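(* Let $n\geq 1$ be an integer and let $K\subset\mathbb{C}$ be a number field. Let $(G,q)=(\mathbb{R}^{n+1},1)$ if $K\subset\mathbb{R}$, and $(G,q)=(\mathbb{C}^{n+1},2)$ if $K\not\subset\mathbb{R}$. Let $\mathbf{u}\in G\setminus\{0\}$. Then for every $j$ with $0\leq j\leq n-1$, \[ \omega_j(K,\mathbf{u})\;\geq\;\hat{\omega}_j(K,\mathbf{u})\;\geq\;\frac{j+1}{n-j}. \]
   Context: $G$ carries its standard inner product $\langle\cdot,\cdot\rangle$ (Euclidean, resp. Hermitian $\langle x,y\rangle=\sum x_i\overline{y_i}$) with norm $\|\cdot\|$. For $X_1,\dots,X_m\in G$, $\|X_1\wedge\dots\wedge X_m\|$ denotes $\big(\det(\langle X_i,X_j\rangle)_{i,j}\big)^{1/2}$. A subspace $S$ of $G$ is defined over $K$ if it has a basis with coordinates in $K$. Let $p=[K:\mathbb{Q}]$ and $\sigma_1,\dots,\sigma_p$ the embeddings $K\to\mathbb{C}$; for $X\in K^{n+1}$, $X^{(i)}$ is obtained by applying $\sigma_i$ coordinatewise. Height: if $S$ is defined over $K$ of dimension $d$ with basis $X_1,\dots,X_d\in K^{n+1}$, let $\mathfrak{a}$ be the fractional ideal of $K$ generated by all $d\times d$ minors of the matrix with rows $X_1,\dots,X_d$; then $H(S)=N_{K/\mathbb{Q}}(\mathfrak{a})^{-1}\prod_{i=1}^p\|X_1^{(i)}\wedge\dots\wedge X_d^{(i)}\|$ (independent of the basis). For nonzero $X,Y\in G$, $\omega(X,Y)=\|X\wedge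 Y\|/(\|X\|\,\|Y\|)$, and for a nonzero subspace $S$, $\omega_1(\mathbf{u},S)=\min_{Y\in S\setminus\{0\}}\omega(\mathbf{u},Y)$. Exponents: for $0\le j\le n-1$, $\omega_j(K,\mathbf{u})$ (resp. $\hat{\omega}_j(K,\mathbf{u})$) is the supremum of all real $\omega$ such that for arbitrarily large $Q$ (resp. for all sufficiently large $Q$) there exists a subspace $S$ of $G$ defined over $K$ of dimension $j+1$ with $H(S)\le Q$ and $H(S)\,\omega_1(\mathbf{u},S)^q\le Q^{-\omega}$. *)

theory Defs
  imports "HOL-Analysis.Analysis" "Jordan_Normal_Form.Determinant"
begin

section \<open>Number fields inside the complex numbers\<close>

definition number_field :: "complex set \<Rightarrow> bool" where
  "number_field K \<longleftrightarrow>
     0 \<in> K \<and> 1 \<in> K \<and>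
     (\<forall>x\<in>K. \<forall>y\<in>K. x + y \<in> K \<and> x - y \<in> K \<and> x * y \<in> K) \<and>
     (\<forall>x\<in>K. inverse x \<in> K) \<and>
     (\<exists>B. finite B \<and> B \<subseteq> K \<and>
        (\<forall>x\<in>K. \<exists>c :: complex \<Rightarrow> rat. x = (\<Sum>b\<in>B. of_rat (c b) * b)))"

text \<open>Extensionality outside \<open>K\<close> makes every embedding \<open>K \<rightarrow> \<complex>\<close> occur exactly once.\<close>

definition embeddings :: "complex set \<Rightarrow> (complex \<Rightarrow> complex) set" where
  "embeddings K = {\<sigma> \<in> extensional K. \<sigma> 1 = 1 \<and>
     (\<forall>x\<in>K. \<forall>y\<in>K. \<sigma> (x + y) = \<sigma> x + \<sigma> y \<and> \<sigma> (x * y) = \<sigma> x * \<sigma> y)}"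

definition ring_of_integers :: "complex set \<Rightarrow> complex set" where
  "ring_of_integers K = {x \<in> K. algebraic_int x}"

definition fractional_ideal_gen :: "complex set \<Rightarrow> complex set \<Rightarrow> complex set" where
  "fractional_ideal_gen K A =
     {(\<Sum>a\<in>B. c a * a) | B c. finite B \<and> B \<subseteq> A \<and> (\<forall>a\<in>B. c a \<in> ring_of_integers K)}"

definition ideal_norm :: "complex set \<Rightarrow> complex set \<Rightarrow> nat" where
  "ideal_norm K I = card (ring_of_integers K //
     {(x, y). x \<in> ring_of_integers K \<and> y \<in> ring_of_integers K \<and> x - y \<in> I})"

text \<open>The norm of a fractional ideal \<open>\<aa>\<close> is \<open>N(d\<aa>) / N(d O\<^sub>K)\<close> for any nonzero \<open>d \<in> O\<^sub>K\<close> with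
  \<open>d\<aa> \<subseteq> O\<^sub>K\<close>; by multiplicativity of the norm on integral ideals, the value does not depend
  on \<open>d\<close>.\<close>

definition fractional_ideal_norm :: "complex set \<Rightarrow> complex set \<Rightarrow> real" where
  "fractional_ideal_norm K \<aa> =
     (SOME r. \<exists>d \<in> ring_of_integers K - {0}. (*) d ` \<aa> \<subseteq> ring_of_integers K \<and>
        r = real (ideal_norm K ((*) d ` \<aa>)) / real (ideal_norm K ((*) d ` ring_of_integers K)))"

section \<open>The ambient space\<close>

text \<open>\<open>\<real>\<^sup>n\<^sup>+\<^sup>1\<close> is regarded as the set of vectors of \<open>\<complex>\<^sup>n\<^sup>+\<^sup>1\<close> with real coordinates; the Hermitian
  product and the norm of \<open>\<complex>\<^sup>n\<^sup>+\<^sup>1\<close> restrict to the Euclidean ones there. Over \<open>\<real>\<close>, spans and linear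
  independence are taken with real coefficients.\<close>

definition ambient :: "complex set \<Rightarrow> (complex ^ 'n) set" where
  "ambient K = (if K \<subseteq> \<real> then {x. \<forall>i. vec_nth x i \<in> \<real>} else UNIV)"

definition ambient_exponent :: "complex set \<Rightarrow> nat" where
  "ambient_exponent K = (if K \<subseteq> \<real> then 1 else 2)"

definition ambient_span :: "complex set \<Rightarrow> (complex ^ 'n) set \<Rightarrow> (complex ^ 'n) set" where
  "ambient_span K B = (if K \<subseteq> \<real> then span B else vec.span B)"

definition ambient_independent :: "complex set \<Rightarrow> (complex ^ 'n) set \<Rightarrow> bool" where
  "ambient_independent K B = (if K \<subseteq> \<real> then independent B else vec.independent B)"

definition rational_basis ::
    "complex set \<Rightarrow> (complex ^ 'n) set \<Rightarrow> (complex ^ 'n) list \<Rightarrow> bool" where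
  "rational_basis K S Xs \<longleftrightarrow>
     (\<forall>X\<in>set Xs. \<forall>i. vec_nth X i \<in> K) \<and>
     distinct Xs \<and> ambient_independent K (set Xs) \<and> S = ambient_span K (set Xs)"

definition rational_subspace :: "complex set \<Rightarrow> nat \<Rightarrow> (complex ^ 'n) set \<Rightarrow> bool" where
  "rational_subspace K d S \<longleftrightarrow> (\<exists>Xs. length Xs = d \<and> rational_basis K S Xs)"

definition hermitian :: "complex ^ 'n \<Rightarrow> complex ^ 'n \<Rightarrow> complex" where
  "hermitian x y = (\<Sum>i\<in>UNIV. vec_nth x i * cnj (vec_nth y i))"

text \<open>A Gram determinant is a nonnegative real number, so taking the real part is harmless.\<close>

definition wedge_norm :: "(complex ^ 'n) list \<Rightarrow> real" where
  "wedge_norm Xs = sqrt (Re (Determinant.det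
     (Matrix.mat (length Xs) (length Xs) (\<lambda>(i, k). hermitian (Xs ! i) (Xs ! k)))))"

section \<open>Heights\<close>

text \<open>Columns are chosen by an injection \<open>f\<close> rather than by an increasing sequence of indices;
  this changes minors only by a sign, hence does not affect the ideal they generate.\<close>

definition maximal_minors :: "(complex ^ 'n) list \<Rightarrow> complex set" where
  "maximal_minors Xs =
     {Determinant.det (Matrix.mat (length Xs) (length Xs) (\<lambda>(i, k). vec_nth (Xs ! i) (f k))) | f.
        inj_on f {..<length Xs}}"

definition conjugate_vec :: "(complex \<Rightarrow> complex) \<Rightarrow> complex ^ 'n \<Rightarrow> complex ^ 'n" where
  "conjugate_vec \<sigma> X = (\<chi> i. \<sigma> (vec_nth X i))"

definition basis_height :: "complex set \<Rightarrow> (complex ^ 'n) list \<Rightarrow> real" where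
  "basis_height K Xs =
     inverse (fractional_ideal_norm K (fractional_ideal_gen K (maximal_minors Xs))) *
     (\<Prod>\<sigma>\<in>embeddings K. wedge_norm (map (conjugate_vec \<sigma>) Xs))"

text \<open>The choice of the basis is immaterial.\<close>

definition height :: "complex set \<Rightarrow> (complex ^ 'n) set \<Rightarrow> real" where
  "height K S = basis_height K (SOME Xs. rational_basis K S Xs)"

section \<open>Angles and exponents of approximation\<close>

definition angle :: "complex ^ 'n \<Rightarrow> complex ^ 'n \<Rightarrow> real" where
  "angle X Y = wedge_norm [X, Y] / (norm X * norm Y)"

text \<open>For a nonzero subspace the infimum is a minimum, by compactness of its unit sphere.\<close>

definition first_angle :: "complex ^ 'n \<Rightarrow> (complex ^ 'n) set \<Rightarrow> real" where
  "first_angle u S = (INF Y\<in>S - {0}. angle u Y)"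

definition approximable :: "complex set \<Rightarrow> complex ^ 'n \<Rightarrow> nat \<Rightarrow> real \<Rightarrow> real \<Rightarrow> bool" where
  "approximable K u j w Q \<longleftrightarrow>
     (\<exists>S. rational_subspace K (j + 1) S \<and> height K S \<le> Q \<and>
          height K S * first_angle u S ^ ambient_exponent K \<le> Q powr (- w))"

text \<open>The exponents may be infinite, hence the extended reals.\<close>

definition exponent :: "complex set \<Rightarrow> nat \<Rightarrow> complex ^ 'n \<Rightarrow> ereal" where
  "exponent K j u = Sup (ereal ` {w. \<exists>\<^sub>F Q in at_top. approximable K u j w Q})"

definition uniform_exponent :: "complex set \<Rightarrow> nat \<Rightarrow> complex ^ 'n \<Rightarrow> ereal" where
  "uniform_exponent K j u = Sup (ereal ` {w. \<forall>\<^sub>F Q in at_top. approximable K u j w Q})"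

end

theory Submission
  imports Defs "Jordan_Normal_Form.Char_Poly"
begin

text \<open>
  Put \<open>p = [K : \<rat>]\<close> and let \<open>q\<close> be the number of embeddings of \<open>K\<close> inducing the given absolute value.
  For a parameter \<open>W \<ge> 1\<close>, measure a point \<open>x\<close> of the lattice \<open>O\<^sub>K\<^sup>n\<^sup>+\<^sup>1\<close> by the maximum over all embeddings
  of its norm, where at the \<open>q\<close> distinguished places the part of \<open>x\<close> transversal to \<open>u\<close> is magnified
  by \<open>W\<close>.  The corresponding successive minima (with respect to \<open>K\<close>-linear independence) satisfy
  \<open>(L\<^sub>0 \<cdots> L\<^sub>n)\<^sup>p \<le> C W\<^sup>q\<^sup>n\<close>, the upper bound in Minkowski's second theorem.  Let \<open>S\<close> be spanned by
  points realising the first \<open>d = j + 1\<close> minima, and let \<open>P\<close> be the product of these minima.  Since the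
  transversal parts are small, \<open>H(S) \<le> C P\<^sup>p W\<^sup>-\<^sup>(\<^sup>d\<^sup>-\<^sup>1\<^sup>)\<^sup>q\<close> and \<open>H(S) \<omega>\<^sub>1(u, S)\<^sup>q \<le> C P\<^sup>p W\<^sup>-\<^sup>d\<^sup>q\<close>, while
  \<open>P\<^sup>n\<^sup>+\<^sup>1 \<le> (L\<^sub>0 \<cdots> L\<^sub>n)\<^sup>d\<close>.  Choosing \<open>W\<close> as a power of \<open>Q\<close> gives the exponent \<open>(j + 1) / (n - j)\<close>.

  Only inequalities up to constants are needed, so all lattice point counts are pigeonhole arguments
  with boxes, resting on the fact that a nonzero algebraic integer has norm at least \<open>1\<close>.
\<close>

text \<open>The transversal part of \<open>x\<close> is \<open>x - (x_l / u_l) u\<close> for one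
  fixed coordinate with \<open>u_l \<noteq> 0\<close>, not an orthogonal projection. Replacing the
  other coordinates of \<open>x\<close> by those of this part is a unipotent map, so the
  magnification alone changes the volume, by \<open>W^n\<close> at each distinguished place; hence
  the \<open>W^(qn)\<close> in the bound for the minima. There a volume spanned by \<open>d\<close>
  points gains \<open>1/W\<close> for each of the \<open>d - 1\<close> vectors that can be made
  transversal, and the angle of the remaining one with \<open>u\<close> gains one more. The
  exponents balance as follows. As \<open>P^p\<close> is at most a constant times
  \<open>W^(qnd/(n+1))\<close>, the height has exponent
  \<open>e1 = qnd/(n+1) - (d-1)q = q(n-j)/(n+1)\<close> in \<open>W\<close>, and its product with
  the angle power has exponent \<open>-e2\<close> with \<open>e2 = q(j+1)/(n+1)\<close>; the
  quotient \<open>e2/e1\<close> is \<open>(j+1)/(n-j)\<close>. Two obstacles shape the rest. The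
  maps at the various places respect only combinations over \<open>K\<close>, so coefficients must
  be placed in \<open>K\<close> before an embedding is applied. And \<open>height\<close> evaluates
  an unspecified basis, so a change of basis has to be followed through the ideal norm and all
  conjugates at once.\<close>

abbreviation (input) "Det \<equiv> Determinant.det"

lemmas cart_eq_iff = Finite_Cartesian_Product.vec_eq_iff

section \<open>Algebraic integers\<close>

text \<open>The vector of the \<open>v i\<close> is an eigenvector, with eigenvalue
  \<open>x\<close>, of the integer matrix of the coefficients, so \<open>x\<close> is a root of a
  monic integral characteristic polynomial. One nonzero entry makes it an eigenvector; the entries
  may be dependent, so any family of monomials can be used.\<close>

lemma algebraic_int_if_nat_stable:
  fixes v :: "nat \<Rightarrow> complex"
  assumes "i0 < n" and "v i0 \<noteq> 0"
    and "\<And>i. i < n \<Longrightarrow> \<exists>c :: nat \<Rightarrow> int. x * v i = (\<Sum>j<n. of_int (c j) * v j)"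
  shows "algebraic_int x"
proof -
  have "\<forall>i. \<exists>c :: nat \<Rightarrow> int. i < n \<longrightarrow> x * v i = (\<Sum>j<n. of_int (c j) * v j)"
    using assms(3) by blast
  then obtain c :: "nat \<Rightarrow> nat \<Rightarrow> int"
    where c: "\<And>i. i < n \<Longrightarrow> x * v i = (\<Sum>j<n. of_int (c i j) * v j)"
    by metis
  define A where "A = Matrix.mat n n (\<lambda>(i, j). c i j)"
  define A' where "A' = map_mat (of_int :: int \<Rightarrow> complex) A"
  have A: "A \<in> carrier_mat n n" and A': "A' \<in> carrier_mat n n"
    by (auto simp: A_def A'_def)
  define w where "w = Matrix.vec n v"
  have "w \<noteq> 0\<^sub>v n"
    using assms(1,2) by (metis index_vec index_zero_vec(1) w_def)
  moreover have "A' *\<^sub>v w = x \<cdot>\<^sub>v w"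
    by (rule eq_vecI)
      (auto simp: A'_def A_def w_def scalar_prod_def c lessThan_atLeast0)
  ultimately have "eigenvalue A' x"
    using A' unfolding eigenvalue_def eigenvector_def by (intro exI[of _ w]) (auto simp: w_def)
  hence "poly (char_poly A') x = 0"
    using eigenvalue_root_char_poly[OF A'] by simp
  moreover have "char_poly A' = map_poly of_int (char_poly A)"
    unfolding A'_def by (rule of_int_hom.char_poly_hom[OF A])
  moreover have "lead_coeff (char_poly A) = 1"
    using degree_monic_char_poly[OF A] by simp
  ultimately show ?thesis
    by (auto simp: algebraic_int_altdef_ipoly)
qed

lemma algebraic_int_if_stable:
  fixes v :: "'i \<Rightarrow> complex"
  assumes "finite I" and "i0 \<in> I" and "v i0 \<noteq> 0"
    and "\<And>i. i \<in> I \<Longrightarrow> \<exists>c :: 'i \<Rightarrow> int. x * v i = (\<Sum>j\<in>I. of_int (c j) * v j)"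
  shows "algebraic_int x"
proof -
  obtain h where h: "bij_betw h {..<card I} I"
    using ex_bij_betw_nat_finite[OF assms(1)] by (auto simp: lessThan_atLeast0)
  then obtain k0 where k0: "k0 < card I" "h k0 = i0"
    using assms(2) unfolding bij_betw_def by (metis imageE lessThan_iff)
  show ?thesis
  proof (rule algebraic_int_if_nat_stable[of k0 "card I" "v \<circ> h"])
    fix k assume "k < card I"
    hence "h k \<in> I" using h by (auto simp: bij_betw_def)
    then obtain c :: "'i \<Rightarrow> int" where "x * v (h k) = (\<Sum>j\<in>I. of_int (c j) * v j)"
      using assms(4) by blast
    also have "\<dots> = (\<Sum>j<card I. of_int (c (h j)) * v (h j))"
      by (rule sum.reindex_bij_betw[OF h, symmetric])
    finally show "\<exists>c :: nat \<Rightarrow> int. x * (v \<circ> h) k = (\<Sum>j<card I. of_int (c j) * (v \<circ> h) j)"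
      by (intro exI[of _ "c \<circ> h"]) simp
  qed (use k0 assms(3) in auto)
qed

lemma power_times_self:
  fixes x :: complex
  assumes "x ^ n = (\<Sum>k<n. of_int (e k) * x ^ k)" and "i < n"
  shows "\<exists>c :: nat \<Rightarrow> int. x * x ^ i = (\<Sum>k<n. of_int (c k) * x ^ k)"
proof (cases "Suc i = n")
  case True
  hence "x * x ^ i = x ^ n" by auto
  thus ?thesis using assms(1) by metis
next
  case False
  have "(\<Sum>k<n. of_int (if k = Suc i then 1 else 0) * x ^ k) = (\<Sum>k<n. if k = Suc i then x ^ k else 0)"
    by (intro sum.cong) auto
  also have "\<dots> = x * x ^ i" using False assms(2) by simp
  finally show ?thesis by (intro exI[of _ "\<lambda>k. if k = Suc i then 1 else 0"]) simp
qed

lemma algebraic_int_power_reduction: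
  fixes x :: complex
  assumes "algebraic_int x"
  obtains n c where "n > 0" and "\<And>i. i < n \<Longrightarrow> x * x ^ i = (\<Sum>k<n. of_int (c i k) * x ^ k)"
proof -
  obtain p where p: "poly (map_poly of_int p) x = 0" "lead_coeff p = 1"
    using assms by (auto simp: algebraic_int_altdef_ipoly)
  define n where "n = degree p"
  have n: "n > 0"
  proof (rule ccontr)
    assume "\<not> n > 0"
    hence "p = [:1:]"
      using p(2) by (auto simp: n_def elim: degree_eq_zeroE)
    thus False using p(1) by simp
  qed
  have "(\<Sum>i\<le>n. of_int (coeff p i) * x ^ i) = 0"
    using p(1) by (simp add: poly_altdef n_def degree_map_poly coeff_map_poly)
  hence "x ^ n = (\<Sum>i<n. of_int (- coeff p i) * x ^ i)"
    using p(2) by (simp add: n_def lessThan_Suc_atMost[symmetric] add_eq_0_iff sum_negf)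
  from power_times_self[OF this]
  have "\<forall>i. \<exists>c :: nat \<Rightarrow> int. i < n \<longrightarrow> x * x ^ i = (\<Sum>k<n. of_int (c k) * x ^ k)"
    by blast
  then obtain c :: "nat \<Rightarrow> nat \<Rightarrow> int"
    where "\<And>i. i < n \<Longrightarrow> x * x ^ i = (\<Sum>k<n. of_int (c i k) * x ^ k)"
    by metis
  thus ?thesis using that n by blast
qed

text \<open>The monomials \<open>x ^ i * y ^ j\<close> with exponents below the degrees of monic
  relations for \<open>x\<close> and \<open>y\<close> span a module stable under multiplication by
  \<open>x\<close> and by \<open>y\<close>, hence by their sum and product.\<close>

lemma
  fixes x y :: complex
  assumes "algebraic_int x" and "algebraic_int y"
  shows algebraic_int_add: "algebraic_int (x + y)"
    and algebraic_int_mult: "algebraic_int (x * y)"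
proof -
  obtain n c where n: "n > 0" and c: "\<And>i. i < n \<Longrightarrow> x * x ^ i = (\<Sum>k<n. of_int (c i k) * x ^ k)"
    using algebraic_int_power_reduction[OF assms(1)] by metis
  obtain m d where m: "m > 0" and d: "\<And>i. i < m \<Longrightarrow> y * y ^ i = (\<Sum>k<m. of_int (d i k) * y ^ k)"
    using algebraic_int_power_reduction[OF assms(2)] by metis
  define v where "v = (\<lambda>(i, j). x ^ i * y ^ j)"
  let ?I = "{..<n} \<times> {..<m}"
  show "algebraic_int (x + y)"
  proof (rule algebraic_int_if_stable[of ?I "(0, 0)" v])
    fix ij assume "ij \<in> ?I"
    then obtain i j where ij: "ij = (i, j)" "i < n" "j < m" by auto
    \<comment> \<open>Multiplication by \<open>x\<close> moves only the first exponent and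
      multiplication by \<open>y\<close> only the second, so the image is supported on the two lines
      through \<open>(i, j)\<close>.\<close>
    let ?c = "\<lambda>(k, l). (if l = j then c i k else 0) + (if k = i then d j l else 0)"
    have "(\<Sum>kl\<in>?I. of_int (?c kl) * v kl)
        = (\<Sum>k<n. \<Sum>l<m. of_int (?c (k, l)) * v (k, l))"
      by (simp only: sum.cartesian_product')
    also have "\<dots> = (\<Sum>k<n. \<Sum>l<m. (if l = j then of_int (c i k) * v (k, l) else 0))
        + (\<Sum>k<n. \<Sum>l<m. (if k = i then of_int (d j l) * v (k, l) else 0))"
      unfolding sum.distrib[symmetric] by (intro sum.cong) (auto simp: algebra_simps)
    also have "(\<Sum>k<n. \<Sum>l<m. (if l = j then of_int (c i k) * v (k, l) else 0))
        = (\<Sum>k<n. of_int (c i k) * x ^ k) * y ^ j"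
      using ij by (simp add: v_def sum_distrib_right mult.assoc)
    also have "(\<Sum>k<n. \<Sum>l<m. (if k = i then of_int (d j l) * v (k, l) else 0))
        = (\<Sum>l<m. \<Sum>k<n. (if k = i then of_int (d j l) * v (k, l) else 0))"
      by (rule sum.swap)
    also have "\<dots> = (\<Sum>l<m. of_int (d j l) * y ^ l) * x ^ i"
      using ij by (simp add: v_def sum_distrib_left sum_distrib_right mult_ac)
    finally have "(\<Sum>kl\<in>?I. of_int (?c kl) * v kl) = x * x ^ i * y ^ j + y * y ^ j * x ^ i"
      by (simp only: c[OF ij(2)] d[OF ij(3)])
    hence "(x + y) * v ij = (\<Sum>kl\<in>?I. of_int (?c kl) * v kl)"
      using ij by (simp add: v_def algebra_simps)
    thus "\<exists>c :: nat \<times> nat \<Rightarrow> int. (x + y) * v ij = (\<Sum>j\<in>?I. of_int (c j) * v j)" by blast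
  qed (use n m in \<open>auto simp: v_def\<close>)
  show "algebraic_int (x * y)"
  proof (rule algebraic_int_if_stable[of ?I "(0, 0)" v])
    fix ij assume "ij \<in> ?I"
    then obtain i j where ij: "ij = (i, j)" "i < n" "j < m" by auto
    let ?c = "\<lambda>(k, l). c i k * d j l"
    have "(\<Sum>kl\<in>?I. of_int (?c kl) * v kl)
        = (\<Sum>k<n. \<Sum>l<m. of_int (?c (k, l)) * v (k, l))"
      by (simp only: sum.cartesian_product')
    also have "\<dots> = (\<Sum>k<n. of_int (c i k) * x ^ k) * (\<Sum>l<m. of_int (d j l) * y ^ l)"
      unfolding sum_product by (intro sum.cong) (auto simp: v_def)
    finally have "(x * y) * v ij = (\<Sum>kl\<in>?I. of_int (?c kl) * v kl)"
      using ij by (simp add: c[symmetric] d[symmetric] v_def)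
    thus "\<exists>c :: nat \<times> nat \<Rightarrow> int. (x * y) * v ij = (\<Sum>j\<in>?I. of_int (c j) * v j)" by blast
  qed (use n m in \<open>auto simp: v_def\<close>)
qed

section \<open>Evaluation of rational polynomials at complex numbers\<close>

interpretation of_rat_poly_hom: map_poly_inj_idom_hom "of_rat :: rat \<Rightarrow> complex" ..

abbreviation rat_poly :: "rat poly \<Rightarrow> complex \<Rightarrow> complex" where
  "rat_poly h x \<equiv> poly (map_poly of_rat h) x"

lemma rat_poly_add: "rat_poly (f + g) x = rat_poly f x + rat_poly g x"
  by (simp add: of_rat_poly_hom.hom_add)
lemma rat_poly_diff: "rat_poly (f - g) x = rat_poly f x - rat_poly g x"
  by (simp add: of_rat_poly_hom.hom_minus)
lemma rat_poly_mult: "rat_poly (f * g) x = rat_poly f x * rat_poly g x"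
  by (simp add: of_rat_poly_hom.hom_mult)
lemma rat_poly_pCons: "rat_poly (pCons a f) x = of_rat a + x * rat_poly f x"
  by (simp add: of_rat_hom.map_poly_pCons_hom)
lemma rat_poly_sum_coeff: "degree f < n \<Longrightarrow> rat_poly f x = (\<Sum>i<n. of_rat (coeff f i) * x ^ i)"
  apply (simp add: poly_altdef)
  apply (rule sum.mono_neutral_left)
  apply (auto simp: coeff_eq_0)
  done
lemma pderiv_rat: "pderiv (map_poly (of_rat :: rat \<Rightarrow> complex) f) = map_poly of_rat (pderiv f)"
  by (simp add: of_rat_hom.map_poly_pderiv)

section \<open>Primitive elements\<close>

text \<open>A generator of the ideal of rational polynomials vanishing at \<open>x\<close>, with no
  normalised leading coefficient. Divisibility and comparison of degrees do the work of
  irreducibility.\<close>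

definition is_min_poly :: "rat poly \<Rightarrow> complex \<Rightarrow> bool" where
  "is_min_poly f x \<longleftrightarrow> f \<noteq> 0 \<and> rat_poly f x = 0 \<and> (\<forall>g. rat_poly g x = 0 \<longrightarrow> f dvd g)"

lemma min_poly_exists:
  assumes "h \<noteq> 0" and "rat_poly h x = 0"
  obtains f where "is_min_poly f x"
proof -
  let ?P = "\<lambda>f. f \<noteq> 0 \<and> rat_poly f x = 0"
  obtain f where f: "?P f" and least: "\<And>g. ?P g \<Longrightarrow> degree f \<le> degree g"
    using ex_has_least_nat[of ?P h degree] assms by blast
  have "f dvd g" if g: "rat_poly g x = 0" for g
  proof (rule ccontr)
    assume "\<not> f dvd g"
    hence "g mod f \<noteq> 0" by (simp add: dvd_eq_mod_eq_0)
    moreover have "rat_poly (g mod f) x = 0"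
      using g f rat_poly_add[of "g div f * f" "g mod f" x] by (simp add: rat_poly_mult)
    ultimately show False
      using least[of "g mod f"] degree_mod_less[of f g] f by auto
  qed
  thus ?thesis using f that unfolding is_min_poly_def by blast
qed

lemma degree_min_poly_pos:
  assumes "is_min_poly f x"
  shows "degree f > 0"
proof (rule ccontr)
  assume "\<not> degree f > 0"
  then obtain a where "f = [:a:]" by (auto elim: degree_eq_zeroE)
  thus False using assms by (auto simp: is_min_poly_def rat_poly_pCons)
qed

lemma min_poly_degree_le:
  assumes "is_min_poly f x" and "g \<noteq> 0" and "rat_poly g x = 0"
  shows "degree f \<le> degree g"
  using assms by (auto simp: is_min_poly_def dvd_imp_degree_le)

text \<open>Let \<open>g\<close> be a minimal polynomial of the root \<open>r\<close> and
  \<open>f = g * k\<close>. The cofactor \<open>k\<close> has too small a degree to vanish at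
  \<open>x\<close>, so \<open>g\<close> does, and \<open>g\<close> has the full degree of
  \<open>f\<close>. If the derivative of \<open>f\<close> vanished at \<open>r\<close>, then
  \<open>g\<close> would divide a polynomial of smaller degree.\<close>

lemma min_poly_simple_root:
  assumes f: "is_min_poly f x" and root: "rat_poly f r = 0"
  shows "rat_poly (pderiv f) r \<noteq> 0"
proof
  assume deriv: "rat_poly (pderiv f) r = 0"
  have f0: "f \<noteq> 0" using f by (simp add: is_min_poly_def)
  obtain g where g: "is_min_poly g r"
    using min_poly_exists[OF f0 root] .
  have "g dvd f" using g root by (simp add: is_min_poly_def)
  then obtain k where k: "f = g * k" by blast
  have gk: "g \<noteq> 0" "k \<noteq> 0" using f0 k by auto
  have "rat_poly g x * rat_poly k x = 0"
    using f k by (simp add: is_min_poly_def rat_poly_mult[symmetric])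
  moreover have "rat_poly k x \<noteq> 0"
    using min_poly_degree_le[OF f gk(2)] degree_min_poly_pos[OF g] gk k by (auto simp: degree_mult_eq)
  ultimately have "degree f \<le> degree g"
    using min_poly_degree_le[OF f gk(1)] by auto
  moreover have "pderiv f \<noteq> 0"
    using degree_min_poly_pos[OF f] by (simp add: pderiv_eq_0_iff)
  hence "degree g \<le> degree (pderiv f)"
    using min_poly_degree_le[OF g] deriv by simp
  ultimately show False
    using degree_min_poly_pos[OF f] by (simp add: degree_pderiv)
qed

lemma card_roots_min_poly:
  assumes "is_min_poly f x"
  shows "finite {r. rat_poly f r = 0}" and "card {r. rat_poly f r = 0} = degree f"
proof -
  let ?F = "map_poly of_rat f :: complex poly"
  have F0: "?F \<noteq> 0" using assms by (simp add: is_min_poly_def)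
  have "rsquarefree ?F"
    unfolding rsquarefree_roots using min_poly_simple_root[OF assms] by (auto simp: pderiv_rat)
  hence "?F = Polynomial.smult (lead_coeff ?F) (\<Prod>z|poly ?F z = 0. [:-z, 1:])"
    by (rule complex_poly_decompose_rsquarefree[symmetric])
  hence "degree ?F = degree (\<Prod>z|poly ?F z = 0. [:-z, 1:])"
    using F0 by (metis degree_smult_eq leading_coeff_0_iff)
  also have "\<dots> = card {r. rat_poly f r = 0}"
    by (subst degree_prod_eq_sum_degree) auto
  finally show "card {r. rat_poly f r = 0} = degree f" by simp
  show "finite {r. rat_poly f r = 0}" by (rule poly_roots_finite[OF F0])
qed

definition rat_adjoin :: "complex \<Rightarrow> complex set" where
  "rat_adjoin x = range (\<lambda>h. rat_poly h x)"

lemma rat_adjoinI: "rat_poly h x \<in> rat_adjoin x"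
  by (auto simp: rat_adjoin_def)

lemma rat_adjoin_add: "a \<in> rat_adjoin x \<Longrightarrow> b \<in> rat_adjoin x \<Longrightarrow> a + b \<in> rat_adjoin x"
  unfolding rat_adjoin_def by (auto simp: rat_poly_add[symmetric])

lemma rat_adjoin_diff: "a \<in> rat_adjoin x \<Longrightarrow> b \<in> rat_adjoin x \<Longrightarrow> a - b \<in> rat_adjoin x"
  unfolding rat_adjoin_def by (auto simp: rat_poly_diff[symmetric])

lemma rat_adjoin_mult: "a \<in> rat_adjoin x \<Longrightarrow> b \<in> rat_adjoin x \<Longrightarrow> a * b \<in> rat_adjoin x"
  unfolding rat_adjoin_def by (auto simp: rat_poly_mult[symmetric])

lemma rat_adjoin_of_rat: "of_rat c \<in> rat_adjoin x"
  using rat_adjoinI[of "[:c:]" x] by (simp add: rat_poly_pCons)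

lemma rat_adjoin_self: "x \<in> rat_adjoin x"
  using rat_adjoinI[of "[:0, 1:]" x] by (simp add: rat_poly_pCons)

lemma rat_adjoin_sum: "(\<And>i. i \<in> I \<Longrightarrow> a i \<in> rat_adjoin x) \<Longrightarrow> (\<Sum>i\<in>I. a i) \<in> rat_adjoin x"
  using rat_adjoin_of_rat[of 0 x]
  by (induction I rule: infinite_finite_induct) (auto intro: rat_adjoin_add)

lemma rat_poly_in_rat_adjoin: "y \<in> rat_adjoin x \<Longrightarrow> rat_poly h y \<in> rat_adjoin x"
proof (induction h)
  case 0
  thus ?case using rat_adjoin_of_rat[of 0] by simp
next
  case (pCons a h)
  thus ?case by (simp add: rat_poly_pCons rat_adjoin_add rat_adjoin_mult rat_adjoin_of_rat)
qed

lemma rat_adjoin_trans: "y \<in> rat_adjoin x \<Longrightarrow> rat_adjoin y \<subseteq> rat_adjoin x"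
  using rat_poly_in_rat_adjoin unfolding rat_adjoin_def[of y] by blast

text \<open>The constant term of a minimal polynomial of \<open>y \<noteq> 0\<close> is nonzero,
  since otherwise a factor \<open>y\<close> could be cancelled; solving the equation for that term
  exhibits the inverse.\<close>

lemma inverse_in_rat_adjoin:
  assumes "h \<noteq> 0" and "rat_poly h y = 0"
  shows "inverse y \<in> rat_adjoin y"
proof (cases "y = 0")
  case True
  thus ?thesis using rat_adjoin_of_rat[of 0] by simp
next
  case False
  obtain g where g: "is_min_poly g y" using min_poly_exists[OF assms] .
  obtain a g' where g': "g = pCons a g'" by (cases g)
  have "a \<noteq> 0"
  proof
    assume "a = 0"
    hence "rat_poly g' y = 0" "g' \<noteq> 0"
      using g g' False by (auto simp: is_min_poly_def rat_poly_pCons)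
    thus False using min_poly_degree_le[OF g] g' by force
  qed
  have "of_rat a + y * rat_poly g' y = 0"
    using g g' by (simp add: is_min_poly_def rat_poly_pCons)
  hence "inverse y = of_rat (- inverse a) * rat_poly g' y"
    using False \<open>a \<noteq> 0\<close> by (simp add: field_simps of_rat_minus of_rat_divide add_eq_0_iff)
  thus ?thesis by (metis rat_adjoin_mult rat_adjoin_of_rat rat_adjoinI)
qed

interpretation Q: vector_space "\<lambda>(q::rat) (x::complex). of_rat q * x"
  by unfold_locales (auto simp: algebra_simps of_rat_add of_rat_mult)

locale num_field =
  fixes K :: "complex set"
  assumes nf: "number_field K"
begin

lemma zero_K: "0 \<in> K" and one_K: "1 \<in> K"
  and add_K: "x \<in> K \<Longrightarrow> y \<in> K \<Longrightarrow> x + y \<in> K"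
  and diff_K: "x \<in> K \<Longrightarrow> y \<in> K \<Longrightarrow> x - y \<in> K"
  and mult_K: "x \<in> K \<Longrightarrow> y \<in> K \<Longrightarrow> x * y \<in> K"
  and inverse_K: "x \<in> K \<Longrightarrow> inverse x \<in> K"
  using nf by (auto simp: number_field_def)

lemma minus_K: "x \<in> K \<Longrightarrow> - x \<in> K"
  using diff_K[OF zero_K] by simp

lemma divide_K: "x \<in> K \<Longrightarrow> y \<in> K \<Longrightarrow> x / y \<in> K"
  by (simp add: divide_inverse inverse_K mult_K)

lemma power_K: "x \<in> K \<Longrightarrow> x ^ k \<in> K"
  by (induction k) (auto simp: one_K mult_K)

lemma sum_K: "(\<And>i. i \<in> I \<Longrightarrow> a i \<in> K) \<Longrightarrow> (\<Sum>i\<in>I. a i) \<in> K"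
  by (induction I rule: infinite_finite_induct) (auto simp: zero_K add_K)

lemma prod_K: "(\<And>i. i \<in> I \<Longrightarrow> a i \<in> K) \<Longrightarrow> (\<Prod>i\<in>I. a i) \<in> K"
  by (induction I rule: infinite_finite_induct) (auto simp: one_K mult_K)

lemma of_nat_K: "of_nat k \<in> K"
  by (induction k) (auto simp: zero_K one_K add_K)

lemma of_int_K: "of_int k \<in> K"
  by (cases k) (auto simp del: of_nat_Suc intro: of_nat_K minus_K)

lemma of_rat_K: "of_rat c \<in> K"
  by (cases c) (auto simp: of_rat_rat of_int_K divide_K)

lemma rat_poly_K: "x \<in> K \<Longrightarrow> rat_poly h x \<in> K"
  by (induction h) (auto simp: zero_K rat_poly_pCons add_K mult_K of_rat_K)

lemma rat_adjoin_subset_K: "x \<in> K \<Longrightarrow> rat_adjoin x \<subseteq> K"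
  by (auto simp: rat_adjoin_def rat_poly_K)

text \<open>The \<open>card B + 1\<close> powers of \<open>x\<close> lie in a space spanned by
  \<open>card B\<close> elements. Either they are distinct and hence dependent, or two of them
  coincide, which is a relation already; as a set they would lose this repetition.\<close>

lemma rat_poly_root:
  assumes "x \<in> K"
  obtains h where "h \<noteq> 0" and "rat_poly h x = 0"
proof -
  obtain B where B: "finite B" "B \<subseteq> K"
    "\<And>y. y \<in> K \<Longrightarrow> \<exists>c :: complex \<Rightarrow> rat. y = (\<Sum>b\<in>B. of_rat (c b) * b)"
    using nf unfolding number_field_def by metis
  have span: "K \<subseteq> Q.span B"
  proof
    fix y assume "y \<in> K"
    then obtain c :: "complex \<Rightarrow> rat" where "y = (\<Sum>b\<in>B. of_rat (c b) * b)" using B(3) by blast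
    moreover have "(\<Sum>b\<in>B. of_rat (c b) * b) \<in> Q.span B"
      by (intro Q.span_sum Q.span_scale Q.span_base)
    ultimately show "y \<in> Q.span B" by simp
  qed
  let ?I = "{..card B}"
  show ?thesis
  proof (cases "inj_on (\<lambda>i. x ^ i) ?I")
    case True
    let ?S = "(\<lambda>i. x ^ i) ` ?I"
    have "card ?S = Suc (card B)" using card_image[OF True] by simp
    moreover have "?S \<subseteq> Q.span B" using power_K[OF assms] span by auto
    ultimately have "Q.dependent ?S"
      using Q.independent_span_bound[OF B(1), of ?S] by auto
    then obtain u where u: "\<exists>v\<in>?S. u v \<noteq> 0" "(\<Sum>v\<in>?S. of_rat (u v) * v) = 0"
      by (auto simp: Q.dependent_finite)
    define h where "h = (\<Sum>i\<in>?I. Polynomial.monom (u (x ^ i)) i)"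
    have coeff: "coeff h k = (if k \<in> ?I then u (x ^ k) else 0)" for k
      by (simp add: h_def coeff_sum)
    have "h \<noteq> 0"
    proof -
      obtain k where "k \<in> ?I" "u (x ^ k) \<noteq> 0" using u(1) by auto
      hence "coeff h k \<noteq> 0" by (simp add: coeff)
      thus ?thesis by auto
    qed
    moreover have "degree h < Suc (card B)"
      by (intro le_imp_less_Suc degree_le) (auto simp: coeff)
    hence "rat_poly h x = (\<Sum>i\<in>?I. of_rat (u (x ^ i)) * x ^ i)"
      by (subst rat_poly_sum_coeff[of _ "Suc (card B)"]) (auto simp: coeff lessThan_Suc_atMost)
    hence "rat_poly h x = 0"
      using u(2) by (simp add: sum.reindex[OF True])
    ultimately show ?thesis using that by blast
  next
    case False
    then obtain i j where ij: "x ^ i = x ^ j" "i \<noteq> j" by (auto simp: inj_on_def)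
    let ?h = "Polynomial.monom 1 i - Polynomial.monom 1 j :: rat poly"
    have "coeff ?h i \<noteq> 0" using ij by simp
    hence "?h \<noteq> 0" by (metis coeff_0)
    moreover have "rat_poly ?h x = 0"
      using ij by (simp add: rat_poly_diff poly_monom)
    ultimately show ?thesis using that by blast
  qed
qed

lemma min_poly_K:
  assumes "x \<in> K"
  obtains f where "is_min_poly f x"
  using min_poly_exists rat_poly_root[OF assms] by metis

text \<open>The classical argument: for all but finitely many rational \<open>c\<close>, the element
  \<open>s = t + c a\<close> generates both. A polynomial \<open>m\<close> of least degree over
  \<open>rat_adjoin s\<close> that vanishes at \<open>a\<close> divides both \<open>g\<close> and
  \<open>h\<close>, the composite of \<open>f\<close> with \<open>s - c z\<close>. As these share
  only the root \<open>a\<close>, which is simple for \<open>g\<close>, \<open>m\<close> is linear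
  and its coefficients give \<open>a\<close>.\<close>

lemma primitive_element_pair:
  assumes "t \<in> K" and "a \<in> K"
  shows "\<exists>s\<in>K. t \<in> rat_adjoin s \<and> a \<in> rat_adjoin s"
proof -
  obtain f where f: "is_min_poly f t" using min_poly_K[OF assms(1)] .
  obtain g where g: "is_min_poly g a" using min_poly_K[OF assms(2)] .
  \<comment> \<open>The \<open>c\<close> for which some other pair of conjugates satisfies
    \<open>r + c b = t + c a\<close>. Pairs with \<open>b = a\<close> contribute only the harmless
    value 0, from division by zero.\<close>
  define bad where "bad = (\<lambda>(r, b). (r - t) / (a - b)) ` ({r. rat_poly f r = 0} \<times> {b. rat_poly g b = 0})"
  have "finite bad"
    unfolding bad_def using card_roots_min_poly(1)[OF f] card_roots_min_poly(1)[OF g] by simp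
  moreover have "infinite (range (of_rat :: rat \<Rightarrow> complex))"
    using finite_imageD[of "of_rat :: rat \<Rightarrow> complex" UNIV] by (auto simp: inj_def infinite_UNIV_char_0)
  ultimately obtain c :: rat where c: "of_rat c \<notin> bad"
    by (metis finite_subset image_subset_iff)
  define s where "s = t + of_rat c * a"
  have s: "s \<in> K" by (simp add: s_def assms add_K mult_K of_rat_K)
  \<comment> \<open>The polynomials with coefficients in \<open>rat_adjoin s\<close>, carried as a
    subset of the complex polynomials because this field is a set and not a type.\<close>
  define PF where "PF = {m :: complex poly. \<forall>i. coeff m i \<in> rat_adjoin s}"
  have PF_0: "0 \<in> PF" using rat_adjoin_of_rat[of 0 s] by (simp add: PF_def)
  have PF_add: "m + m' \<in> PF" if "m \<in> PF" "m' \<in> PF" for m m'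
    using that by (auto simp: PF_def rat_adjoin_add)
  have PF_diff: "m - m' \<in> PF" if "m \<in> PF" "m' \<in> PF" for m m'
    using that by (auto simp: PF_def rat_adjoin_diff)
  have PF_mult: "m * m' \<in> PF" if "m \<in> PF" "m' \<in> PF" for m m'
    using that by (auto simp: PF_def coeff_mult intro!: rat_adjoin_sum rat_adjoin_mult)
  have PF_pCons: "pCons b m \<in> PF" if "b \<in> rat_adjoin s" "m \<in> PF" for b m
    using that by (auto simp: PF_def coeff_pCons split: nat.splits)
  have PF_monom: "Polynomial.monom b k \<in> PF" if "b \<in> rat_adjoin s" for b k
    using that rat_adjoin_of_rat[of 0 s] by (auto simp: PF_def)
  have PF_rat: "map_poly of_rat h \<in> PF" for h
    by (auto simp: PF_def coeff_map_poly rat_adjoin_of_rat)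
  define h where "h = pcompose (map_poly of_rat f) [:s, - of_rat c:]"
  have h: "h \<in> PF"
  proof -
    have lin: "[:s, - of_rat c:] \<in> PF"
      using rat_adjoin_self[of s] rat_adjoin_of_rat[of "- c" s]
      by (auto intro!: PF_pCons PF_0 simp: of_rat_minus)
    have "pcompose (map_poly of_rat f') [:s, - of_rat c:] \<in> PF" for f'
    proof (induction f')
      case (pCons b f')
      show ?case
        unfolding of_rat_hom.map_poly_pCons_hom pcompose_pCons
        by (intro PF_add PF_mult PF_pCons rat_adjoin_of_rat lin PF_0 pCons.IH)
    qed (simp add: PF_0)
    thus ?thesis by (simp add: h_def)
  qed
  have h_eval: "poly h z = rat_poly f (s - of_rat c * z)" for z
    by (simp add: h_def poly_pcompose mult.commute)
  let ?P = "\<lambda>m. m \<in> PF \<and> m \<noteq> 0 \<and> poly m a = 0"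
  let ?g = "map_poly of_rat g :: complex poly"
  have "?P ?g" using g PF_rat[of g] by (simp add: is_min_poly_def)
  then obtain m where m: "?P m" and least: "\<And>m'. ?P m' \<Longrightarrow> degree m \<le> degree m'"
    using ex_has_least_nat[of ?P ?g degree] by blast
  have inv: "inverse y \<in> rat_adjoin s" if "y \<in> rat_adjoin s" for y
  proof -
    have "y \<in> K" using that rat_adjoin_subset_K[OF s] by blast
    then obtain h where "h \<noteq> 0" "rat_poly h y = 0" using rat_poly_root by metis
    thus ?thesis using inverse_in_rat_adjoin rat_adjoin_trans[OF that] by blast
  qed
  \<comment> \<open>Division with remainder inside \<open>PF\<close>; the leading coefficient of
    \<open>m\<close> can be inverted there by \<open>inv\<close>.\<close>
  have dvd: "m dvd k" if "k \<in> PF" "poly k a = 0" for k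
    using that
  proof (induction "degree k" arbitrary: k rule: less_induct)
    case less
    show ?case
    proof (cases "k = 0")
      case False
      hence deg: "degree m \<le> degree k" using least less.prems by blast
      define b where "b = lead_coeff k / lead_coeff m"
      have b: "b \<in> rat_adjoin s"
        using less.prems m inv unfolding b_def divide_inverse
        by (auto simp: PF_def intro!: rat_adjoin_mult)
      let ?q = "Polynomial.monom b (degree k - degree m)"
      define k' where "k' = k - ?q * m"
      have k': "k' \<in> PF" "poly k' a = 0"
        using less.prems m b unfolding k'_def by (auto intro: PF_diff PF_mult PF_monom)
      have dm: "degree m > 0"
      proof (rule ccontr)
        assume "\<not> degree m > 0"
        then obtain e where "m = [:e:]" by (auto elim: degree_eq_zeroE)
        thus False using m by auto
      qed
      have "coeff k' (degree k) = 0"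
        using m deg by (simp add: k'_def b_def coeff_monom_mult)
      moreover have "degree k' \<le> degree k"
        unfolding k'_def
        by (intro degree_diff_le order.refl order.trans[OF degree_mult_le])
          (use deg degree_monom_le[of b "degree k - degree m"] in linarith)
      ultimately have "k' = 0 \<or> degree k' < degree k"
        by (metis le_neq_implies_less leading_coeff_0_iff)
      hence "degree k' < degree k"
        using deg dm by auto
      hence "m dvd k'" using less.hyps k' by blast
      moreover have "k = k' + ?q * m" by (simp add: k'_def)
      ultimately show ?thesis by (metis dvd_add dvd_triv_right)
    qed auto
  qed
  have "poly h a = 0"
    using f by (simp add: h_eval s_def is_min_poly_def)
  hence mh: "m dvd h" by (rule dvd[OF h])
  have mg: "m dvd ?g" using dvd \<open>?P ?g\<close> by blast
  have root_m: "b = a" if "poly m b = 0" for b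
  proof (rule ccontr)
    assume "b \<noteq> a"
    have "rat_poly g b = 0" "rat_poly f (s - of_rat c * b) = 0"
      using that mh mg by (auto simp: h_eval[symmetric] dvd_def)
    moreover have "of_rat c = ((s - of_rat c * b) - t) / (a - b)"
      using \<open>b \<noteq> a\<close> by (simp add: s_def field_simps)
    ultimately have "of_rat c \<in> bad"
      unfolding bad_def by (intro image_eqI[of _ _ "(s - of_rat c * b, b)"]) auto
    thus False using c by blast
  qed
  obtain m1 where m1: "m = [:- a, 1:] * m1"
    using m by (auto simp: poly_eq_0_iff_dvd)
  \<comment> \<open>A further root of \<open>m\<close> could again only be \<open>a\<close>, which
    would then be a double root of \<open>g\<close>.\<close>
  have "degree m1 = 0"
  proof (rule ccontr)
    assume "degree m1 \<noteq> 0"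
    hence "\<not> constant (poly m1)" by (simp add: constant_degree)
    then obtain b where "poly m1 b = 0" using fundamental_theorem_of_algebra by blast
    hence "poly m1 a = 0" using root_m[of b] m1 by simp
    then obtain m2 where "m1 = [:- a, 1:] * m2" by (auto simp: poly_eq_0_iff_dvd)
    obtain k where "?g = m * k" using mg by (rule dvdE)
    hence "?g = [:- a, 1:] * ([:- a, 1:] * (m2 * k))"
      by (simp only: m1 \<open>m1 = [:- a, 1:] * m2\<close> mult.assoc)
    hence "poly (pderiv ?g) a = 0" by (simp only: pderiv_mult poly_add poly_mult) simp
    thus False using min_poly_simple_root[OF g, of a] g by (simp add: pderiv_rat is_min_poly_def)
  qed
  then obtain e where "m1 = [:e:]" by (auto elim: degree_eq_zeroE)
  hence me: "m = [:- a * e, e:]" using m1 by simp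
  hence e: "e \<noteq> 0" "coeff m 0 = - a * e" "coeff m 1 = e" using m by auto
  hence "- a * e \<in> rat_adjoin s" "e \<in> rat_adjoin s" using m unfolding PF_def by (metis mem_Collect_eq)+
  hence "(- a * e) * inverse e \<in> rat_adjoin s" using inv rat_adjoin_mult by blast
  hence "0 - (- a * e) * inverse e \<in> rat_adjoin s" using rat_adjoin_diff rat_adjoin_of_rat[of 0 s] by fastforce
  hence a: "a \<in> rat_adjoin s" using e by (simp add: mult.assoc)
  have "s - of_rat c * a \<in> rat_adjoin s"
    using a by (intro rat_adjoin_diff rat_adjoin_mult rat_adjoin_of_rat rat_adjoin_self)
  hence "t \<in> rat_adjoin s" by (simp add: s_def)
  thus ?thesis using a s by blast
qed

lemma primitive_element: "\<exists>t\<in>K. K = rat_adjoin t"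
proof -
  obtain B where B: "finite B" "B \<subseteq> K"
    "\<And>y. y \<in> K \<Longrightarrow> \<exists>c :: complex \<Rightarrow> rat. y = (\<Sum>b\<in>B. of_rat (c b) * b)"
    using nf unfolding number_field_def by metis
  have "\<exists>t\<in>K. B \<subseteq> rat_adjoin t"
    using B(1,2)
  proof (induction B)
    case empty
    thus ?case using one_K by blast
  next
    case (insert b B)
    then obtain t where t: "t \<in> K" "B \<subseteq> rat_adjoin t" by auto
    then obtain s where "s \<in> K" "t \<in> rat_adjoin s" "b \<in> rat_adjoin s"
      using primitive_element_pair insert.prems by blast
    thus ?case using t rat_adjoin_trans[of t s] by (intro bexI[of _ s]) auto
  qed
  then obtain t where t: "t \<in> K" "B \<subseteq> rat_adjoin t" by blast
  have "K \<subseteq> rat_adjoin t"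
  proof
    fix y assume "y \<in> K"
    then obtain c :: "complex \<Rightarrow> rat" where "y = (\<Sum>b\<in>B. of_rat (c b) * b)" using B(3) by blast
    thus "y \<in> rat_adjoin t" using t(2) by (auto intro!: rat_adjoin_sum rat_adjoin_mult rat_adjoin_of_rat)
  qed
  thus ?thesis using t rat_adjoin_subset_K by blast
qed

end

section \<open>Embeddings and norms\<close>

text \<open>Multiplying an integral equation of degree \<open>n\<close> by the
  \<open>(n - 1)\<close>-st power of its leading coefficient \<open>a\<close> turns it into a monic
  equation for \<open>a * x\<close>. Passing to the absolute value of \<open>a\<close> makes the
  multiplier a natural number.\<close>

lemma algebraic_int_multiple:
  fixes x :: complex
  assumes "algebraic x"
  obtains m :: nat where "m > 0" and "algebraic_int (of_nat m * x)"
proof -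
  obtain p where p: "poly (map_poly of_int p) x = 0" "p \<noteq> 0"
    using assms by (elim algebraicE')
  define n where "n = degree p"
  define a where "a = lead_coeff p"
  have a: "a \<noteq> 0" using p by (simp add: a_def)
  have n: "n > 0"
  proof (rule ccontr)
    assume "\<not> n > 0"
    then obtain e where "p = [:e:]" by (auto simp: n_def elim: degree_eq_zeroE)
    thus False using p by simp
  qed
  define y where "y = of_int a * x"
  have sum0: "(\<Sum>i\<le>n. of_int (coeff p i) * x ^ i) = 0"
    using p(1) by (simp add: poly_altdef n_def degree_map_poly coeff_map_poly)
  hence "of_int a * x ^ n = - (\<Sum>i<n. of_int (coeff p i) * x ^ i)"
    by (simp add: n_def a_def lessThan_Suc_atMost[symmetric] add_eq_0_iff)
  hence "of_int a ^ (n - 1) * (of_int a * x ^ n) = - (\<Sum>i<n. of_int a ^ (n - 1) * (of_int (coeff p i) * x ^ i))"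
    by (simp add: sum_distrib_left)
  moreover have "of_int a ^ (n - 1) * (of_int a * x ^ n) = y ^ n"
    using n by (cases n) (auto simp: y_def power_mult_distrib)
  moreover have tm: "of_int a ^ (n - 1) * (of_int (coeff p i) * x ^ i) = of_int (a ^ (n - 1 - i) * coeff p i) * y ^ i"
    if "i < n" for i
  proof -
    have "of_int a ^ (n - 1) = (of_int a ^ (n - 1 - i) * of_int a ^ i :: complex)"
      using that by (simp flip: power_add)
    thus ?thesis by (simp add: y_def power_mult_distrib)
  qed
  moreover from tm have "(\<Sum>i<n. of_int a ^ (n - 1) * (of_int (coeff p i) * x ^ i))
      = (\<Sum>i<n. of_int (a ^ (n - 1 - i) * coeff p i) * y ^ i)"
    by (intro sum.cong) auto
  ultimately have "y ^ n = - (\<Sum>i<n. of_int (a ^ (n - 1 - i) * coeff p i) * y ^ i)"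
    by metis
  hence yn: "y ^ n = (\<Sum>i<n. of_int (- (a ^ (n - 1 - i) * coeff p i)) * y ^ i)"
    by (simp add: sum_negf)
  have "algebraic_int y"
  proof (rule algebraic_int_if_nat_stable[of 0 n "\<lambda>i. y ^ i"])
    fix i assume "i < n"
    thus "\<exists>c :: nat \<Rightarrow> int. y * y ^ i = (\<Sum>j<n. of_int (c j) * y ^ j)"
      by (rule power_times_self[OF yn])
  qed (use n in auto)
  moreover have "of_nat (nat \<bar>a\<bar>) * x = y \<or> of_nat (nat \<bar>a\<bar>) * x = - y"
    by (cases "a \<ge> 0") (auto simp: y_def)
  ultimately have "algebraic_int (of_nat (nat \<bar>a\<bar>) * x)"
    by (metis algebraic_int_minus)
  thus ?thesis using that[of "nat \<bar>a\<bar>"] a by simp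
qed

context num_field
begin

abbreviation "E \<equiv> embeddings K"
abbreviation "OK \<equiv> ring_of_integers K"
abbreviation "Nm x \<equiv> \<Prod>\<sigma>\<in>E. norm (\<sigma> x)"

lemma algebraic_K: "x \<in> K \<Longrightarrow> algebraic x"
  using rat_poly_root[of x] unfolding algebraic_altdef by (metis Rats_of_rat coeff_map_poly of_rat_0 of_rat_poly_hom.hom_0_iff)

lemma integral_multiple:
  assumes "x \<in> K"
  obtains m :: nat where "m > 0" and "of_nat m * x \<in> OK"
  using algebraic_int_multiple[OF algebraic_K[OF assms]] assms
  by (metis (mono_tags, lifting) mem_Collect_eq mult_K of_nat_K ring_of_integers_def)

lemma OK_K: "x \<in> OK \<Longrightarrow> x \<in> K"
  by (simp add: ring_of_integers_def)

lemma OK_0: "0 \<in> OK" and OK_1: "1 \<in> OK"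
  using zero_K one_K by (auto simp: ring_of_integers_def)

lemma OK_add: "x \<in> OK \<Longrightarrow> y \<in> OK \<Longrightarrow> x + y \<in> OK"
  by (simp add: ring_of_integers_def add_K algebraic_int_add)

lemma OK_mult: "x \<in> OK \<Longrightarrow> y \<in> OK \<Longrightarrow> x * y \<in> OK"
  by (simp add: ring_of_integers_def mult_K algebraic_int_mult)

lemma OK_minus: "x \<in> OK \<Longrightarrow> - x \<in> OK"
  by (simp add: ring_of_integers_def minus_K)

lemma OK_diff: "x \<in> OK \<Longrightarrow> y \<in> OK \<Longrightarrow> x - y \<in> OK"
  using OK_add[OF _ OK_minus] by fastforce

lemma OK_sum: "(\<And>i. i \<in> I \<Longrightarrow> a i \<in> OK) \<Longrightarrow> (\<Sum>i\<in>I. a i) \<in> OK"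
  by (induction I rule: infinite_finite_induct) (auto simp: OK_0 OK_add)

lemma OK_prod: "(\<And>i. i \<in> I \<Longrightarrow> a i \<in> OK) \<Longrightarrow> (\<Prod>i\<in>I. a i) \<in> OK"
  by (induction I rule: infinite_finite_induct) (auto simp: OK_1 OK_mult)

lemma OK_power: "x \<in> OK \<Longrightarrow> x ^ k \<in> OK"
  by (induction k) (auto simp: OK_1 OK_mult)

lemma OK_of_int: "of_int k \<in> OK"
  by (simp add: ring_of_integers_def of_int_K int_imp_algebraic_int)

lemma OK_of_nat: "of_nat k \<in> OK"
  using OK_of_int[of "int k"] by simp

lemma integral_primitive_element: "\<exists>t\<in>OK. K = rat_adjoin t"
proof -
  obtain t where t: "t \<in> K" "K = rat_adjoin t" using primitive_element by blast
  obtain m :: nat where m: "m > 0" "of_nat m * t \<in> OK" using integral_multiple[OF t(1)] .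
  have "of_rat (inverse (of_nat m)) * (of_nat m * t) \<in> rat_adjoin (of_nat m * t)"
    by (intro rat_adjoin_mult rat_adjoin_of_rat rat_adjoin_self)
  hence "t \<in> rat_adjoin (of_nat m * t)"
    using m(1) by (simp add: of_rat_inverse mult.assoc[symmetric])
  hence "K \<subseteq> rat_adjoin (of_nat m * t)" using t(2) rat_adjoin_trans by blast
  thus ?thesis using m(2) rat_adjoin_subset_K[OF OK_K[OF m(2)]] by blast
qed

lemma embD:
  assumes "\<sigma> \<in> E"
  shows emb_1: "\<sigma> 1 = 1"
    and emb_add: "x \<in> K \<Longrightarrow> y \<in> K \<Longrightarrow> \<sigma> (x + y) = \<sigma> x + \<sigma> y"
    and emb_mult: "x \<in> K \<Longrightarrow> y \<in> K \<Longrightarrow> \<sigma> (x * y) = \<sigma> x * \<sigma> y"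
    and emb_extensional: "\<sigma> \<in> extensional K"
  using assms by (auto simp: embeddings_def)

lemma emb_0: "\<sigma> \<in> E \<Longrightarrow> \<sigma> 0 = 0"
  using emb_add[of \<sigma> 0 0] zero_K by simp

lemma emb_minus: "\<sigma> \<in> E \<Longrightarrow> x \<in> K \<Longrightarrow> \<sigma> (- x) = - \<sigma> x"
  using emb_add[of \<sigma> x "- x"] minus_K[of x] emb_0[of \<sigma>] by (simp add: eq_neg_iff_add_eq_0 add.commute)

lemma emb_diff: "\<sigma> \<in> E \<Longrightarrow> x \<in> K \<Longrightarrow> y \<in> K \<Longrightarrow> \<sigma> (x - y) = \<sigma> x - \<sigma> y"
  using emb_add[of \<sigma> x "- y"] by (simp add: minus_K emb_minus)

lemma emb_sum: "\<sigma> \<in> E \<Longrightarrow> (\<And>i. i \<in> I \<Longrightarrow> a i \<in> K) \<Longrightarrow> \<sigma> (\<Sum>i\<in>I. a i) = (\<Sum>i\<in>I. \<sigma> (a i))"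
  by (induction I rule: infinite_finite_induct) (auto simp: emb_0 emb_add sum_K)

lemma emb_prod: "\<sigma> \<in> E \<Longrightarrow> (\<And>i. i \<in> I \<Longrightarrow> a i \<in> K) \<Longrightarrow> \<sigma> (\<Prod>i\<in>I. a i) = (\<Prod>i\<in>I. \<sigma> (a i))"
  by (induction I rule: infinite_finite_induct) (auto simp: emb_1 emb_mult prod_K)

lemma emb_power: "\<sigma> \<in> E \<Longrightarrow> x \<in> K \<Longrightarrow> \<sigma> (x ^ k) = \<sigma> x ^ k"
  by (induction k) (auto simp: emb_1 emb_mult power_K)

lemma emb_nonzero: "\<sigma> \<in> E \<Longrightarrow> x \<in> K \<Longrightarrow> x \<noteq> 0 \<Longrightarrow> \<sigma> x \<noteq> 0"
  using emb_mult[of \<sigma> x "inverse x"] by (auto simp: inverse_K emb_1)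

lemma emb_inverse: "\<sigma> \<in> E \<Longrightarrow> x \<in> K \<Longrightarrow> \<sigma> (inverse x) = inverse (\<sigma> x)"
  using emb_mult[of \<sigma> x "inverse x"]
  by (cases "x = 0") (auto simp: emb_0 emb_1 inverse_K inverse_unique)

lemma emb_divide: "\<sigma> \<in> E \<Longrightarrow> x \<in> K \<Longrightarrow> y \<in> K \<Longrightarrow> \<sigma> (x / y) = \<sigma> x / \<sigma> y"
  by (simp add: divide_inverse emb_mult emb_inverse inverse_K)

lemma emb_of_nat: "\<sigma> \<in> E \<Longrightarrow> \<sigma> (of_nat k) = of_nat k"
  by (induction k) (auto simp: emb_0 emb_1 emb_add of_nat_K one_K)

lemma emb_of_int: "\<sigma> \<in> E \<Longrightarrow> \<sigma> (of_int k) = of_int k"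
  by (cases k) (auto simp del: of_nat_Suc simp: emb_of_nat emb_minus of_nat_K)

lemma emb_of_rat: "\<sigma> \<in> E \<Longrightarrow> \<sigma> (of_rat c) = of_rat c"
  by (cases c) (auto simp: of_rat_rat emb_divide emb_of_int of_int_K)

lemma emb_rat_poly: "\<sigma> \<in> E \<Longrightarrow> x \<in> K \<Longrightarrow> \<sigma> (rat_poly h x) = rat_poly h (\<sigma> x)"
  by (induction h) (auto simp: emb_0 rat_poly_pCons emb_add emb_mult of_rat_K emb_of_rat mult_K rat_poly_K)

lemma emb_algebraic_int:
  assumes "\<sigma> \<in> E" and "x \<in> OK"
  shows "algebraic_int (\<sigma> x)"
proof -
  obtain p where p: "poly (map_poly of_int p) x = 0" "lead_coeff p = 1"
    using assms(2) by (auto simp: ring_of_integers_def algebraic_int_altdef_ipoly)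
  have "poly (map_poly of_int p) y = rat_poly (map_poly of_int p) y" for y
    by (simp add: map_poly_map_poly comp_def)
  hence "poly (map_poly of_int p) (\<sigma> x) = \<sigma> 0"
    using p(1) emb_rat_poly[OF assms(1) OK_K[OF assms(2)], of "map_poly of_int p"] by simp
  thus ?thesis using p(2) assms(1) by (auto simp: algebraic_int_altdef_ipoly emb_0)
qed

definition theta :: complex where
  "theta = (SOME t. t \<in> OK \<and> K = rat_adjoin t)"

definition min_theta :: "rat poly" where
  "min_theta = (SOME f. is_min_poly f theta)"

text \<open>This is \<open>[K : \<rat>]\<close>; by \<open>card_E\<close> it is also the number of
  embeddings.\<close>

definition deg :: nat where
  "deg = degree min_theta"

lemma theta: "theta \<in> OK" "K = rat_adjoin theta"
  using someI_ex[of "\<lambda>t. t \<in> OK \<and> K = rat_adjoin t"] integral_primitive_element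
  by (auto simp: theta_def)

lemma theta_K: "theta \<in> K"
  by (rule OK_K[OF theta(1)])

lemma min_theta: "is_min_poly min_theta theta"
  using min_poly_K[OF theta_K] someI_ex[of "\<lambda>f. is_min_poly f theta"]
  by (metis min_theta_def)

lemma deg_pos: "deg > 0"
  using degree_min_poly_pos[OF min_theta] by (simp add: deg_def)

lemma K_rat_poly:
  assumes "x \<in> K"
  obtains h where "x = rat_poly h theta"
  using assms theta(2) by (auto simp: rat_adjoin_def)

lemma power_basis:
  assumes "x \<in> K"
  obtains c :: "nat \<Rightarrow> rat" where "x = (\<Sum>k<deg. of_rat (c k) * theta ^ k)"
proof -
  obtain h where h: "x = rat_poly h theta" using K_rat_poly[OF assms] .
  let ?r = "h mod min_theta"
  have "min_theta \<noteq> 0" using min_theta by (simp add: is_min_poly_def)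
  hence "degree ?r < deg"
    using degree_mod_less[of min_theta h] deg_pos by (auto simp: deg_def)
  hence "rat_poly ?r theta = (\<Sum>k<deg. of_rat (coeff ?r k) * theta ^ k)"
    by (rule rat_poly_sum_coeff)
  moreover have "x = rat_poly ?r theta"
    using h min_theta rat_poly_add[of "h div min_theta * min_theta" ?r theta]
    by (simp add: rat_poly_mult is_min_poly_def)
  ultimately show ?thesis using that by simp
qed

lemma power_basis_independent:
  assumes "(\<Sum>k<deg. of_rat (c k) * theta ^ k) = 0" and "k < deg"
  shows "c k = 0"
proof (rule ccontr)
  assume ck: "c k \<noteq> 0"
  define h where "h = (\<Sum>i<deg. Polynomial.monom (c i) i)"
  have coeff: "coeff h i = (if i < deg then c i else 0)" for i
    by (simp add: h_def coeff_sum)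
  have "h \<noteq> 0" using ck assms(2) coeff[of k] by auto
  moreover have "degree h \<le> deg - 1"
    by (rule degree_le) (auto simp: coeff)
  hence dh: "degree h < deg" using deg_pos by simp
  hence "rat_poly h theta = (\<Sum>k<deg. of_rat (c k) * theta ^ k)"
    by (simp add: rat_poly_sum_coeff coeff)
  ultimately show False
    using min_poly_degree_le[OF min_theta, of h] dh assms(1) by (simp add: deg_def)
qed

lemma emb_eqI:
  assumes "\<sigma> \<in> E" and "\<tau> \<in> E" and "\<sigma> theta = \<tau> theta"
  shows "\<sigma> = \<tau>"
proof (rule extensionalityI[OF emb_extensional[OF assms(1)] emb_extensional[OF assms(2)]])
  fix x assume "x \<in> K"
  then obtain h where "x = rat_poly h theta" using K_rat_poly by blast
  thus "\<sigma> x = \<tau> x" using assms by (simp add: emb_rat_poly theta_K)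
qed

text \<open>An embedding is determined by its value at \<open>theta\<close>, which is a root of
  \<open>min_theta\<close>. Conversely, a root \<open>r\<close> defines one by substituting
  \<open>r\<close> for \<open>theta\<close>: two polynomials with the same value at
  \<open>theta\<close> differ by a multiple of \<open>min_theta\<close>, so the chosen
  representative does not matter.\<close>

lemma bij_embeddings_roots: "bij_betw (\<lambda>\<sigma>. \<sigma> theta) E {r. rat_poly min_theta r = 0}"
proof -
  have "inj_on (\<lambda>\<sigma>. \<sigma> theta) E" using emb_eqI by (auto simp: inj_on_def)
  moreover have "(\<lambda>\<sigma>. \<sigma> theta) ` E \<subseteq> {r. rat_poly min_theta r = 0}"
  proof clarify
    fix \<sigma> assume \<sigma>: "\<sigma> \<in> E"
    have "rat_poly min_theta (\<sigma> theta) = \<sigma> (rat_poly min_theta theta)"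
      using \<sigma> by (simp add: emb_rat_poly theta_K)
    thus "rat_poly min_theta (\<sigma> theta) = 0"
      using min_theta \<sigma> by (simp add: is_min_poly_def emb_0)
  qed
  moreover have "r \<in> (\<lambda>\<sigma>. \<sigma> theta) ` E" if r: "rat_poly min_theta r = 0" for r
  proof -
    define \<sigma> where "\<sigma> = restrict (\<lambda>x. rat_poly (SOME h. rat_poly h theta = x) r) K"
    have val: "\<sigma> (rat_poly h theta) = rat_poly h r" for h
    proof -
      define h' where "h' = (SOME h'. rat_poly h' theta = rat_poly h theta)"
      have "rat_poly h' theta = rat_poly h theta"
        unfolding h'_def by (rule someI) (rule refl)
      hence "min_theta dvd (h' - h)"
        using min_theta by (simp add: is_min_poly_def rat_poly_diff)
      then obtain k where "h' - h = min_theta * k" by blast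
      hence "rat_poly (h' - h) r = 0" using r by (simp add: rat_poly_mult)
      hence "rat_poly h' r = rat_poly h r" by (simp add: rat_poly_diff)
      moreover have "\<sigma> (rat_poly h theta) = rat_poly h' r"
        by (simp add: \<sigma>_def h'_def rat_poly_K theta_K)
      ultimately show ?thesis by simp
    qed
    have "\<sigma> \<in> E"
      unfolding embeddings_def
    proof (intro CollectI conjI ballI)
      show "\<sigma> \<in> extensional K" by (simp add: \<sigma>_def)
      show "\<sigma> 1 = 1" using val[of "[:1:]"] by (simp add: rat_poly_pCons)
      fix x y assume "x \<in> K" "y \<in> K"
      then obtain h k where "x = rat_poly h theta" "y = rat_poly k theta" using K_rat_poly by metis
      thus "\<sigma> (x + y) = \<sigma> x + \<sigma> y" "\<sigma> (x * y) = \<sigma> x * \<sigma> y"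
        by (simp_all add: val rat_poly_add[symmetric] rat_poly_mult[symmetric] del: of_rat_poly_hom.hom_add of_rat_poly_hom.hom_mult)
    qed
    moreover have "\<sigma> theta = r"
      using val[of "[:0, 1:]"] by (simp add: rat_poly_pCons)
    ultimately show ?thesis by blast
  qed
  ultimately show ?thesis by (auto simp: bij_betw_def)
qed

lemma finite_E: "finite E" and card_E: "card E = deg"
  using bij_embeddings_roots card_roots_min_poly[OF min_theta]
  by (auto simp: deg_def bij_betw_finite bij_betw_same_card)

lemma id_emb: "restrict (\<lambda>x. x) K \<in> E"
  by (auto simp: embeddings_def one_K add_K mult_K)

lemma cnj_emb: "\<sigma> \<in> E \<Longrightarrow> restrict (\<lambda>x. cnj (\<sigma> x)) K \<in> E"
  by (auto simp: embeddings_def one_K add_K mult_K)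

text \<open>The Vandermonde matrix of the conjugates of the primitive element diagonalises the rational matrix
  of the multiplication by \<open>x\<close>.\<close>

lemma norm_rational:
  assumes "x \<in> K"
  shows "(\<Prod>\<sigma>\<in>E. \<sigma> x) \<in> \<rat>"
proof -
  obtain r where r: "bij_betw r {0..<deg} E"
    using ex_bij_betw_nat_finite[OF finite_E] card_E by auto
  have rE: "r i \<in> E" if "i < deg" for i using r that by (auto simp: bij_betw_def)
  have "\<forall>k. \<exists>c :: nat \<Rightarrow> rat. x * theta ^ k = (\<Sum>l<deg. of_rat (c l) * theta ^ l)"
    using power_basis[OF mult_K[OF assms power_K[OF theta_K]]] by metis
  then obtain m :: "nat \<Rightarrow> nat \<Rightarrow> rat"
    where m: "\<And>k. x * theta ^ k = (\<Sum>l<deg. of_rat (m k l) * theta ^ l)"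
    by metis
  define V where "V = Matrix.mat deg deg (\<lambda>(i, k). (r i theta) ^ k)"
  define D where "D = Matrix.mat deg deg (\<lambda>(i, k). if i = k then r i x else 0)"
  define M0 where "M0 = Matrix.mat deg deg (\<lambda>(l, k). m k l)"
  define M where "M = map_mat (of_rat :: rat \<Rightarrow> complex) M0"
  have carrier: "V \<in> carrier_mat deg deg" "D \<in> carrier_mat deg deg" "M \<in> carrier_mat deg deg"
    by (auto simp: V_def D_def M_def M0_def)
  \<comment> \<open>Column \<open>k\<close> of \<open>M\<close> holds the coordinates of
    \<open>x * theta ^ k\<close> in the power basis; both sides have the conjugate of this element
    under \<open>r i\<close> as entry \<open>(i, k)\<close>.\<close>
  have "V * M = D * V"
  proof (rule eq_matI)
    fix i k assume "i < dim_row (D * V)" "k < dim_col (D * V)"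
    hence ik: "i < deg" "k < deg" by (auto simp: D_def V_def)
    have "(V * M) $$ (i, k) = (\<Sum>l<deg. (r i theta) ^ l * of_rat (m k l))"
      using ik by (simp add: V_def M_def M0_def scalar_prod_def lessThan_atLeast0)
    also have "\<dots> = r i (x * theta ^ k)"
      unfolding m using ik by (simp add: emb_sum emb_mult emb_power emb_of_rat of_rat_K power_K theta_K mult_K rE mult.commute)
    also have "\<dots> = r i x * (r i theta) ^ k"
      using ik assms by (simp add: emb_mult emb_power power_K theta_K rE)
    also have "\<dots> = (\<Sum>l<deg. (if i = l then r i x else 0) * (r l theta) ^ k)"
      using ik by (simp add: if_distribR if_distrib[of "\<lambda>z. z * _"] cong: if_cong)
    also have "\<dots> = (D * V) $$ (i, k)"
      using ik by (simp add: V_def D_def scalar_prod_def lessThan_atLeast0)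
    finally show "(V * M) $$ (i, k) = (D * V) $$ (i, k)" .
  qed (auto simp: V_def D_def M_def M0_def)
  hence "Det V * Det M = Det D * Det V"
    using carrier by (metis det_mult)
  \<comment> \<open>A kernel vector would be the coefficient vector of a nonzero polynomial of
    degree below \<open>deg\<close> that vanishes at the \<open>deg\<close> distinct conjugates of
    \<open>theta\<close>.\<close>
  moreover have "Det V \<noteq> 0"
  proof
    assume "Det V = 0"
    then obtain v where v: "v \<in> carrier_vec deg" "v \<noteq> 0\<^sub>v deg" "V *\<^sub>v v = 0\<^sub>v deg"
      using det_0_iff_vec_prod_zero_field[OF carrier(1)] by auto
    define h where "h = (\<Sum>k<deg. Polynomial.monom (vec_index v k) k)"
    have coeff: "coeff h i = (if i < deg then vec_index v i else 0)" for i
      by (simp add: h_def coeff_sum)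
    have "h \<noteq> 0"
    proof
      assume "h = 0"
      hence "vec_index v i = 0" if "i < deg" for i using coeff[of i] that by simp
      hence "v = 0\<^sub>v deg" using v(1) by (intro eq_vecI) auto
      thus False using v(2) by simp
    qed
    have "degree h \<le> deg - 1" by (rule degree_le) (auto simp: coeff)
    have "poly h (r i theta) = 0" if "i < deg" for i
    proof -
      have "poly h (r i theta) = (\<Sum>k<deg. (r i theta) ^ k * vec_index v k)"
        by (simp add: h_def poly_sum poly_monom mult.commute)
      also have "\<dots> = vec_index (V *\<^sub>v v) i"
        using that v(1) by (auto simp: V_def scalar_prod_def lessThan_atLeast0)
      finally show ?thesis using v(3) that by simp
    qed
    hence "(\<lambda>i. r i theta) ` {0..<deg} \<subseteq> {z. poly h z = 0}" by auto
    hence "card ((\<lambda>i. r i theta) ` {0..<deg}) \<le> card {z. poly h z = 0}"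
      using poly_roots_finite[OF \<open>h \<noteq> 0\<close>] by (rule card_mono[rotated])
    also have "\<dots> \<le> degree h" by (rule poly_roots_degree[OF \<open>h \<noteq> 0\<close>])
    also have "card ((\<lambda>i. r i theta) ` {0..<deg}) = deg"
    proof -
      have "inj_on (\<lambda>i. r i theta) {0..<deg}"
        using r rE emb_eqI by (auto simp: inj_on_def bij_betw_def)
      thus ?thesis by (simp add: card_image)
    qed
    finally show False using \<open>degree h \<le> deg - 1\<close> deg_pos by simp
  qed
  ultimately have "Det D = Det M" by simp
  also have "\<dots> = of_rat (Det M0)" by (simp add: M_def)
  finally have "Det D \<in> \<rat>" by simp
  moreover have "Det D = (\<Prod>i\<in>{0..<deg}. r i x)"
  proof -
    have "upper_triangular D" by (auto simp: D_def)
    hence "Det D = prod_list (diag_mat D)"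
      using det_upper_triangular carrier(2) by blast
    also have "\<dots> = (\<Prod>i\<in>{0..<deg}. D $$ (i, i))"
      by (simp add: prod_list_diag_prod D_def)
    finally show ?thesis by (simp add: D_def)
  qed
  ultimately show ?thesis by (simp add: prod.reindex_bij_betw[OF r, of "\<lambda>\<sigma>. \<sigma> x"])
qed

text \<open>The product of the conjugates is rational and an algebraic integer, hence a rational
  integer. It is nonzero because no embedding kills \<open>x\<close>.\<close>

lemma norm_ge_1:
  assumes "x \<in> OK" and "x \<noteq> 0"
  shows "Nm x \<ge> 1"
proof -
  let ?N = "\<Prod>\<sigma>\<in>E. \<sigma> x"
  have "algebraic_int (\<Prod>\<sigma>\<in>F. \<sigma> x)" if "F \<subseteq> E" for F
    using that assms(1)
    by (induction F rule: infinite_finite_induct) (auto simp: algebraic_int_mult emb_algebraic_int)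
  hence "?N \<in> \<int>"
    using norm_rational[OF OK_K[OF assms(1)]] rational_algebraic_int_is_int by blast
  then obtain k where k: "?N = of_int k" by (auto simp: Ints_def)
  have "?N \<noteq> 0"
    using assms by (simp add: finite_E emb_nonzero OK_K)
  hence "k \<noteq> 0" using k by auto
  hence "\<bar>real_of_int k\<bar> \<ge> 1" by linarith
  hence "norm ?N \<ge> 1" unfolding k by simp
  thus ?thesis by (simp add: prod_norm)
qed

end

section \<open>Counting points in boxes\<close>

text \<open>The cell of a point is found by rounding each coordinate down in units of
  \<open>s i\<close>. The summand 2 in the count pays for the incomplete cells at the two ends of
  the interval.\<close>

lemma box_partition:
  fixes f :: "'a \<Rightarrow> 'i \<Rightarrow> real"
  assumes "finite I" and bound: "\<And>x i. x \<in> A \<Longrightarrow> i \<in> I \<Longrightarrow> \<bar>f x i\<bar> \<le> R i"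
    and pos: "\<And>i. i \<in> I \<Longrightarrow> s i > 0" and R: "\<And>i. i \<in> I \<Longrightarrow> R i \<ge> 0"
  shows "\<exists>(g :: 'a \<Rightarrow> 'i \<Rightarrow> int) C. finite C \<and> g ` A \<subseteq> C \<and> real (card C) \<le> (\<Prod>i\<in>I. 2 * R i / s i + 2) \<and>
    (\<forall>x\<in>A. \<forall>y\<in>A. g x = g y \<longrightarrow> (\<forall>i\<in>I. \<bar>f x i - f y i\<bar> < s i))"
proof -
  define g where "g x = restrict (\<lambda>i. \<lfloor>f x i / s i\<rfloor>) I" for x
  define J where "J i = {\<lfloor>- R i / s i\<rfloor>..\<lfloor>R i / s i\<rfloor>}" for i
  define C where "C = PiE I J"
  show ?thesis
  proof (intro exI conjI ballI impI)
    show "finite C" using assms(1) by (auto simp: C_def J_def intro: finite_PiE)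
    have "\<lfloor>f x i / s i\<rfloor> \<in> J i" if "x \<in> A" "i \<in> I" for x i
    proof -
      have "- R i \<le> f x i" "f x i \<le> R i" using bound[OF that] by linarith+
      hence "- R i / s i \<le> f x i / s i" "f x i / s i \<le> R i / s i"
        using pos[OF that(2)] by (intro divide_right_mono; simp)+
      thus ?thesis unfolding J_def atLeastAtMost_iff by (intro conjI floor_mono)
    qed
    thus "g ` A \<subseteq> C" by (auto simp: g_def C_def)
    have "real (card (J i)) \<le> 2 * R i / s i + 2" if i: "i \<in> I" for i
    proof -
      have "0 \<le> R i / s i" using R[OF i] pos[OF i] by simp
      hence "real (card (J i)) = real_of_int (\<lfloor>R i / s i\<rfloor> - \<lfloor>- R i / s i\<rfloor> + 1)"
        by (auto simp: J_def) linarith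
      thus ?thesis by simp linarith
    qed
    hence "(\<Prod>i\<in>I. real (card (J i))) \<le> (\<Prod>i\<in>I. 2 * R i / s i + 2)"
      by (intro prod_mono) auto
    thus "real (card C) \<le> (\<Prod>i\<in>I. 2 * R i / s i + 2)"
      by (simp add: C_def card_PiE assms(1))
    fix x y i assume *: "x \<in> A" "y \<in> A" "g x = g y" "i \<in> I"
    from *(3) have "g x i = g y i" by simp
    hence "\<lfloor>f x i / s i\<rfloor> = \<lfloor>f y i / s i\<rfloor>"
      using *(4) by (simp add: g_def)
    hence "\<bar>f x i / s i - f y i / s i\<bar> < 1" by linarith
    thus "\<bar>f x i - f y i\<bar> < s i"
      using pos[OF *(4)] by (simp add: diff_divide_distrib[symmetric] abs_divide)
  qed
qed

text \<open>If no cell holds two points, points are counted by cells. This is the tool for upper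
  bounds; the separation comes from a lower bound for nonzero differences.\<close>

lemma card_le_boxes:
  fixes f :: "'a \<Rightarrow> 'i \<Rightarrow> real"
  assumes "finite I" and "\<And>x i. x \<in> A \<Longrightarrow> i \<in> I \<Longrightarrow> \<bar>f x i\<bar> \<le> R i"
    and "\<And>i. i \<in> I \<Longrightarrow> s i > 0" and "\<And>i. i \<in> I \<Longrightarrow> R i \<ge> 0"
    and sep: "\<And>x y. x \<in> A \<Longrightarrow> y \<in> A \<Longrightarrow> (\<And>i. i \<in> I \<Longrightarrow> \<bar>f x i - f y i\<bar> < s i) \<Longrightarrow> x = y"
  shows "finite A" and "real (card A) \<le> (\<Prod>i\<in>I. 2 * R i / s i + 2)"
proof -
  have "\<exists>(g :: 'a \<Rightarrow> 'i \<Rightarrow> int) C. finite C \<and> g ` A \<subseteq> C \<and> real (card C) \<le> (\<Prod>i\<in>I. 2 * R i / s i + 2) \<and>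
    (\<forall>x\<in>A. \<forall>y\<in>A. g x = g y \<longrightarrow> (\<forall>i\<in>I. \<bar>f x i - f y i\<bar> < s i))"
    by (rule box_partition) (fact assms)+
  then obtain g :: "'a \<Rightarrow> 'i \<Rightarrow> int" and C where C:
    "finite C" "g ` A \<subseteq> C" "real (card C) \<le> (\<Prod>i\<in>I. 2 * R i / s i + 2)"
    "\<forall>x\<in>A. \<forall>y\<in>A. g x = g y \<longrightarrow> (\<forall>i\<in>I. \<bar>f x i - f y i\<bar> < s i)"
    by (elim exE conjE)
  have "inj_on g A"
  proof (rule inj_onI)
    fix x y assume xy: "x \<in> A" "y \<in> A" "g x = g y"
    show "x = y" by (rule sep[OF xy(1,2)]) (use C(4) xy in blast)
  qed
  thus "finite A" "real (card A) \<le> (\<Prod>i\<in>I. 2 * R i / s i + 2)"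
    using C(1-3) inj_on_finite card_inj_on_le[of g A C] by (auto intro: order.trans[rotated])
qed

text \<open>\<open>B\<close> is a fullest cell, which holds at least the average number of points.
  This is the tool for lower bounds.\<close>

lemma pigeonhole_boxes:
  fixes f :: "'a \<Rightarrow> 'i \<Rightarrow> real"
  assumes "finite I" and "\<And>x i. x \<in> A \<Longrightarrow> i \<in> I \<Longrightarrow> \<bar>f x i\<bar> \<le> R i"
    and "\<And>i. i \<in> I \<Longrightarrow> s i > 0" and "\<And>i. i \<in> I \<Longrightarrow> R i \<ge> 0"
    and "finite A" and "A \<noteq> {}"
  obtains B where "B \<subseteq> A" and "B \<noteq> {}" and "real (card A) \<le> real (card B) * (\<Prod>i\<in>I. 2 * R i / s i + 2)"
    and "\<And>x y i. x \<in> B \<Longrightarrow> y \<in> B \<Longrightarrow> i \<in> I \<Longrightarrow> \<bar>f x i - f y i\<bar> < s i"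
proof -
  have "\<exists>(g :: 'a \<Rightarrow> 'i \<Rightarrow> int) C. finite C \<and> g ` A \<subseteq> C \<and> real (card C) \<le> (\<Prod>i\<in>I. 2 * R i / s i + 2) \<and>
    (\<forall>x\<in>A. \<forall>y\<in>A. g x = g y \<longrightarrow> (\<forall>i\<in>I. \<bar>f x i - f y i\<bar> < s i))"
    by (rule box_partition) (fact assms)+
  then obtain g :: "'a \<Rightarrow> 'i \<Rightarrow> int" and C where C:
    "finite C" "g ` A \<subseteq> C" "real (card C) \<le> (\<Prod>i\<in>I. 2 * R i / s i + 2)"
    "\<forall>x\<in>A. \<forall>y\<in>A. g x = g y \<longrightarrow> (\<forall>i\<in>I. \<bar>f x i - f y i\<bar> < s i)"
    by (elim exE conjE)
  define fib where "fib c = {x \<in> A. g x = c}" for c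
  define m where "m = Max ((\<lambda>c. card (fib c)) ` g ` A)"
  have fin: "finite ((\<lambda>c. card (fib c)) ` g ` A)" "(\<lambda>c. card (fib c)) ` g ` A \<noteq> {}"
    using assms(5,6) by auto
  obtain c where c: "c \<in> g ` A" "m = card (fib c)"
    using Max_in[OF fin] by (auto simp: m_def)
  have "A = (\<Union>c\<in>g ` A. fib c)" by (auto simp: fib_def)
  hence "card A \<le> (\<Sum>c\<in>g ` A. card (fib c))"
    using assms(5) by (metis card_UN_le finite_imageI)
  also have "\<dots> \<le> (\<Sum>c\<in>g ` A. m)"
    using fin by (intro sum_mono) (auto simp: m_def)
  also have "\<dots> = card (g ` A) * m" by simp
  also have "\<dots> \<le> card C * m"
    using C(1,2) by (intro mult_right_mono card_mono) auto
  finally have "real (card A) \<le> real (card C) * real m"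
    by (metis of_nat_le_iff of_nat_mult)
  also have "\<dots> \<le> (\<Prod>i\<in>I. 2 * R i / s i + 2) * real m"
    using C(3) by (intro mult_right_mono) auto
  finally have "real (card A) \<le> real (card (fib c)) * (\<Prod>i\<in>I. 2 * R i / s i + 2)"
    by (simp add: c mult.commute)
  moreover have "fib c \<subseteq> A" "fib c \<noteq> {}" using c(1) by (auto simp: fib_def)
  moreover have "\<bar>f x i - f y i\<bar> < s i" if "x \<in> fib c" "y \<in> fib c" "i \<in> I" for x y i
    using that C(4) by (auto simp: fib_def)
  ultimately show ?thesis using that by blast
qed

text \<open>At two conjugate embeddings, \<open>Re + Im\<close> yields two independent real coordinates. Using it at every
  embedding gives exactly \<open>[K : \<rat>]\<close> real coordinates, without choosing representatives of conjugate
  pairs.\<close>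

definition re_im :: "complex \<Rightarrow> real" where
  "re_im z = Re z + Im z"

lemma re_im_diff: "re_im (z - w) = re_im z - re_im w"
  by (simp add: re_im_def)

lemma abs_re_im_le: "\<bar>re_im z\<bar> \<le> 2 * norm z"
  using abs_Re_le_cmod[of z] abs_Im_le_cmod[of z] by (simp add: re_im_def)

text \<open>The two coordinates are \<open>Re z + Im z\<close> and \<open>Re z - Im z\<close>, and
  the larger of their absolute values is the sum of the absolute values of \<open>Re z\<close> and
  \<open>Im z\<close>. A conjugate is thus controlled by the coordinates at an embedding and at its
  complex conjugate together.\<close>

lemma norm_le_re_im: "norm z \<le> \<bar>re_im z\<bar> + \<bar>re_im (cnj z)\<bar>"
  using cmod_le[of z] by (simp add: re_im_def)

lemma norm_of_rat: "norm (of_rat c :: complex) = of_rat \<bar>c\<bar>"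
proof -
  have "(of_rat c :: complex) = of_real (of_rat c)"
    by (cases c) (simp add: of_rat_rat)
  hence "norm (of_rat c :: complex) = \<bar>of_rat c :: real\<bar>"
    using norm_of_real[of "of_rat c", where ?'a = complex] by simp
  thus ?thesis by simp
qed

context num_field
begin

definition cj :: "(complex \<Rightarrow> complex) \<Rightarrow> complex \<Rightarrow> complex" where
  "cj \<sigma> = restrict (\<lambda>x. cnj (\<sigma> x)) K"

lemma cj_emb: "\<sigma> \<in> E \<Longrightarrow> cj \<sigma> \<in> E"
  unfolding cj_def by (rule cnj_emb)

lemma cj_apply: "x \<in> K \<Longrightarrow> cj \<sigma> x = cnj (\<sigma> x)"
  by (simp add: cj_def)

lemma cj_cj: "\<sigma> \<in> E \<Longrightarrow> cj (cj \<sigma>) = \<sigma>"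
  using emb_extensional[of \<sigma>] by (auto simp: cj_def fun_eq_iff extensional_def restrict_def)

text \<open>With \<open>q\<close> the geometric mean of the \<open>T \<sigma>\<close>, cells of side
  \<open>T \<sigma> / (4 * q)\<close> are used. A conjugate is controlled by the coordinates at
  \<open>\<sigma>\<close> and \<open>cj \<sigma>\<close>, where \<open>T\<close> agrees; so two
  points of one cell differ by an integer of norm at most \<open>1 / 2 ^ deg\<close>, that is, by 0.
  Each coordinate meets at most \<open>16 * q + 2\<close> cells, and \<open>q \<ge> 1\<close> bounds
  this by \<open>18 * q\<close>.\<close>

lemma card_integers_in_box:
  "\<exists>C>0. \<forall>T. (\<forall>\<sigma>\<in>E. T \<sigma> > 0 \<and> T (cj \<sigma>) = T \<sigma>) \<and> (\<Prod>\<sigma>\<in>E. T \<sigma>) \<ge> 1 \<longrightarrow>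
     finite {x \<in> OK. \<forall>\<sigma>\<in>E. norm (\<sigma> x) \<le> T \<sigma>} \<and>
     real (card {x \<in> OK. \<forall>\<sigma>\<in>E. norm (\<sigma> x) \<le> T \<sigma>}) \<le> C * (\<Prod>\<sigma>\<in>E. T \<sigma>)"
proof (intro exI[of _ "18 ^ deg"] conjI allI impI, simp)
  fix T :: "(complex \<Rightarrow> complex) \<Rightarrow> real"
  let ?A = "{x \<in> OK. \<forall>\<sigma>\<in>E. norm (\<sigma> x) \<le> T \<sigma>}"
  define P where "P = (\<Prod>\<sigma>\<in>E. T \<sigma>)"
  assume "(\<forall>\<sigma>\<in>E. T \<sigma> > 0 \<and> T (cj \<sigma>) = T \<sigma>) \<and> (\<Prod>\<sigma>\<in>E. T \<sigma>) \<ge> 1"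
  hence T: "\<And>\<sigma>. \<sigma> \<in> E \<Longrightarrow> T \<sigma> > 0" "\<And>\<sigma>. \<sigma> \<in> E \<Longrightarrow> T (cj \<sigma>) = T \<sigma>" and P: "P \<ge> 1"
    by (auto simp: P_def)
  define q where "q = root deg P"
  have q: "q \<ge> 1" "q ^ deg = P" using P deg_pos by (auto simp: q_def)
  define s where "s \<sigma> = T \<sigma> / (4 * q)" for \<sigma>
  have s: "s \<sigma> > 0" if "\<sigma> \<in> E" for \<sigma> using T(1)[OF that] q by (simp add: s_def)
  have bound: "\<bar>re_im (\<sigma> x)\<bar> \<le> 2 * T \<sigma>" if "x \<in> ?A" "\<sigma> \<in> E" for x \<sigma>
  proof -
    have "norm (\<sigma> x) \<le> T \<sigma>" using that by simp
    thus ?thesis using abs_re_im_le[of "\<sigma> x"] by linarith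
  qed
  have sep: "x = y" if xy: "x \<in> ?A" "y \<in> ?A"
    and close: "\<And>\<sigma>. \<sigma> \<in> E \<Longrightarrow> \<bar>re_im (\<sigma> x) - re_im (\<sigma> y)\<bar> < s \<sigma>" for x y
  proof (rule ccontr)
    assume "x \<noteq> y"
    have O: "x - y \<in> OK" and K: "x \<in> K" "y \<in> K" using xy by (auto intro: OK_diff OK_K)
    have small: "norm (\<sigma> (x - y)) \<le> T \<sigma> / (2 * q)" if \<sigma>: "\<sigma> \<in> E" for \<sigma>
    proof -
      have "norm (\<sigma> (x - y)) \<le> \<bar>re_im (\<sigma> (x - y))\<bar> + \<bar>re_im (cj \<sigma> (x - y))\<bar>"
        using norm_le_re_im[of "\<sigma> (x - y)"] K by (simp add: cj_apply diff_K)
      also have "\<dots> \<le> s \<sigma> + s (cj \<sigma>)"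
        using close[OF \<sigma>] close[OF cj_emb[OF \<sigma>]] K \<sigma> by (simp add: emb_diff cj_emb re_im_diff)
      finally show ?thesis using T(2)[OF \<sigma>] by (simp add: s_def)
    qed
    have "1 \<le> Nm (x - y)"
      using norm_ge_1[OF O] \<open>x \<noteq> y\<close> by simp
    also have "\<dots> \<le> (\<Prod>\<sigma>\<in>E. T \<sigma> / (2 * q))"
      using small by (intro prod_mono) auto
    also have "\<dots> = P / (2 * q) ^ deg"
      by (simp add: prod_dividef P_def card_E)
    also have "\<dots> = 1 / 2 ^ deg"
      using q P by (simp add: power_mult_distrib)
    also have "\<dots> < 1" using deg_pos by simp
    finally show False by simp
  qed
  have T0: "0 \<le> 2 * T \<sigma>" if "\<sigma> \<in> E" for \<sigma> using T(1)[OF that] by simp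
  show "finite ?A"
    by (rule card_le_boxes(1)[where f = "\<lambda>x \<sigma>. re_im (\<sigma> x)" and R = "\<lambda>\<sigma>. 2 * T \<sigma>" and s = s and I = E])
      (fact finite_E bound s T0 sep)+
  have "real (card ?A) \<le> (\<Prod>\<sigma>\<in>E. 2 * (2 * T \<sigma>) / s \<sigma> + 2)"
    by (rule card_le_boxes(2)[where f = "\<lambda>x \<sigma>. re_im (\<sigma> x)" and R = "\<lambda>\<sigma>. 2 * T \<sigma>" and s = s and I = E])
      (fact finite_E bound s T0 sep)+
  also have "\<dots> \<le> (\<Prod>\<sigma>\<in>E. 18 * q)"
  proof (intro prod_mono conjI)
    fix \<sigma> assume \<sigma>: "\<sigma> \<in> E"
    have "2 * (2 * T \<sigma>) / s \<sigma> = 16 * q"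
      using T(1)[OF \<sigma>] q by (simp add: s_def field_simps)
    thus "2 * (2 * T \<sigma>) / s \<sigma> + 2 \<le> 18 * q" "0 \<le> 2 * (2 * T \<sigma>) / s \<sigma> + 2" using q by auto
  qed
  also have "\<dots> = 18 ^ deg * P" using q(2) by (simp add: card_E power_mult_distrib)
  finally show "real (card ?A) \<le> 18 ^ deg * (\<Prod>\<sigma>\<in>E. T \<sigma>)" by (simp add: P_def)
qed

lemma finite_integers_bounded: "finite {x \<in> OK. \<forall>\<sigma>\<in>E. norm (\<sigma> x) \<le> T}"
proof -
  have "(\<Prod>\<sigma>\<in>E. max T 1) \<ge> 1" by (intro prod_ge_1) auto
  moreover have "max T 1 > 0" by (simp add: less_max_iff_disj)
  moreover obtain C where "\<forall>S. (\<forall>\<sigma>\<in>E. S \<sigma> > 0 \<and> S (cj \<sigma>) = S \<sigma>) \<and> (\<Prod>\<sigma>\<in>E. S \<sigma>) \<ge> (1 :: real) \<longrightarrow>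
     finite {x \<in> OK. \<forall>\<sigma>\<in>E. norm (\<sigma> x) \<le> S \<sigma>} \<and>
     real (card {x \<in> OK. \<forall>\<sigma>\<in>E. norm (\<sigma> x) \<le> S \<sigma>}) \<le> C * (\<Prod>\<sigma>\<in>E. S \<sigma>)"
    using card_integers_in_box by blast
  ultimately have "finite {x \<in> OK. \<forall>\<sigma>\<in>E. norm (\<sigma> x) \<le> max T 1}"
    by (elim allE[of _ "\<lambda>_. max T 1"]) blast
  thus ?thesis
    by (rule rev_finite_subset) (auto intro: order.trans)
qed

section \<open>Norms of ideals\<close>

text \<open>Counting residue classes involves only the additive structure of an ideal.\<close>

definition add_subgroup :: "complex set \<Rightarrow> bool" where
  "add_subgroup I \<longleftrightarrow> 0 \<in> I \<and> I \<subseteq> OK \<and> (\<forall>x\<in>I. \<forall>y\<in>I. x - y \<in> I)"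

definition ideal_cong :: "complex set \<Rightarrow> (complex \<times> complex) set" where
  "ideal_cong I = {(x, y). x \<in> OK \<and> y \<in> OK \<and> x - y \<in> I}"

lemma ideal_norm_eq: "ideal_norm K I = card (OK // ideal_cong I)"
  by (simp add: ideal_norm_def ideal_cong_def)

lemma add_subgroup_neg: "add_subgroup I \<Longrightarrow> x - y \<in> I \<Longrightarrow> y - x \<in> I"
  unfolding add_subgroup_def by (metis diff_0 minus_diff_eq)

lemma add_subgroup_trans: "add_subgroup I \<Longrightarrow> x - y \<in> I \<Longrightarrow> y - z \<in> I \<Longrightarrow> x - z \<in> I"
  using add_subgroup_neg[of I y z] unfolding add_subgroup_def
  by (metis (no_types, opaque_lifting) diff_diff_eq2 diff_add_cancel)

lemma equiv_ideal_cong: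
  assumes "add_subgroup I"
  shows "equiv OK (ideal_cong I)"
proof (rule equivI)
  show "ideal_cong I \<subseteq> OK \<times> OK" by (auto simp: ideal_cong_def)
  show "refl_on OK (ideal_cong I)"
    using assms by (auto simp: refl_on_def ideal_cong_def add_subgroup_def)
  show "sym (ideal_cong I)"
    using add_subgroup_neg[OF assms] by (auto simp: sym_def ideal_cong_def)
  show "trans (ideal_cong I)"
    using add_subgroup_trans[OF assms] by (auto simp: trans_def ideal_cong_def)
qed

lemma class_eq_iff:
  assumes "add_subgroup I" and "x \<in> OK" and "y \<in> OK"
  shows "ideal_cong I `` {x} = ideal_cong I `` {y} \<longleftrightarrow> x - y \<in> I"
  using eq_equiv_class_iff[OF equiv_ideal_cong[OF assms(1)] assms(2,3)] assms by (simp add: ideal_cong_def)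

lemma quotient_eq_image: "OK // ideal_cong I = (\<lambda>x. ideal_cong I `` {x}) ` OK"
  by (auto simp: quotient_def)

text \<open>Finiteness is concluded along with the bound, because an infinite quotient would have
  \<open>ideal_norm\<close> 0 by the convention for \<open>card\<close>.\<close>

lemma quotient_representatives:
  assumes "add_subgroup I" and "finite S" and "\<And>x. x \<in> OK \<Longrightarrow> \<exists>y\<in>S. y \<in> OK \<and> x - y \<in> I"
  shows "finite (OK // ideal_cong I)" and "ideal_norm K I \<le> card S"
proof -
  have "OK // ideal_cong I \<subseteq> (\<lambda>x. ideal_cong I `` {x}) ` S"
  proof
    fix X assume "X \<in> OK // ideal_cong I"
    then obtain x where x: "x \<in> OK" "X = ideal_cong I `` {x}" by (auto simp: quotient_eq_image)
    obtain y where y: "y \<in> S" "y \<in> OK" "x - y \<in> I" using assms(3)[OF x(1)] by blast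
    have "X = ideal_cong I `` {y}" using class_eq_iff[OF assms(1) x(1) y(2)] x y by simp
    thus "X \<in> (\<lambda>x. ideal_cong I `` {x}) ` S" using y(1) by (rule image_eqI)
  qed
  thus "finite (OK // ideal_cong I)" "ideal_norm K I \<le> card S"
    unfolding ideal_norm_eq using assms(2)
    by (auto intro: finite_surj surj_card_le)
qed

text \<open>A class that meets \<open>S\<close> in a point \<open>x\<close> meets it exactly in the
  \<open>y\<close> congruent to \<open>x\<close>, hence at most \<open>c\<close> times.\<close>

lemma ideal_norm_lower:
  assumes "add_subgroup I" and "finite (OK // ideal_cong I)" and "finite S" and "S \<subseteq> OK"
    and c: "\<And>x. x \<in> S \<Longrightarrow> card {y \<in> S. x - y \<in> I} \<le> c"
  shows "card S \<le> ideal_norm K I * c"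
proof -
  have "S = (\<Union>A \<in> OK // ideal_cong I. S \<inter> A)"
    using Union_quotient[OF equiv_ideal_cong[OF assms(1)]] assms(4) by auto
  hence "card S \<le> (\<Sum>A \<in> OK // ideal_cong I. card (S \<inter> A))"
    using card_UN_le[OF assms(2), of "\<lambda>A. S \<inter> A"] by simp
  also have "\<dots> \<le> (\<Sum>A \<in> OK // ideal_cong I. c)"
  proof (rule sum_mono)
    fix A assume A: "A \<in> OK // ideal_cong I"
    show "card (S \<inter> A) \<le> c"
    proof (cases "S \<inter> A = {}")
      case False
      then obtain x where x: "x \<in> S" "x \<in> A" by blast
      have "A = ideal_cong I `` {x}"
        using A x by (metis Image_singleton_iff equiv_class_eq equiv_ideal_cong[OF assms(1)] quotientE)
      hence "S \<inter> A = {y \<in> S. x - y \<in> I}"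
        using assms(4) x by (auto simp: ideal_cong_def)
      thus ?thesis using c[OF x(1)] by simp
    qed auto
  qed
  finally show ?thesis by (simp add: ideal_norm_eq)
qed

lemma ideal_norm_pos:
  assumes "finite (OK // ideal_cong I)"
  shows "ideal_norm K I > 0"
  using assms OK_0 by (auto simp: ideal_norm_eq card_gt_0_iff quotient_def)

lemma add_subgroup_OK: "add_subgroup OK"
  by (auto simp: add_subgroup_def OK_0 OK_diff)

lemma add_subgroup_scale:
  assumes "add_subgroup I" and "d \<in> OK"
  shows "add_subgroup ((*) d ` I)"
  using assms unfolding add_subgroup_def
  by (auto simp: OK_mult subset_iff image_iff right_diff_distrib[symmetric])

text \<open>Multiplicativity of the index along \<open>d I\<close>, \<open>d OK\<close>,
  \<open>OK\<close>, combined with the bijection of \<open>OK / I\<close> with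
  \<open>d OK / d I\<close> given by multiplication by \<open>d\<close>. A class modulo
  \<open>d I\<close> is written uniquely as \<open>rep A + d * rep B\<close>.\<close>

lemma ideal_norm_scale:
  assumes I: "add_subgroup I" and d: "d \<in> OK" "d \<noteq> 0"
  shows "ideal_norm K ((*) d ` I) = ideal_norm K ((*) d ` OK) * ideal_norm K I"
proof -
  let ?D = "(*) d ` OK" and ?J = "(*) d ` I"
  have D: "add_subgroup ?D" and J: "add_subgroup ?J"
    using I d add_subgroup_OK by (auto intro: add_subgroup_scale)
  have IO: "I \<subseteq> OK" using I by (simp add: add_subgroup_def)
  define rep where "rep A = (SOME x. x \<in> A)" for A :: "complex set"
  have rep: "rep A \<in> OK \<and> A = ideal_cong M `` {rep A}" if M: "add_subgroup M" and A: "A \<in> OK // ideal_cong M" for M A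
  proof -
    obtain x where x: "x \<in> OK" "A = ideal_cong M `` {x}" using A by (auto simp: quotient_def)
    have "x \<in> A" using equiv_class_self[OF equiv_ideal_cong[OF M] x(1)] x by simp
    hence "rep A \<in> A" unfolding rep_def by (rule someI)
    hence "(x, rep A) \<in> ideal_cong M" using x by simp
    hence "A = ideal_cong M `` {rep A}"
      using x(2) equiv_class_eq[OF equiv_ideal_cong[OF M]] by metis
    moreover have "rep A \<in> OK"
      using \<open>(x, rep A) \<in> ideal_cong M\<close> by (simp add: ideal_cong_def)
    ultimately show ?thesis by simp
  qed
  define \<phi> where "\<phi> = (\<lambda>(A, B). ideal_cong ?J `` {rep A + d * rep B})"
  have "bij_betw \<phi> ((OK // ideal_cong ?D) \<times> (OK // ideal_cong I)) (OK // ideal_cong ?J)"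
  proof (rule bij_betw_imageI)
    show "inj_on \<phi> ((OK // ideal_cong ?D) \<times> (OK // ideal_cong I))"
    proof (rule inj_onI, clarify)
      fix A B A' B'
      assume A: "A \<in> OK // ideal_cong ?D" "A' \<in> OK // ideal_cong ?D"
        and B: "B \<in> OK // ideal_cong I" "B' \<in> OK // ideal_cong I"
        and eq: "\<phi> (A, B) = \<phi> (A', B')"
      note rs = rep[OF D A(1)] rep[OF D A(2)] rep[OF I B(1)] rep[OF I B(2)]
      have "(rep A + d * rep B) - (rep A' + d * rep B') \<in> ?J"
        using eq class_eq_iff[OF J] rs d by (simp add: \<phi>_def OK_add OK_mult)
      then obtain z where z: "z \<in> I" "(rep A + d * rep B) - (rep A' + d * rep B') = d * z" by auto
      have "rep A - rep A' = d * (z - rep B + rep B')" using z(2) by (simp add: algebra_simps)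
      moreover have "z - rep B + rep B' \<in> OK" using z(1) IO rs by (auto intro!: OK_add OK_diff)
      ultimately have "rep A - rep A' \<in> ?D" by blast
      hence AA: "A = A'" using class_eq_iff[OF D, of "rep A" "rep A'"] rs by metis
      hence "d * (rep B - rep B') = d * z" using z(2) by (simp add: algebra_simps)
      hence "rep B - rep B' \<in> I" using d(2) z(1) by simp
      hence "B = B'" using class_eq_iff[OF I, of "rep B" "rep B'"] rs by metis
      thus "A = A' \<and> B = B'" using AA by simp
    qed
    show "\<phi> ` ((OK // ideal_cong ?D) \<times> (OK // ideal_cong I)) = OK // ideal_cong ?J"
    proof (intro equalityI subsetI)
      fix X assume "X \<in> \<phi> ` ((OK // ideal_cong ?D) \<times> (OK // ideal_cong I))"
      then obtain A B where "A \<in> OK // ideal_cong ?D" "B \<in> OK // ideal_cong I" "X = \<phi> (A, B)" by auto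
      thus "X \<in> OK // ideal_cong ?J"
        using rep[OF D, of A] rep[OF I, of B] d by (auto simp: \<phi>_def quotient_eq_image OK_add OK_mult)
    next
      fix X assume "X \<in> OK // ideal_cong ?J"
      then obtain x where x: "x \<in> OK" "X = ideal_cong ?J `` {x}" by (auto simp: quotient_def)
      define A where "A = ideal_cong ?D `` {x}"
      have A: "A \<in> OK // ideal_cong ?D" using x by (auto simp: A_def quotient_def)
      have "x - rep A \<in> ?D" using rep[OF D A] class_eq_iff[OF D x(1)] A_def by metis
      then obtain y where y: "y \<in> OK" "x - rep A = d * y" by auto
      define B where "B = ideal_cong I `` {y}"
      have B: "B \<in> OK // ideal_cong I" using y by (auto simp: B_def quotient_def)
      have "y - rep B \<in> I" using rep[OF I B] class_eq_iff[OF I y(1)] B_def by metis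
      hence "d * (y - rep B) \<in> ?J" by (rule imageI)
      moreover have "x - (rep A + d * rep B) = d * (y - rep B)" using y(2) by (simp add: algebra_simps)
      ultimately have "X = \<phi> (A, B)"
        using class_eq_iff[OF J x(1), of "rep A + d * rep B"] rep[OF D A] rep[OF I B] d x
        by (simp add: \<phi>_def OK_add OK_mult)
      thus "X \<in> \<phi> ` ((OK // ideal_cong ?D) \<times> (OK // ideal_cong I))" using A B by blast
    qed
  qed
  thus ?thesis
    unfolding ideal_norm_eq by (metis bij_betw_same_card card_cartesian_product)
qed

section \<open>Norms of principal ideals, up to constants\<close>

definition theta_bound :: real where
  "theta_bound = 1 + (\<Sum>\<sigma>\<in>E. \<Sum>k<deg. norm (\<sigma> theta) ^ k)"

lemma theta_bound_ge_1: "theta_bound \<ge> 1"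
  by (auto simp: theta_bound_def intro!: sum_nonneg)

text \<open>Coordinates in the power basis control all conjugates at once;
  \<open>theta_bound\<close> sums over all embeddings and so does not depend on
  \<open>\<sigma>\<close>.\<close>

lemma norm_emb_combination_le:
  assumes "\<sigma> \<in> E" and "\<And>k. k < deg \<Longrightarrow> \<bar>c k\<bar> \<le> M" and "M \<ge> 0"
  shows "norm (\<sigma> (\<Sum>k<deg. of_rat (c k) * theta ^ k)) \<le> of_rat M * theta_bound"
proof -
  have "norm (\<sigma> (\<Sum>k<deg. of_rat (c k) * theta ^ k)) = norm (\<Sum>k<deg. of_rat (c k) * \<sigma> theta ^ k)"
    using assms(1) by (simp add: emb_sum emb_mult emb_of_rat emb_power of_rat_K power_K theta_K mult_K)
  also have "\<dots> \<le> (\<Sum>k<deg. of_rat M * norm (\<sigma> theta) ^ k)"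
  proof (rule sum_norm_le)
    fix k assume "k \<in> {..<deg}"
    hence "\<bar>c k\<bar> \<le> M" using assms(2) by simp
    moreover have "norm (of_rat (c k) :: complex) = of_rat \<bar>c k\<bar>"
      by (rule norm_of_rat)
    ultimately show "norm (of_rat (c k) * \<sigma> theta ^ k) \<le> of_rat M * norm (\<sigma> theta) ^ k"
      by (simp add: norm_mult norm_power mult_right_mono of_rat_less_eq)
  qed
  also have "\<dots> = of_rat M * (\<Sum>k<deg. norm (\<sigma> theta) ^ k)" by (simp add: sum_distrib_left)
  also have "\<dots> \<le> of_rat M * theta_bound"
  proof (rule mult_left_mono)
    have "(\<Sum>k<deg. norm (\<sigma> theta) ^ k) \<le> (\<Sum>\<sigma>\<in>E. \<Sum>k<deg. norm (\<sigma> theta) ^ k)"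
      using assms(1) finite_E by (intro member_le_sum) (auto intro: sum_nonneg)
    thus "(\<Sum>k<deg. norm (\<sigma> theta) ^ k) \<le> theta_bound" by (simp add: theta_bound_def)
    show "(0::real) \<le> of_rat M" using assms(3) by simp
  qed
  finally show ?thesis .
qed


text \<open>Rounding down the coefficients of \<open>x / e\<close> in the power basis shows
  \<open>x\<close> to be congruent modulo \<open>e\<close> to \<open>e\<close> times a combination
  with coefficients in \<open>[0, 1)\<close>. Such representatives lie in a box of volume
  \<open>theta_bound ^ deg * Nm e\<close>. The powers of \<open>theta\<close> may span less than
  \<open>OK\<close>, which does no harm: only integral multiples of \<open>e\<close> are
  subtracted.\<close>

lemma ideal_norm_principal_le:
  "\<exists>C>0. \<forall>e\<in>OK - {0}. finite (OK // ideal_cong ((*) e ` OK)) \<and>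
     real (ideal_norm K ((*) e ` OK)) \<le> C * Nm e"
proof -
  obtain C where C: "C > 0" and box: "\<And>T. (\<forall>\<sigma>\<in>E. T \<sigma> > 0 \<and> T (cj \<sigma>) = T \<sigma>) \<and> (\<Prod>\<sigma>\<in>E. T \<sigma>) \<ge> 1 \<Longrightarrow>
     finite {x \<in> OK. \<forall>\<sigma>\<in>E. norm (\<sigma> x) \<le> T \<sigma>} \<and>
     real (card {x \<in> OK. \<forall>\<sigma>\<in>E. norm (\<sigma> x) \<le> T \<sigma>}) \<le> C * (\<Prod>\<sigma>\<in>E. T \<sigma>)"
    using card_integers_in_box by blast
  have "finite (OK // ideal_cong ((*) e ` OK)) \<and>
     real (ideal_norm K ((*) e ` OK)) \<le> C * theta_bound ^ deg * Nm e"
    if e: "e \<in> OK" "e \<noteq> 0" for e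
  proof -
    define T where "T \<sigma> = theta_bound * norm (\<sigma> e)" for \<sigma> :: "complex \<Rightarrow> complex"
    let ?S = "{x \<in> OK. \<forall>\<sigma>\<in>E. norm (\<sigma> x) \<le> T \<sigma>}"
    have eK: "e \<in> K" using e OK_K by blast
    have prod: "(\<Prod>\<sigma>\<in>E. T \<sigma>) = theta_bound ^ deg * Nm e"
      by (simp add: T_def prod.distrib card_E)
    moreover have "1 * 1 \<le> theta_bound ^ deg * Nm e"
      using theta_bound_ge_1 norm_ge_1[OF e] by (intro mult_mono) auto
    moreover have "T \<sigma> > 0" "T (cj \<sigma>) = T \<sigma>" if "\<sigma> \<in> E" for \<sigma>
      using that theta_bound_ge_1 eK e by (auto simp: T_def cj_apply emb_nonzero)
    ultimately have S: "finite ?S" "real (card ?S) \<le> C * (theta_bound ^ deg * Nm e)"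
      using box[of T] by auto
    have rep: "\<exists>y\<in>?S. y \<in> OK \<and> x - y \<in> (*) e ` OK" if x: "x \<in> OK" for x
    proof -
      obtain c :: "nat \<Rightarrow> rat" where c: "x / e = (\<Sum>k<deg. of_rat (c k) * theta ^ k)"
        using power_basis[OF divide_K[OF OK_K[OF x] eK]] .
      define z where "z = (\<Sum>k<deg. of_int \<lfloor>c k\<rfloor> * theta ^ k)"
      have z: "z \<in> OK" unfolding z_def by (intro OK_sum OK_mult OK_of_int OK_power theta(1))
      have w: "x / e - z = (\<Sum>k<deg. of_rat (frac (c k)) * theta ^ k)"
        unfolding c z_def sum_subtractf[symmetric]
        by (intro sum.cong) (auto simp: frac_def of_rat_diff algebra_simps)
      define y where "y = x - e * z"
      have y: "y \<in> OK" unfolding y_def by (intro OK_diff OK_mult x z e)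
      have ye: "y = e * (x / e - z)" using e by (simp add: y_def field_simps)
      have "norm (\<sigma> y) \<le> T \<sigma>" if "\<sigma> \<in> E" for \<sigma>
      proof -
        have "norm (\<sigma> (x / e - z)) \<le> of_rat 1 * theta_bound"
          unfolding w using that by (rule norm_emb_combination_le) (auto simp: frac_lt_1 less_imp_le)
        hence "norm (\<sigma> e) * norm (\<sigma> (x / e - z)) \<le> norm (\<sigma> e) * theta_bound"
          by (intro mult_left_mono) auto
        thus ?thesis
          unfolding ye using that eK OK_K[OF x] OK_K[OF z]
          by (simp add: emb_mult diff_K divide_K norm_mult T_def mult.commute[of theta_bound])
      qed
      moreover have "x - y \<in> (*) e ` OK" using z by (auto simp: y_def)
      ultimately show ?thesis using y by blast
    qed
    have sub: "add_subgroup ((*) e ` OK)" by (rule add_subgroup_scale[OF add_subgroup_OK e(1)])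
    show ?thesis
      using quotient_representatives[OF sub S(1) rep] S(2) by (auto simp: mult.assoc)
  qed
  moreover have "C * theta_bound ^ deg > 0"
    using C theta_bound_ge_1 by simp
  ultimately show ?thesis by blast
qed

text \<open>The \<open>m ^ deg\<close> combinations of powers of \<open>theta\<close> with
  coefficients below \<open>m\<close> may be congruent to each other modulo \<open>m\<close>, as
  these powers may span a proper subring of \<open>OK\<close>. But two congruent ones differ by
  \<open>m\<close> times an element of the finite set \<open>Y\<close>, which does not depend on
  \<open>m\<close>; so a class contains at most \<open>card Y\<close> of them.\<close>

lemma ideal_norm_int_ge:
  "\<exists>c>0. \<forall>m>0. real (ideal_norm K ((*) (of_nat m) ` OK)) \<ge> c * real m ^ deg"
proof -
  define Y where "Y = {z \<in> OK. \<forall>\<sigma>\<in>E. norm (\<sigma> z) \<le> theta_bound}"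
  have Y: "finite Y" unfolding Y_def by (rule finite_integers_bounded)
  have "0 \<in> Y" using theta_bound_ge_1 by (simp add: Y_def OK_0 emb_0)
  hence cY: "card Y > 0" using Y by (auto simp: card_gt_0_iff)
  have "real (ideal_norm K ((*) (of_nat m) ` OK)) \<ge> 1 / real (card Y) * real m ^ deg"
    if m: "m > 0" for m
  proof -
    let ?I = "(*) (of_nat m) ` OK"
    define comb where "comb f = (\<Sum>k<deg. of_rat (of_nat (f k)) * theta ^ k)" for f :: "nat \<Rightarrow> nat"
    define S where "S = comb ` (PiE {..<deg} (\<lambda>_. {..<m}))"
    have comb_OK: "comb f \<in> OK" for f
      unfolding comb_def of_rat_of_nat_eq by (intro OK_sum OK_mult OK_of_nat OK_power theta(1))
    have diff: "comb f - comb g = (\<Sum>k<deg. of_rat (of_nat (f k) - of_nat (g k)) * theta ^ k)" for f g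
      unfolding comb_def sum_subtractf[symmetric]
      by (intro sum.cong) (auto simp: of_rat_diff algebra_simps)
    have inj: "inj_on comb (PiE {..<deg} (\<lambda>_. {..<m}))"
    proof (rule inj_onI)
      fix f g assume fg: "f \<in> PiE {..<deg} (\<lambda>_. {..<m})" "g \<in> PiE {..<deg} (\<lambda>_. {..<m})" "comb f = comb g"
      have "(of_nat (f k) - of_nat (g k) :: rat) = 0" if "k < deg" for k
        by (rule power_basis_independent[OF _ that]) (use fg(3) in \<open>simp flip: diff\<close>)
      thus "f = g" using fg by (intro PiE_ext[OF fg(1,2)]) auto
    qed
    have cS: "card S = m ^ deg" unfolding S_def by (simp add: card_image[OF inj] card_PiE)
    have SO: "S \<subseteq> OK" using comb_OK by (auto simp: S_def)
    have fS: "finite S" unfolding S_def by (intro finite_imageI finite_PiE) auto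
    have "card {y \<in> S. x - y \<in> ?I} \<le> card Y" if x: "x \<in> S" for x
    proof (rule card_inj_on_le[OF _ _ Y])
      let ?h = "\<lambda>y. (x - y) / of_nat m"
      show "inj_on ?h {y \<in> S. x - y \<in> ?I}" using m by (auto simp: inj_on_def)
      show "?h ` {y \<in> S. x - y \<in> ?I} \<subseteq> Y"
      proof clarify
        fix y z assume y: "y \<in> S" and z: "z \<in> OK" and xy: "x - y = of_nat m * z"
        have hz: "?h y = z" using m by (simp add: xy)
        obtain f where f: "f \<in> PiE {..<deg} (\<lambda>_. {..<m})" "x = comb f" using x by (auto simp: S_def)
        obtain g where g: "g \<in> PiE {..<deg} (\<lambda>_. {..<m})" "y = comb g" using y by (auto simp: S_def)
        have zc: "z = (\<Sum>k<deg. of_rat ((of_nat (f k) - of_nat (g k)) / of_nat m) * theta ^ k)"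
          unfolding hz[symmetric] f g diff sum_divide_distrib by (intro sum.cong) (auto simp: of_rat_divide)
        have "norm (\<sigma> z) \<le> of_rat 1 * theta_bound" if "\<sigma> \<in> E" for \<sigma>
          unfolding zc using that
        proof (rule norm_emb_combination_le)
          fix k assume k: "k < deg"
          have "f k < m" "g k < m" using f(1) g(1) k by (auto simp: PiE_iff)
          hence "(of_nat (f k) :: rat) < of_nat m" "(of_nat (g k) :: rat) < of_nat m" by simp_all
          moreover have "(of_nat (f k) :: rat) \<ge> 0" "(of_nat (g k) :: rat) \<ge> 0" by simp_all
          ultimately have "\<bar>of_nat (f k) - of_nat (g k)\<bar> \<le> (of_nat m :: rat)" by linarith
          thus "\<bar>(of_nat (f k) - of_nat (g k)) / of_nat m\<bar> \<le> (1 :: rat)"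
            using m by (simp add: abs_divide)
        qed simp
        thus "?h y \<in> Y" using z unfolding hz by (simp add: Y_def)
      qed
    qed
    moreover have "finite (OK // ideal_cong ?I)"
      using ideal_norm_principal_le OK_of_nat[of m] m by auto
    moreover have "add_subgroup ?I" by (rule add_subgroup_scale[OF add_subgroup_OK OK_of_nat])
    ultimately have "m ^ deg \<le> ideal_norm K ?I * card Y"
      using ideal_norm_lower[OF _ _ fS SO] cS by metis
    hence "real m ^ deg \<le> real (ideal_norm K ?I) * real (card Y)"
      by (metis of_nat_le_iff of_nat_mult of_nat_power)
    thus ?thesis using cY by (simp add: field_simps)
  qed
  thus ?thesis using cY by (intro exI[of _ "1 / real (card Y)"]) auto
qed

section \<open>Generated ideals and the norm of a fractional ideal\<close>

lemma fractional_ideal_gen_subset_OK: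
  assumes "M \<subseteq> OK"
  shows "fractional_ideal_gen K M \<subseteq> OK"
  using assms by (auto simp: fractional_ideal_gen_def intro!: OK_sum OK_mult)

lemma multiple_in_fractional_ideal_gen:
  assumes "a \<in> M" and "x \<in> OK"
  shows "x * a \<in> fractional_ideal_gen K M"
  unfolding fractional_ideal_gen_def using assms
  by (intro CollectI exI[of _ "{a}"] exI[of _ "\<lambda>_. x"]) auto

lemma add_subgroup_fractional_ideal_gen:
  assumes "M \<subseteq> OK"
  shows "add_subgroup (fractional_ideal_gen K M)"
  unfolding add_subgroup_def
proof (intro conjI ballI fractional_ideal_gen_subset_OK assms)
  show "0 \<in> fractional_ideal_gen K M"
    unfolding fractional_ideal_gen_def by (intro CollectI exI[of _ "{}"]) auto
  fix x y assume "x \<in> fractional_ideal_gen K M" "y \<in> fractional_ideal_gen K M"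
  then obtain B c B' c' where x: "finite B" "B \<subseteq> M" "\<forall>a\<in>B. c a \<in> OK" "x = (\<Sum>a\<in>B. c a * a)"
    and y: "finite B'" "B' \<subseteq> M" "\<forall>a\<in>B'. c' a \<in> OK" "y = (\<Sum>a\<in>B'. c' a * a)"
    unfolding fractional_ideal_gen_def by blast
  let ?c = "\<lambda>a. (if a \<in> B then c a else 0) - (if a \<in> B' then c' a else 0)"
  have "x = (\<Sum>a\<in>B \<union> B'. (if a \<in> B then c a else 0) * a)"
    unfolding x(4) using x(1) y(1) by (intro sum.mono_neutral_cong_left) auto
  moreover have "y = (\<Sum>a\<in>B \<union> B'. (if a \<in> B' then c' a else 0) * a)"
    unfolding y(4) using x(1) y(1) by (intro sum.mono_neutral_cong_left) auto
  ultimately have "x - y = (\<Sum>a\<in>B \<union> B'. ?c a * a)"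
    by (simp only: sum_subtractf[symmetric] left_diff_distrib)
  moreover have "\<forall>a\<in>B \<union> B'. ?c a \<in> OK" using x(3) y(3) by (auto simp: OK_0 OK_diff OK_minus)
  ultimately show "x - y \<in> fractional_ideal_gen K M"
    unfolding fractional_ideal_gen_def using x(1,2) y(1,2)
    by (intro CollectI exI[of _ "B \<union> B'"] exI[of _ ?c]) auto
qed

lemma fractional_ideal_gen_scale:
  assumes "x \<noteq> 0"
  shows "fractional_ideal_gen K ((*) x ` M) = (*) x ` fractional_ideal_gen K M"
proof (intro equalityI subsetI)
  have inj: "inj_on ((*) x) B" for B using assms by (auto simp: inj_on_def)
  fix y assume "y \<in> fractional_ideal_gen K ((*) x ` M)"
  then obtain B c where B: "finite B" "B \<subseteq> (*) x ` M" "\<forall>a\<in>B. c a \<in> OK" "y = (\<Sum>a\<in>B. c a * a)"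
    unfolding fractional_ideal_gen_def by blast
  obtain B' where B': "B' \<subseteq> M" "finite B'" "B = (*) x ` B'"
    using finite_subset_image[OF B(1,2)] by blast
  have "y = x * (\<Sum>a\<in>B'. c (x * a) * a)"
    unfolding B(4) B'(3) sum.reindex[OF inj] sum_distrib_left by (simp add: mult_ac)
  moreover have "(\<Sum>a\<in>B'. c (x * a) * a) \<in> fractional_ideal_gen K M"
    unfolding fractional_ideal_gen_def using B' B(3)
    by (intro CollectI exI[of _ B'] exI[of _ "\<lambda>a. c (x * a)"]) auto
  ultimately show "y \<in> (*) x ` fractional_ideal_gen K M" by blast
next
  have inj: "inj_on ((*) x) B" for B using assms by (auto simp: inj_on_def)
  fix y assume "y \<in> (*) x ` fractional_ideal_gen K M"
  then obtain B c where B: "finite B" "B \<subseteq> M" "\<forall>a\<in>B. c a \<in> OK" "y = x * (\<Sum>a\<in>B. c a * a)"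
    unfolding fractional_ideal_gen_def by blast
  have "y = (\<Sum>a\<in>(*) x ` B. c (a / x) * a)"
    unfolding B(4) sum.reindex[OF inj] sum_distrib_left using assms by (simp add: mult_ac)
  thus "y \<in> fractional_ideal_gen K ((*) x ` M)"
    unfolding fractional_ideal_gen_def using B assms
    by (intro CollectI exI[of _ "(*) x ` B"] exI[of _ "\<lambda>a. c (a / x)"]) auto
qed

text \<open>Scaling by \<open>e = m / x\<close> with an integer \<open>m\<close> reduces the claim to norms of principal ideals, so that
  multiplicativity of the norm on arbitrary ideals is not needed.\<close>

lemma fractional_ideal_norm_ge:
  "\<exists>c>0. \<forall>x M. x \<in> K - {0} \<longrightarrow> M \<subseteq> OK \<longrightarrow> M - {0} \<noteq> {} \<longrightarrow>
     fractional_ideal_norm K (fractional_ideal_gen K ((*) x ` M)) \<ge> c * Nm x"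
proof -
  obtain C where C: "C > 0" "\<And>e. e \<in> OK - {0} \<Longrightarrow> finite (OK // ideal_cong ((*) e ` OK))"
     "\<And>e. e \<in> OK - {0} \<Longrightarrow> real (ideal_norm K ((*) e ` OK)) \<le> C * Nm e"
    using ideal_norm_principal_le by blast
  obtain c where c: "c > 0" "\<And>m. m > 0 \<Longrightarrow> real (ideal_norm K ((*) (of_nat m) ` OK)) \<ge> c * real m ^ deg"
    using ideal_norm_int_ge by blast
  have "fractional_ideal_norm K (fractional_ideal_gen K ((*) x ` M)) \<ge> c / C * Nm x"
    if x: "x \<in> K" "x \<noteq> 0" and M: "M \<subseteq> OK" "M - {0} \<noteq> {}" for x M
  proof -
    let ?N = "\<lambda>d. ideal_norm K ((*) d ` OK)"
    define a where "a = fractional_ideal_gen K M"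
    have a: "add_subgroup a" unfolding a_def by (rule add_subgroup_fractional_ideal_gen[OF M(1)])
    obtain \<alpha> where \<alpha>: "\<alpha> \<in> M" "\<alpha> \<noteq> 0" using M(2) by blast
    have \<alpha>a: "(*) \<alpha> ` OK \<subseteq> a"
      using multiple_in_fractional_ideal_gen[OF \<alpha>(1)] by (auto simp: a_def mult.commute)
    have \<alpha>O: "\<alpha> \<in> OK - {0}" using \<alpha> M(1) by blast
    \<comment> \<open>The ideal contains all multiples of \<open>\<alpha>\<close>, so
      representatives modulo \<open>\<alpha>\<close> also represent every class modulo
      \<open>a\<close>.\<close>
    have "finite (OK // ideal_cong a)"
    proof -
      let ?Q = "OK // ideal_cong ((*) \<alpha> ` OK)"
      have sub: "add_subgroup ((*) \<alpha> ` OK)" using add_subgroup_scale[OF add_subgroup_OK] \<alpha>O by blast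
      have "\<exists>y\<in>(\<lambda>A. SOME y. y \<in> A) ` ?Q. y \<in> OK \<and> x - y \<in> a" if x: "x \<in> OK" for x
      proof -
        let ?A = "ideal_cong ((*) \<alpha> ` OK) `` {x}"
        have "x \<in> ?A" using equiv_class_self[OF equiv_ideal_cong[OF sub] x] .
        hence "(SOME y. y \<in> ?A) \<in> ?A" by (rule someI)
        moreover have "?A \<in> ?Q" using x by (auto simp: quotient_def)
        ultimately show ?thesis using \<alpha>a by (intro bexI[of _ "SOME y. y \<in> ?A"] imageI) (auto simp: ideal_cong_def)
      qed
      thus ?thesis using quotient_representatives(1)[OF a] C(2)[OF \<alpha>O] by (metis finite_imageI)
    qed
    hence Na: "ideal_norm K a \<ge> 1" using ideal_norm_pos by (simp add: Suc_leI)
    obtain m where m: "m > 0" "of_nat m * inverse x \<in> OK"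
      using integral_multiple[OF inverse_K[OF x(1)]] .
    define e where "e = of_nat m * inverse x"
    have e: "e \<in> OK" "e \<noteq> 0" "e * x = of_nat m" using m x by (auto simp: e_def)
    have mO: "of_nat m \<in> OK" "of_nat m \<noteq> (0::complex)" using m OK_of_nat by auto
    have Ne: "real (?N e) > 0" using ideal_norm_pos C(2) e by simp
    let ?P = "\<lambda>r. \<exists>d \<in> OK - {0}. (*) d ` ((*) x ` a) \<subseteq> OK \<and>
        r = real (ideal_norm K ((*) d ` ((*) x ` a))) / real (?N d)"
    \<comment> \<open>This evaluates the quotient for whichever denominator \<open>d\<close> is
      selected by the choice operator: multiplying \<open>?J\<close> by \<open>e\<close> replaces
      the factor \<open>x\<close> by the integer \<open>m\<close>, and the norm then splits into
      norms of principal ideals and the norm of \<open>a\<close>.\<close>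
    have val: "r = real (?N (of_nat m)) * real (ideal_norm K a) / real (?N e)" if "?P r" for r
    proof -
      from that obtain d where d: "d \<in> OK" "d \<noteq> 0" "(*) d ` ((*) x ` a) \<subseteq> OK"
        "r = real (ideal_norm K ((*) d ` ((*) x ` a))) / real (?N d)" by blast
      let ?J = "(*) d ` ((*) x ` a)"
      have J: "add_subgroup ?J"
        using a d(3) unfolding add_subgroup_def by (auto simp: right_diff_distrib[symmetric] image_iff)
      have "(*) e ` ?J = (*) (of_nat m) ` ((*) d ` a)"
        by (simp add: image_image e(3)[symmetric] mult_ac)
      hence "?N e * ideal_norm K ?J = ?N (of_nat m) * (?N d * ideal_norm K a)"
        using ideal_norm_scale[OF J e(1,2)] ideal_norm_scale[OF add_subgroup_scale[OF a d(1)] mO]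
          ideal_norm_scale[OF a d(1,2)] by simp
      hence "real (?N e) * real (ideal_norm K ?J) = real (?N (of_nat m)) * (real (?N d) * real (ideal_norm K a))"
        by (metis of_nat_mult)
      moreover have "real (?N d) > 0" using ideal_norm_pos C(2) d by simp
      ultimately show ?thesis using Ne by (simp add: d(4) field_simps)
    qed
    have "\<exists>r. ?P r"
    proof -
      have "(*) e ` ((*) x ` a) \<subseteq> OK"
        using a mO e(3) by (auto simp: add_subgroup_def mult.assoc[symmetric] OK_mult)
      thus ?thesis using e by blast
    qed
    hence "?P (fractional_ideal_norm K ((*) x ` a))"
      unfolding fractional_ideal_norm_def by (rule someI_ex)
    hence eq: "fractional_ideal_norm K ((*) x ` a) = real (?N (of_nat m)) * real (ideal_norm K a) / real (?N e)"
      by (rule val)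
    have Px: "Nm x > 0" using x by (intro prod_pos) (auto simp: emb_nonzero)
    have Pe: "Nm e * Nm x = real m ^ deg"
    proof -
      have "norm (\<sigma> e) * norm (\<sigma> x) = real m" if "\<sigma> \<in> E" for \<sigma>
        using that e(3) x(1) emb_mult[OF that OK_K[OF e(1)] x(1)] by (metis emb_of_nat norm_mult norm_of_nat)
      thus ?thesis by (simp add: prod.distrib[symmetric] card_E)
    qed
    have "c / C * Nm x * real (?N e) \<le> c / C * Nm x * (C * Nm e)"
      using C c e Px by (intro mult_left_mono) auto
    also have "\<dots> = c * real m ^ deg" using C(1) by (simp add: Pe[symmetric])
    also have "\<dots> \<le> real (?N (of_nat m)) * 1" using c(2)[OF m(1)] by simp
    also have "\<dots> \<le> real (?N (of_nat m)) * real (ideal_norm K a)"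
      using Na by (intro mult_left_mono) auto
    finally have "c / C * Nm x \<le> fractional_ideal_norm K ((*) x ` a)"
      unfolding eq using Ne by (simp add: pos_le_divide_eq)
    thus ?thesis by (simp add: a_def fractional_ideal_gen_scale x(2))
  qed
  thus ?thesis using C(1) c(1) by (intro exI[of _ "c / C"]) auto
qed

end

section \<open>Bases, minors and heights\<close>

definition lin_indep_family :: "'i set \<Rightarrow> ('i \<Rightarrow> complex ^ 'n) \<Rightarrow> bool" where
  "lin_indep_family I x \<longleftrightarrow> (\<forall>c. (\<Sum>i\<in>I. c i *s x i) = 0 \<longrightarrow> (\<forall>i\<in>I. c i = 0))"

lemma lin_indep_family_subset:
  assumes "lin_indep_family I x" and "J \<subseteq> I" and "finite I"
  shows "lin_indep_family J x"
  unfolding lin_indep_family_def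
proof (intro allI impI ballI)
  fix c i assume c: "(\<Sum>i\<in>J. c i *s x i) = 0" and i: "i \<in> J"
  have "(\<Sum>i\<in>I. (if i \<in> J then c i else 0) *s x i) = (\<Sum>i\<in>J. c i *s x i)"
    using assms(2,3) by (intro sum.mono_neutral_cong_right) auto
  hence "\<forall>i\<in>I. (if i \<in> J then c i else 0) = 0"
    using assms(1) c unfolding lin_indep_family_def by (elim allE[of _ "\<lambda>i. if i \<in> J then c i else 0"]) simp
  thus "c i = 0" using i assms(2) by (auto split: if_splits)
qed

text \<open>A nonzero minor of size \<open>d\<close> is enlarged by the row \<open>d\<close> and a
  column \<open>l\<close>. Expanded along this column, the new minor is the coordinate
  \<open>l\<close> of the fixed combination with coefficients \<open>C i\<close>. Since
  \<open>C d\<close> is the old minor, independence makes some coordinate nonzero, and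
  \<open>l\<close> cannot be an old column because two columns would then be equal.\<close>

lemma nonzero_minor:
  fixes x :: "nat \<Rightarrow> complex ^ 'n"
  assumes "lin_indep_family {..<d} x"
  shows "\<exists>f. inj_on f {..<d} \<and> Det (Matrix.mat d d (\<lambda>(i, k). vec_nth (x i) (f k))) \<noteq> 0"
  using assms
proof (induction d)
  case 0
  show ?case by (auto simp: det_dim_zero)
next
  case (Suc d)
  have "lin_indep_family {..<d} x"
    by (rule lin_indep_family_subset[OF Suc.prems]) auto
  then obtain f where f: "inj_on f {..<d}"
    "Det (Matrix.mat d d (\<lambda>(i, k). vec_nth (x i) (f k))) \<noteq> 0"
    using Suc.IH by blast
  define M where "M l = Matrix.mat (Suc d) (Suc d) (\<lambda>(i, k). vec_nth (x i) (if k = d then l else f k))" for l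
  have M: "M l \<in> carrier_mat (Suc d) (Suc d)" for l by (simp add: M_def)
  define C where "C i = (-1) ^ (i + d) *
    Det (Matrix.mat d d (\<lambda>(i', k). vec_nth (x (if i' < i then i' else Suc i')) (f k)))" for i
  have cof: "cofactor (M l) i d = C i" for l i
  proof -
    have "mat_delete (M l) i d = Matrix.mat d d (\<lambda>(i', k). vec_nth (x (if i' < i then i' else Suc i')) (f k))"
      by (rule eq_matI) (auto simp: mat_delete_def M_def)
    thus ?thesis by (simp add: cofactor_def C_def)
  qed
  have det: "Det (M l) = (\<Sum>i<Suc d. C i * vec_nth (x i) l)" for l
    using laplace_expansion_column[OF M, of d l]
    by (simp add: cof mult.commute) (simp add: M_def)
  have "C d = Det (Matrix.mat d d (\<lambda>(i, k). vec_nth (x i) (f k)))"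
  proof -
    have "Matrix.mat d d (\<lambda>(i', k). vec_nth (x (if i' < d then i' else Suc i')) (f k))
        = Matrix.mat d d (\<lambda>(i, k). vec_nth (x i) (f k))"
      by (rule eq_matI) auto
    thus ?thesis by (simp add: C_def flip: mult_2)
  qed
  hence "C d \<noteq> 0" using f(2) by simp
  hence "(\<Sum>i<Suc d. C i *s x i) \<noteq> 0"
    using Suc.prems unfolding lin_indep_family_def by blast
  then obtain l where "vec_nth (\<Sum>i<Suc d. C i *s x i) l \<noteq> 0"
    by (auto simp: cart_eq_iff)
  hence l: "Det (M l) \<noteq> 0" by (simp add: det)
  have "l \<notin> f ` {..<d}"
  proof
    assume "l \<in> f ` {..<d}"
    then obtain k where k: "k < d" "l = f k" by auto
    have "Det (M l) = 0"
      by (rule det_identical_columns[OF M, of k d]) (use k in \<open>auto simp: M_def intro!: eq_vecI\<close>)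
    thus False using l by simp
  qed
  hence "inj_on (\<lambda>k. if k = d then l else f k) {..<Suc d}"
    using f(1) by (auto simp: inj_on_def lessThan_Suc)
  thus ?case using l unfolding M_def by blast
qed

section \<open>Hermitian products, Gram determinants and change of basis\<close>

interpretation cnj_hom: comm_ring_hom cnj
  by unfold_locales auto

lemma hermitian_add_left: "hermitian (x + y) z = hermitian x z + hermitian y z"
  by (simp add: hermitian_def algebra_simps sum.distrib)

lemma hermitian_scale_left: "hermitian (c *s x) z = c * hermitian x z"
  by (simp add: hermitian_def algebra_simps sum_distrib_left)

lemma hermitian_cnj: "hermitian y x = cnj (hermitian x y)"
  by (simp add: hermitian_def mult.commute)

lemma hermitian_sum_left: "hermitian (\<Sum>i\<in>I. c i *s x i) z = (\<Sum>i\<in>I. c i * hermitian (x i) z)"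
  by (induction I rule: infinite_finite_induct)
    (auto simp: hermitian_add_left hermitian_scale_left hermitian_def[of 0])

lemma hermitian_sum_right: "hermitian z (\<Sum>i\<in>I. c i *s x i) = (\<Sum>i\<in>I. cnj (c i) * hermitian z (x i))"
proof -
  have "hermitian z (\<Sum>i\<in>I. c i *s x i) = cnj (hermitian (\<Sum>i\<in>I. c i *s x i) z)"
    by (rule hermitian_cnj)
  thus ?thesis
    by (simp only: hermitian_sum_left cnj_sum complex_cnj_mult hermitian_cnj[symmetric])
qed

definition gram_mat :: "(complex ^ 'n) list \<Rightarrow> complex mat" where
  "gram_mat Xs = Matrix.mat (length Xs) (length Xs) (\<lambda>(i, k). hermitian (Xs ! i) (Xs ! k))"

text \<open>The Gram matrix of \<open>Ys\<close> is \<open>A\<close> times that of \<open>Xs\<close>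
  times the conjugate transpose of \<open>A\<close>, so its determinant gains the squared modulus of
  \<open>Det A\<close>.\<close>

lemma wedge_norm_linear_image:
  assumes "length Ys = d" and "length Xs = d" and A: "A \<in> carrier_mat d d"
    and Y: "\<And>i. i < d \<Longrightarrow> Ys ! i = (\<Sum>k<d. A $$ (i, k) *s Xs ! k)"
  shows "wedge_norm Ys = norm (Det A) * wedge_norm Xs"
proof -
  let ?A' = "map_mat cnj (transpose_mat A)"
  have G: "gram_mat Xs \<in> carrier_mat d d" "gram_mat Ys \<in> carrier_mat d d"
    using assms by (auto simp: gram_mat_def)
  have A': "?A' \<in> carrier_mat d d" using A by simp
  have "gram_mat Ys = A * gram_mat Xs * ?A'"
  proof (rule eq_matI)
    fix i j assume "i < dim_row (A * gram_mat Xs * ?A')" "j < dim_col (A * gram_mat Xs * ?A')"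
    hence ij: "i < d" "j < d" using A by auto
    have "(A * gram_mat Xs * ?A') $$ (i, j) = (\<Sum>l<d. (\<Sum>k<d. A $$ (i, k) * hermitian (Xs ! k) (Xs ! l)) * cnj (A $$ (j, l)))"
      using ij A G assms(1,2) by (auto simp: scalar_prod_def gram_mat_def lessThan_atLeast0 intro!: sum.cong)
    also have "\<dots> = hermitian (Ys ! i) (Ys ! j)"
      unfolding Y[OF ij(1)] Y[OF ij(2)] hermitian_sum_right
      by (simp add: hermitian_sum_left mult.commute)
    finally show "gram_mat Ys $$ (i, j) = (A * gram_mat Xs * ?A') $$ (i, j)"
      using ij assms(1) by (simp add: gram_mat_def)
  qed (use A G in auto)
  hence "Det (gram_mat Ys) = Det A * Det (gram_mat Xs) * Det ?A'"
    using det_mult[OF A G(1)] det_mult[OF mult_carrier_mat[OF A G(1)] A'] by simp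
  also have "Det ?A' = cnj (Det A)"
    by (simp add: det_transpose[OF A])
  finally have "Det (gram_mat Ys) = of_real ((norm (Det A))\<^sup>2) * Det (gram_mat Xs)"
    by (simp only: complex_norm_square ac_simps)
  hence "Re (Det (gram_mat Ys)) = (norm (Det A))\<^sup>2 * Re (Det (gram_mat Xs))"
    by simp
  thus ?thesis by (simp add: wedge_norm_def gram_mat_def real_sqrt_mult)
qed

context num_field
begin

text \<open>Gaussian elimination over \<open>K\<close>: the coefficients, a priori complex, solve a
  linear system over \<open>K\<close> whose solution is unique. This is what allows embeddings to be
  applied to them.\<close>

lemma coefficients_in_K:
  fixes x :: "'i \<Rightarrow> complex ^ 'n"
  assumes "finite I" and "lin_indep_family I x" and "\<And>i l. i \<in> I \<Longrightarrow> vec_nth (x i) l \<in> K"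
    and "\<And>l. vec_nth (\<Sum>i\<in>I. c i *s x i) l \<in> K" and "i \<in> I"
  shows "c i \<in> K"
  using assms
proof (induction I arbitrary: x i)
  case (insert j I)
  have nz: "x j \<noteq> 0"
  proof
    assume "x j = 0"
    hence "(\<Sum>i\<in>insert j I. (if i = j then 1 else 0) *s x i) = 0"
      by (intro sum.neutral) auto
    hence "\<forall>i\<in>insert j I. (if i = j then 1 else 0) = (0 :: complex)"
      using insert.prems(1) unfolding lin_indep_family_def
      by (elim allE[of _ "\<lambda>i. if i = j then 1 else 0"]) simp
    thus False by simp
  qed
  then obtain l where l: "vec_nth (x j) l \<noteq> 0" by (auto simp: cart_eq_iff)
  \<comment> \<open>The multiple of \<open>x j\<close> whose subtraction kills the coordinate
    \<open>l\<close> of \<open>v\<close>; it is linear in \<open>v\<close> and lies in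
    \<open>K\<close> for vectors over \<open>K\<close>.\<close>
  define r where "r v = vec_nth v l / vec_nth (x j) l" for v :: "complex ^ 'n"
  define y where "y i = x i - r (x i) *s x j" for i
  define z where "z = (\<Sum>i\<in>insert j I. c i *s x i)"
  have z: "z = c j *s x j + (\<Sum>i\<in>I. c i *s x i)" using insert.hyps by (simp add: z_def)
  have rK: "r (x i) \<in> K" if "i \<in> I" for i using insert.prems(2) that by (simp add: r_def divide_K)
  have sumy: "(\<Sum>i\<in>I. b i *s y i) = (\<Sum>i\<in>I. b i *s x i) - (\<Sum>i\<in>I. b i * r (x i)) *s x j" for b
    by (simp add: y_def vec.scale_right_diff_distrib sum_subtractf vec.scale_sum_left)
  have rsum: "r (\<Sum>i\<in>I. b i *s x i) = (\<Sum>i\<in>I. b i * r (x i))" for b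
    by (simp add: r_def sum_divide_distrib)
  have "lin_indep_family I y"
    unfolding lin_indep_family_def
  proof (intro allI impI ballI)
    fix b i assume b: "(\<Sum>i\<in>I. b i *s y i) = 0" and i: "i \<in> I"
    let ?b = "\<lambda>i. if i = j then - (\<Sum>i\<in>I. b i * r (x i)) else b i"
    have "(\<Sum>i\<in>I. ?b i *s x i) = (\<Sum>i\<in>I. b i *s x i)"
      using insert.hyps by (intro sum.cong) auto
    hence "(\<Sum>i\<in>insert j I. ?b i *s x i) = 0"
      using insert.hyps b by (simp add: sumy)
    hence "\<forall>i\<in>insert j I. ?b i = 0"
      using insert.prems(1) unfolding lin_indep_family_def by (elim allE[of _ ?b]) blast
    thus "b i = 0" using i insert.hyps by (auto split: if_splits)
  qed
  moreover have "vec_nth (y i) l' \<in> K" if "i \<in> I" for i l'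
    using that insert.prems(2) rK by (simp add: y_def diff_K mult_K)
  moreover have "(\<Sum>i\<in>I. c i *s y i) = z - r z *s x j"
  proof -
    have "r z = c j + (\<Sum>i\<in>I. c i * r (x i))"
      using l by (simp add: z rsum[symmetric]) (simp add: r_def add_divide_distrib)
    thus ?thesis by (simp add: sumy z vec.scale_left_distrib)
  qed
  hence "vec_nth (\<Sum>i\<in>I. c i *s y i) l' \<in> K" for l'
    using insert.prems(2,3) by (simp add: z_def[symmetric] r_def diff_K mult_K divide_K)
  ultimately have cI: "c i \<in> K" if "i \<in> I" for i using insert.IH that by blast
  have "c j * vec_nth (x j) l = vec_nth z l - (\<Sum>i\<in>I. c i * vec_nth (x i) l)"
    by (simp add: z)
  hence "c j = (vec_nth z l - (\<Sum>i\<in>I. c i * vec_nth (x i) l)) / vec_nth (x j) l"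
    using l by (simp add: field_simps)
  moreover have "\<dots> \<in> K"
    using insert.prems(2,3) cI by (intro divide_K diff_K sum_K mult_K) (auto simp: z_def)
  ultimately show ?case using cI insert.prems(4) by auto
qed auto

lemma det_K:
  assumes A: "A \<in> carrier_mat d d" and AK: "\<And>i k. i < d \<Longrightarrow> k < d \<Longrightarrow> A $$ (i, k) \<in> K"
  shows "Det A \<in> K"
    and "\<sigma> \<in> E \<Longrightarrow> \<sigma> (Det A) = Det (map_mat \<sigma> A)"
proof -
  let ?t = "\<lambda>p. signof p * (\<Prod>i = 0..<d. A $$ (i, p i))"
  have sg: "(signof p :: complex) = of_int (signof p)" for p :: "nat \<Rightarrow> nat" by (simp add: sign_def)
  have pd: "p i < d" if "p permutes {0..<d}" "i < d" for p i
    using that permutes_in_image[of p "{0..<d}" i] by simp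
  have AK': "A $$ (i, p i) \<in> K" if "p permutes {0..<d}" "i \<in> {0..<d}" for p i
    using AK[of i "p i"] pd[of p i] that by simp
  have pK: "(\<Prod>i = 0..<d. A $$ (i, p i)) \<in> K" if "p permutes {0..<d}" for p
    by (intro prod_K AK' that)
  have tK: "?t p \<in> K" if "p permutes {0..<d}" for p
    unfolding sg[of p] using pK[OF that] by (intro mult_K of_int_K)
  show "Det A \<in> K" unfolding det_def'[OF A] using tK by (intro sum_K) auto
  assume \<sigma>: "\<sigma> \<in> E"
  have "\<sigma> (Det A) = (\<Sum>p | p permutes {0..<d}. \<sigma> (?t p))"
    unfolding det_def'[OF A] using tK by (intro emb_sum[OF \<sigma>]) auto
  also have "\<dots> = (\<Sum>p | p permutes {0..<d}. signof p * (\<Prod>i = 0..<d. map_mat \<sigma> A $$ (i, p i)))"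
  proof (intro sum.cong refl)
    fix p assume "p \<in> {p. p permutes {0..<d}}"
    hence p: "p permutes {0..<d}" by simp
    have "\<sigma> (?t p) = signof p * \<sigma> (\<Prod>i = 0..<d. A $$ (i, p i))"
      unfolding sg[of p] using pK[OF p] \<sigma> by (simp only: emb_mult of_int_K emb_of_int)
    also have "\<sigma> (\<Prod>i = 0..<d. A $$ (i, p i)) = (\<Prod>i = 0..<d. \<sigma> (A $$ (i, p i)))"
      by (intro emb_prod[OF \<sigma>] AK' p)
    also have "\<dots> = (\<Prod>i = 0..<d. map_mat \<sigma> A $$ (i, p i))"
      using A pd[OF p] by (intro prod.cong) auto
    finally show "\<sigma> (?t p) = signof p * (\<Prod>i = 0..<d. map_mat \<sigma> A $$ (i, p i))" .
  qed
  also have "\<dots> = Det (map_mat \<sigma> A)"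
    using A by (subst det_def'[of _ d]) auto
  finally show "\<sigma> (Det A) = Det (map_mat \<sigma> A)" .
qed

lemma det_OK:
  assumes A: "A \<in> carrier_mat d d" and AO: "\<And>i k. i < d \<Longrightarrow> k < d \<Longrightarrow> A $$ (i, k) \<in> OK"
  shows "Det A \<in> OK"
proof -
  have sg: "(signof p :: complex) = of_int (signof p)" for p :: "nat \<Rightarrow> nat" by (simp add: sign_def)
  have pd: "p i < d" if "p permutes {0..<d}" "i < d" for p i
    using that permutes_in_image[of p "{0..<d}" i] by simp
  show ?thesis unfolding det_def'[OF A] sg
  proof (intro OK_sum OK_mult OK_of_int OK_prod)
    fix p i assume "p \<in> {p. p permutes {0..<d}}" "i \<in> {0..<d}"
    thus "A $$ (i, p i) \<in> OK" using AO[of i "p i"] pd[of p i] by simp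
  qed
qed

lemma sum_list_family:
  assumes "distinct Xs"
  shows "(\<Sum>v\<in>set Xs. u v *s v) = (\<Sum>i<length Xs. u (Xs ! i) *s (Xs ! i))"
proof -
  have "bij_betw (\<lambda>i. Xs ! i) {..<length Xs} (set Xs)"
    using bij_betw_nth[OF assms] by simp
  thus ?thesis by (rule sum.reindex_bij_betw[symmetric])
qed

lemma lin_indep_family_list:
  assumes "distinct Xs" and "vec.independent (set Xs)"
  shows "lin_indep_family {..<length Xs} (\<lambda>i. Xs ! i)"
  unfolding lin_indep_family_def
proof (intro allI impI ballI)
  fix c i assume c: "(\<Sum>i<length Xs. c i *s Xs ! i) = 0" and i: "i \<in> {..<length Xs}"
  define u where "u v = c (THE i. i < length Xs \<and> Xs ! i = v)" for v
  have u: "u (Xs ! k) = c k" if "k < length Xs" for k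
  proof -
    have "(THE i. i < length Xs \<and> Xs ! i = Xs ! k) = k"
      using assms(1) that by (intro the_equality) (auto simp: nth_eq_iff_index_eq)
    thus ?thesis by (simp add: u_def)
  qed
  have "(\<Sum>v\<in>set Xs. u v *s v) = (\<Sum>i<length Xs. c i *s Xs ! i)"
    unfolding sum_list_family[OF assms(1)] using u by (intro sum.cong) auto
  hence "(\<Sum>v\<in>set Xs. u v *s v) = 0" using c by simp
  hence "u (Xs ! i) = 0"
    using assms(2) i vec.independentD[of "set Xs" "set Xs" u "Xs ! i"] by auto
  thus "c i = 0" using u i by simp
qed

lemma span_list_coefficients:
  assumes "distinct Xs" and "z \<in> vec.span (set Xs)"
  obtains c where "z = (\<Sum>i<length Xs. c i *s Xs ! i)"
proof -
  obtain u where "z = (\<Sum>v\<in>set Xs. u v *s v)"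
    using assms(2) by (auto simp: vec.span_finite)
  thus ?thesis using that[of "\<lambda>i. u (Xs ! i)"] sum_list_family[OF assms(1)] by simp
qed

text \<open>This unifies the real and the complex reading of the ambient notions. For
  \<open>K \<subseteq> \<real>\<close>, the real and imaginary parts of a complex relation between
  real vectors are real relations, so real independence implies complex independence.\<close>

lemma rational_basisD:
  fixes Xs :: "(complex ^ 'n) list"
  assumes "rational_basis K S Xs"
  shows "distinct Xs" and "vec.independent (set Xs)" and "S \<subseteq> vec.span (set Xs)" and "set Xs \<subseteq> S"
    and "\<And>X l. X \<in> set Xs \<Longrightarrow> vec_nth X l \<in> K"
proof -
  show d: "distinct Xs" and XK: "\<And>X l. X \<in> set Xs \<Longrightarrow> vec_nth X l \<in> K"
    using assms by (auto simp: rational_basis_def)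
  have ind: "ambient_independent K (set Xs)" and S: "S = ambient_span K (set Xs)"
    using assms by (auto simp: rational_basis_def)
  show "set Xs \<subseteq> S"
    unfolding S ambient_span_def using span_superset vec.span_superset by auto
  have "span (set Xs) \<subseteq> vec.span (set Xs)"
  proof (rule span_minimal)
    show "set Xs \<subseteq> vec.span (set Xs)" by (rule vec.span_superset)
    have "r *\<^sub>R x = complex_of_real r *s x" for r and x :: "complex ^ 'n"
      by (simp add: cart_eq_iff) (simp add: scaleR_conv_of_real)
    thus "subspace (vec.span (set Xs))"
      by (auto simp: subspace_def vec.span_zero vec.span_add vec.span_scale)
  qed
  thus "S \<subseteq> vec.span (set Xs)" unfolding S ambient_span_def by auto
  show "vec.independent (set Xs)"
  proof (cases "K \<subseteq> \<real>")
    case True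
    hence ind: "independent (set Xs)" using ind by (simp add: ambient_independent_def)
    have real: "Im (vec_nth X l) = 0" if "X \<in> set Xs" for X l
      using XK[OF that, of l] True by (auto simp: complex_is_Real_iff)
    show ?thesis
    proof (rule vec.independent_if_scalars_zero)
      fix f x assume f: "(\<Sum>x\<in>set Xs. f x *s x) = 0" and x: "x \<in> set Xs"
      have "Re (vec_nth (\<Sum>x\<in>set Xs. f x *s x) l) = vec_nth (\<Sum>x\<in>set Xs. Re (f x) *\<^sub>R x) l
        \<and> Im (vec_nth (\<Sum>x\<in>set Xs. f x *s x) l) = vec_nth (\<Sum>x\<in>set Xs. Im (f x) *\<^sub>R x) l" for l
        by (auto simp: complex_eq_iff real)
      hence "(\<Sum>x\<in>set Xs. Re (f x) *\<^sub>R x) = 0" "(\<Sum>x\<in>set Xs. Im (f x) *\<^sub>R x) = 0"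
        unfolding f by (simp_all add: cart_eq_iff)
      hence "Re (f x) = 0" "Im (f x) = 0"
        using independentD[OF ind, of "set Xs" "\<lambda>x. Re (f x)" x]
          independentD[OF ind, of "set Xs" "\<lambda>x. Im (f x)" x] x by auto
      thus "f x = 0" by (simp add: complex_eq_iff)
    qed auto
  next
    case False
    thus ?thesis using ind by (simp add: ambient_independent_def)
  qed
qed

text \<open>Both lists span the same complex space, so each is expanded in the other; independence
  turns the product of the two coefficient matrices into the identity. The entries lie in
  \<open>K\<close> by \<open>coefficients_in_K\<close>.\<close>

lemma rational_basis_change:
  fixes Xs Ys :: "(complex ^ 'n) list"
  assumes X: "rational_basis K S Xs" and Y: "rational_basis K S Ys"
  shows "length Ys = length Xs \<and> (\<exists>A. A \<in> carrier_mat (length Xs) (length Xs) \<and>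
    (\<forall>i<length Xs. \<forall>k<length Xs. A $$ (i, k) \<in> K) \<and>
    (\<forall>i<length Xs. Ys ! i = (\<Sum>k<length Xs. A $$ (i, k) *s Xs ! k)) \<and>
    Det A \<noteq> 0)"
proof -
  note DX = rational_basisD[OF X] and DY = rational_basisD[OF Y]
  define d where "d = length Xs"
  have len: "length Ys = d"
  proof -
    have "card (set Ys) \<le> card (set Xs)"
      using vec.independent_span_bound[of "set Xs" "set Ys"] DX(3) DY(2,4) by auto
    moreover have "card (set Xs) \<le> card (set Ys)"
      using vec.independent_span_bound[of "set Ys" "set Xs"] DY(3) DX(2,4) by auto
    ultimately show ?thesis using DX(1) DY(1) by (simp add: d_def distinct_card)
  qed
  have "\<exists>c. Ys ! i = (\<Sum>k<d. c k *s Xs ! k)" if "i < d" for i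
  proof -
    have "Ys ! i \<in> set Ys" using that len by simp
    hence "Ys ! i \<in> vec.span (set Xs)" using DY(4) DX(3) by blast
    then obtain c where "Ys ! i = (\<Sum>k<length Xs. c k *s Xs ! k)"
      by (rule span_list_coefficients[OF DX(1)])
    thus ?thesis unfolding d_def by blast
  qed
  then obtain a where a: "\<And>i. i < d \<Longrightarrow> Ys ! i = (\<Sum>k<d. a i k *s Xs ! k)" by metis
  have "\<exists>c. Xs ! i = (\<Sum>k<d. c k *s Ys ! k)" if "i < d" for i
  proof -
    have "Xs ! i \<in> set Xs" using that by (simp add: d_def)
    hence "Xs ! i \<in> vec.span (set Ys)" using DX(4) DY(3) by blast
    then obtain c where "Xs ! i = (\<Sum>k<length Ys. c k *s Ys ! k)"
      by (rule span_list_coefficients[OF DY(1)])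
    thus ?thesis unfolding len by blast
  qed
  then obtain b where b: "\<And>i. i < d \<Longrightarrow> Xs ! i = (\<Sum>k<d. b i k *s Ys ! k)" by metis
  have indX: "lin_indep_family {..<d} (\<lambda>i. Xs ! i)"
    using lin_indep_family_list[OF DX(1,2)] by (simp add: d_def)
  define A where "A = Matrix.mat d d (\<lambda>(i, k). a i k)"
  define B where "B = Matrix.mat d d (\<lambda>(i, k). b i k)"
  have carrier: "A \<in> carrier_mat d d" "B \<in> carrier_mat d d" by (auto simp: A_def B_def)
  have "B * A = 1\<^sub>m d"
  proof (rule eq_matI)
    fix i j assume "i < dim_row (1\<^sub>m d :: complex mat)" "j < dim_col (1\<^sub>m d :: complex mat)"
    hence ij: "i < d" "j < d" by auto
    let ?e = "\<lambda>l. (\<Sum>k<d. b i k * a k l) - (if l = i then 1 else 0)"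
    have "Xs ! i = (\<Sum>k<d. b i k *s (\<Sum>l<d. a k l *s Xs ! l))"
      unfolding b[OF ij(1)] using a by (intro sum.cong) auto
    also have "\<dots> = (\<Sum>l<d. (\<Sum>k<d. b i k * a k l) *s Xs ! l)"
      by (simp add: vec.scale_sum_right vec.scale_sum_left) (rule sum.swap)
    finally have "(\<Sum>l<d. (\<Sum>k<d. b i k * a k l) *s Xs ! l) - Xs ! i = 0" by simp
    moreover have "Xs ! i = (\<Sum>l<d. (if l = i then 1 else 0) *s Xs ! l)"
      using ij by (simp add: if_distrib[of "\<lambda>z. z *s _"] if_distribR cong: if_cong)
    ultimately have "(\<Sum>l<d. ?e l *s Xs ! l) = 0"
      by (simp add: vec.scale_left_diff_distrib sum_subtractf)
    hence "?e j = 0" using indX ij unfolding lin_indep_family_def by (elim allE[of _ ?e]) blast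
    thus "(B * A) $$ (i, j) = 1\<^sub>m d $$ (i, j)"
      using ij by (auto simp: A_def B_def scalar_prod_def lessThan_atLeast0 split: if_splits)
  qed (auto simp: A_def B_def)
  hence "Det B * Det A = 1" using det_mult[OF carrier(2,1)] by simp
  hence "Det A \<noteq> 0" by auto
  moreover have "A $$ (i, k) \<in> K" if "i < d" "k < d" for i k
  proof -
    have "a i k \<in> K"
      by (rule coefficients_in_K[OF _ indX, of "a i"])
        (use that len DX(5) DY(5) in \<open>auto simp: d_def a[OF that(1), unfolded d_def, symmetric]\<close>)
    thus ?thesis using that by (simp add: A_def)
  qed
  moreover have "Ys ! i = (\<Sum>k<d. A $$ (i, k) *s Xs ! k)" if "i < d" for i
    unfolding a[OF that] using that by (intro sum.cong) (auto simp: A_def)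
  ultimately show ?thesis using carrier(1) len unfolding d_def by blast
qed

lemma conjugate_vec_sum:
  assumes "\<sigma> \<in> E" and "\<And>k. k \<in> I \<Longrightarrow> c k \<in> K" and "\<And>k l. k \<in> I \<Longrightarrow> vec_nth (x k) l \<in> K"
  shows "conjugate_vec \<sigma> (\<Sum>k\<in>I. c k *s x k) = (\<Sum>k\<in>I. \<sigma> (c k) *s conjugate_vec \<sigma> (x k))"
  using assms by (simp add: cart_eq_iff conjugate_vec_def emb_sum emb_mult mult_K)

text \<open>If the basis chosen by \<open>height\<close> arises from \<open>Xs\<close> by a matrix
  of determinant \<open>x\<close>, the minors scale by \<open>x\<close> and the volumes by the
  modulus of each conjugate of \<open>x\<close>. The resulting \<open>Nm x\<close> cancels against
  the lower bound for the ideal norm, for which \<open>Xs\<close> has to be integral. The absolute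
  values make all factors nonnegative.\<close>

lemma height_le:
  "\<exists>C>0. \<forall>S (Xs :: (complex ^ 'n) list). rational_basis K S Xs \<longrightarrow> (\<forall>X\<in>set Xs. \<forall>l. vec_nth X l \<in> OK) \<longrightarrow>
     height K S \<le> C * (\<Prod>\<sigma>\<in>E. \<bar>wedge_norm (map (conjugate_vec \<sigma>) Xs)\<bar>)"
proof -
  obtain c where c: "c > 0" and frac: "\<And>x M. x \<in> K - {0} \<Longrightarrow> M \<subseteq> OK \<Longrightarrow> M - {0} \<noteq> {} \<Longrightarrow>
     fractional_ideal_norm K (fractional_ideal_gen K ((*) x ` M)) \<ge> c * Nm x"
    using fractional_ideal_norm_ge by blast
  have "height K S \<le> 1 / c * (\<Prod>\<sigma>\<in>E. \<bar>wedge_norm (map (conjugate_vec \<sigma>) Xs)\<bar>)"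
    if X: "rational_basis K S Xs" and XO: "\<And>X l. X \<in> set Xs \<Longrightarrow> vec_nth X l \<in> OK"
    for S and Xs :: "(complex ^ 'n) list"
  proof -
    define Ys where "Ys = (SOME Xs. rational_basis K S Xs)"
    have Y: "rational_basis K S Ys" unfolding Ys_def using X by (rule someI)
    define d where "d = length Xs"
    have lenY: "length Ys = d" using rational_basis_change[OF X Y] by (simp add: d_def)
    obtain A where A0: "A \<in> carrier_mat d d"
      "\<forall>i<d. \<forall>k<d. A $$ (i, k) \<in> K" "\<forall>i<d. Ys ! i = (\<Sum>k<d. A $$ (i, k) *s Xs ! k)"
      "Det A \<noteq> 0"
      using rational_basis_change[OF X Y] unfolding d_def by (elim exE conjE)
    have A: "length Ys = d" "A \<in> carrier_mat d d" "\<And>i k. i < d \<Longrightarrow> k < d \<Longrightarrow> A $$ (i, k) \<in> K"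
      "\<And>i. i < d \<Longrightarrow> Ys ! i = (\<Sum>k<d. A $$ (i, k) *s Xs ! k)" "Det A \<noteq> 0"
      using A0 lenY by blast+
    define x where "x = Det A"
    have x: "x \<in> K - {0}" using det_K(1)[OF A(2,3)] A(5) by (auto simp: x_def)
    have minor: "Det (Matrix.mat d d (\<lambda>(i, k). vec_nth (Ys ! i) (f k)))
        = x * Det (Matrix.mat d d (\<lambda>(i, k). vec_nth (Xs ! i) (f k)))" for f
    proof -
      have "Matrix.mat d d (\<lambda>(i, k). vec_nth (Ys ! i) (f k)) = A * Matrix.mat d d (\<lambda>(i, k). vec_nth (Xs ! i) (f k))"
        using A(2,4) by (intro eq_matI) (auto simp: scalar_prod_def lessThan_atLeast0)
      thus ?thesis using det_mult[OF A(2)] by (simp add: x_def)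
    qed
    have MY: "maximal_minors Ys = (*) x ` maximal_minors Xs"
      unfolding maximal_minors_def A(1) d_def[symmetric] by (auto simp: minor)
    have MO: "maximal_minors Xs \<subseteq> OK"
      unfolding maximal_minors_def by (auto intro!: det_OK XO)
    have "maximal_minors Xs - {0} \<noteq> {}"
      using nonzero_minor[OF lin_indep_family_list[OF rational_basisD(1,2)[OF X]]]
      by (auto simp: maximal_minors_def)
    hence fr: "fractional_ideal_norm K (fractional_ideal_gen K (maximal_minors Ys)) \<ge> c * Nm x"
      using frac[OF x MO] by (simp add: MY)
    have Px: "Nm x > 0" using x by (intro prod_pos) (auto simp: emb_nonzero)
    have W: "wedge_norm (map (conjugate_vec \<sigma>) Ys) = norm (\<sigma> x) * wedge_norm (map (conjugate_vec \<sigma>) Xs)"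
      if \<sigma>: "\<sigma> \<in> E" for \<sigma>
    proof -
      have "wedge_norm (map (conjugate_vec \<sigma>) Ys)
          = norm (Det (map_mat \<sigma> A)) * wedge_norm (map (conjugate_vec \<sigma>) Xs)"
      proof (rule wedge_norm_linear_image)
        fix i assume i: "i < d"
        have "conjugate_vec \<sigma> (Ys ! i) = (\<Sum>k<d. \<sigma> (A $$ (i, k)) *s conjugate_vec \<sigma> (Xs ! k))"
          unfolding A(4)[OF i]
          using A(3)[OF i] rational_basisD(5)[OF X] by (intro conjugate_vec_sum[OF \<sigma>]) (auto simp: d_def)
        also have "\<dots> = (\<Sum>k<d. map_mat \<sigma> A $$ (i, k) *s map (conjugate_vec \<sigma>) Xs ! k)"
          using A(2) i by (intro sum.cong) (auto simp: d_def)
        finally show "map (conjugate_vec \<sigma>) Ys ! i = (\<Sum>k<d. map_mat \<sigma> A $$ (i, k) *s map (conjugate_vec \<sigma>) Xs ! k)"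
          using i A(1) by simp
      qed (use A d_def in auto)
      thus ?thesis using det_K(2)[OF A(2,3) \<sigma>] by (simp add: x_def)
    qed
    let ?F = "fractional_ideal_norm K (fractional_ideal_gen K (maximal_minors Ys))"
    let ?P = "\<Prod>\<sigma>\<in>E. norm (\<sigma> x)" and ?W = "\<Prod>\<sigma>\<in>E. wedge_norm (map (conjugate_vec \<sigma>) Xs)"
    have "height K S = inverse ?F * ?P * ?W"
      by (simp add: height_def Ys_def[symmetric] basis_height_def W prod.distrib cong: prod.cong)
    also have "\<dots> \<le> inverse ?F * ?P * \<bar>?W\<bar>"
    proof (rule mult_left_mono)
      have "c * ?P > 0" using c Px by simp
      hence "?F > 0" using fr by linarith
      thus "0 \<le> inverse ?F * ?P" using Px by simp
    qed auto
    also have "\<dots> \<le> 1 / c * \<bar>?W\<bar>"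
    proof (rule mult_right_mono)
      have "c * ?P > 0" using c Px by simp
      hence "inverse ?F \<le> inverse (c * ?P)" using fr by (intro le_imp_inverse_le)
      hence "inverse ?F * ?P \<le> inverse (c * ?P) * ?P" using Px by (intro mult_right_mono) auto
      thus "inverse ?F * ?P \<le> 1 / c" using Px c by (simp add: field_simps)
    qed auto
    finally show ?thesis by (simp add: abs_prod)
  qed
  thus ?thesis using c by (intro exI[of _ "1 / c"]) auto
qed

end

section \<open>Orthogonalisation\<close>

definition cnj_vec :: "complex ^ 'n \<Rightarrow> complex ^ 'n" where
  "cnj_vec x = (\<chi> i. cnj (vec_nth x i))"

lemma cnj_vec_diff: "cnj_vec (x - y) = cnj_vec x - cnj_vec y"
  by (simp add: cnj_vec_def cart_eq_iff)

lemma cnj_vec_scale: "cnj_vec (c *s x) = cnj c *s cnj_vec x"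
  by (simp add: cnj_vec_def cart_eq_iff)

lemma cnj_vec_sum: "cnj_vec (\<Sum>i\<in>I. x i) = (\<Sum>i\<in>I. cnj_vec (x i))"
  by (simp add: cnj_vec_def cart_eq_iff)

lemma norm_cnj_vec: "norm (cnj_vec x) = norm x"
  by (simp add: cnj_vec_def norm_vec_def)

lemma hermitian_cnj_vec: "hermitian (cnj_vec x) (cnj_vec y) = cnj (hermitian x y)"
  by (simp add: hermitian_def cnj_vec_def)

lemma hermitian_self: "hermitian x x = of_real ((norm x)\<^sup>2)"
  by (simp add: hermitian_def norm_vec_def L2_set_def sum_nonneg complex_norm_square[symmetric])

lemma norm_hermitian_le: "norm (hermitian x y) \<le> norm x * norm y"
proof -
  have "norm (hermitian x y) \<le> (\<Sum>i\<in>UNIV. \<bar>norm (vec_nth x i)\<bar> * \<bar>norm (vec_nth y i)\<bar>)"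
    unfolding hermitian_def by (rule sum_norm_le) (simp add: norm_mult)
  also have "\<dots> \<le> norm x * norm y"
    unfolding norm_vec_def by (rule L2_set_mult_ineq)
  finally show ?thesis .
qed

lemma norm_scale_complex: "norm (c *s x) = norm c * norm (x :: complex ^ 'n)"
  by (simp add: norm_vec_def norm_mult L2_set_right_distrib)

lemma hermitian_0_left [simp]: "hermitian 0 x = 0" and hermitian_0_right [simp]: "hermitian x 0 = 0"
  by (simp_all add: hermitian_def)

lemma hermitian_diff_left: "hermitian (x - y) z = hermitian x z - hermitian y z"
  by (simp add: hermitian_def algebra_simps sum_subtractf)

text \<open>Since \<open>1 / 0 = 0\<close>, a vector depending on its predecessors contributes \<open>0\<close> to the frame.\<close>

fun gs_frame :: "(nat \<Rightarrow> complex ^ 'n) \<Rightarrow> nat \<Rightarrow> complex ^ 'n" where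
  "gs_frame v k =
     (let e = v k - (\<Sum>i\<in>{..<k}. hermitian (v k) (gs_frame v i) *s gs_frame v i)
      in of_real (1 / norm e) *s e)"

declare gs_frame.simps [simp del]

context
  fixes v :: "nat \<Rightarrow> complex ^ 'n"
begin

abbreviation "g \<equiv> gs_frame v"

definition gs_residual :: "nat \<Rightarrow> complex ^ 'n" where
  "gs_residual k = v k - (\<Sum>i\<in>{..<k}. hermitian (v k) (g i) *s g i)"

lemma frame_eq: "g k = of_real (1 / norm (gs_residual k)) *s gs_residual k"
  by (subst gs_frame.simps) (simp add: gs_residual_def Let_def)

lemma frame_cases: "g k = 0 \<or> norm (g k) = 1"
  by (cases "gs_residual k = 0") (auto simp: frame_eq norm_scale_complex norm_divide)

lemma norm_frame_le: "norm (g k) \<le> 1"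
  using frame_cases[of k] by auto

lemma frame_self: "c * hermitian (g k) (g k) = c \<or> g k = 0"
  using frame_cases[of k] by (auto simp: hermitian_self)

lemma frame_orthogonal: "i < k \<Longrightarrow> hermitian (g k) (g i) = 0"
proof (induction k arbitrary: i rule: less_induct)
  case (less k)
  have orth: "hermitian (g a) (g b) = 0" if "a < k" "b < k" "a \<noteq> b" for a b
  proof (cases "b < a")
    case True
    thus ?thesis using less.IH that by blast
  next
    case False
    hence "hermitian (g b) (g a) = 0" using less.IH that by simp
    thus ?thesis by (subst hermitian_cnj) simp
  qed
  have "hermitian (gs_residual k) (g i)
      = hermitian (v k) (g i) - (\<Sum>i'\<in>{..<k}. hermitian (v k) (g i') * hermitian (g i') (g i))"
    by (simp add: gs_residual_def hermitian_diff_left hermitian_sum_left)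
  also have "(\<Sum>i'\<in>{..<k}. hermitian (v k) (g i') * hermitian (g i') (g i))
      = (\<Sum>i'\<in>{..<k}. if i' = i then hermitian (v k) (g i) * hermitian (g i) (g i) else 0)"
    using orth less.prems by (intro sum.cong) auto
  also have "\<dots> = hermitian (v k) (g i) * hermitian (g i) (g i)"
    using less.prems by simp
  also have "hermitian (v k) (g i) - \<dots> = 0"
    using frame_self[of "hermitian (v k) (g i)" i] by auto
  finally show ?case by (simp add: frame_eq[of k] hermitian_scale_left)
qed

lemma frame_orthogonal': "i \<noteq> k \<Longrightarrow> hermitian (g k) (g i) = 0"
proof (cases "i < k")
  case False
  assume "i \<noteq> k"
  hence "hermitian (g i) (g k) = 0" using False frame_orthogonal[of k i] by simp
  thus ?thesis by (subst hermitian_cnj) simp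
qed (auto intro: frame_orthogonal)

lemma gs_residual_frame: "gs_residual k = of_real (norm (gs_residual k)) *s g k"
  by (cases "gs_residual k = 0") (auto simp: frame_eq)

text \<open>By construction \<open>v k\<close> is a combination of the frame: the norm of the
  residual at \<open>k\<close>, the subtracted products below \<open>k\<close>, zero above.
  Orthogonality identifies these coefficients with Hermitian products, except at vanishing frame
  vectors, where both terms are 0.\<close>

lemma frame_expansion_base:
  assumes "k < m"
  shows "v k = (\<Sum>i<m. hermitian (v k) (g i) *s g i)"
proof -
  define c where "c i = (if i = k then of_real (norm (gs_residual k)) else if i < k then hermitian (v k) (g i) else 0)" for i
  have "v k = gs_residual k + (\<Sum>i<k. hermitian (v k) (g i) *s g i)"
    by (simp add: gs_residual_def)
  also have "gs_residual k = c k *s g k"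
    using gs_residual_frame by (simp add: c_def)
  also have "(\<Sum>i<k. hermitian (v k) (g i) *s g i) = (\<Sum>i<k. c i *s g i)"
    by (intro sum.cong) (auto simp: c_def)
  also have "c k *s g k + \<dots> = (\<Sum>i<Suc k. c i *s g i)" by simp
  also have "\<dots> = (\<Sum>i<m. c i *s g i)"
    using assms by (intro sum.mono_neutral_left) (auto simp: c_def)
  finally have vk: "v k = (\<Sum>i<m. c i *s g i)" .
  have coeff: "hermitian (v k) (g i) *s g i = c i *s g i" if "i < m" for i
  proof -
    have "hermitian (v k) (g i) = (\<Sum>j<m. c j * hermitian (g j) (g i))"
      by (subst vk) (simp add: hermitian_sum_left)
    also have "\<dots> = (\<Sum>j<m. if j = i then c i * hermitian (g i) (g i) else 0)"
      using frame_orthogonal' by (intro sum.cong) auto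
    also have "\<dots> = c i * hermitian (g i) (g i)" using that by simp
    finally show ?thesis using frame_self[of "c i" i] by auto
  qed
  have "(\<Sum>i<m. hermitian (v k) (g i) *s g i) = (\<Sum>i<m. c i *s g i)"
    by (intro sum.cong refl coeff) simp
  thus ?thesis using vk by simp
qed

lemma frame_expansion:
  assumes "z = (\<Sum>k<m. c k *s v k)"
  shows "z = (\<Sum>i<m. hermitian z (g i) *s g i)"
proof -
  have "(\<Sum>i<m. hermitian z (g i) *s g i) = (\<Sum>i<m. (\<Sum>k<m. c k * hermitian (v k) (g i)) *s g i)"
    by (simp add: assms hermitian_sum_left)
  also have "\<dots> = (\<Sum>i<m. \<Sum>k<m. c k *s (hermitian (v k) (g i) *s g i))"
    by (simp add: vec.scale_sum_left)
  also have "\<dots> = (\<Sum>k<m. \<Sum>i<m. c k *s (hermitian (v k) (g i) *s g i))"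
    by (rule sum.swap)
  also have "\<dots> = (\<Sum>k<m. c k *s (\<Sum>i<m. hermitian (v k) (g i) *s g i))"
    by (simp only: vec.scale_sum_right)
  also have "\<dots> = z" unfolding assms
    by (intro sum.cong refl) (simp only: lessThan_iff frame_expansion_base[symmetric])
  finally show ?thesis by simp
qed

end

text \<open>This makes the frame coordinates at conjugate embeddings complex conjugates of each
  other, as the use of \<open>re_im\<close> in the point count requires.\<close>

lemma frame_cnj: "gs_frame (\<lambda>k. cnj_vec (v k)) k = cnj_vec (gs_frame v k)"
proof (induction k rule: less_induct)
  case (less k)
  let ?w = "\<lambda>k. cnj_vec (v k)"
  have "gs_residual ?w k = cnj_vec (v k)
      - (\<Sum>i<k. hermitian (?w k) (gs_frame ?w i) *s gs_frame ?w i)"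
    by (simp add: gs_residual_def)
  also have "(\<Sum>i<k. hermitian (?w k) (gs_frame ?w i) *s gs_frame ?w i)
      = (\<Sum>i<k. cnj_vec (hermitian (v k) (gs_frame v i) *s gs_frame v i))"
    using less by (intro sum.cong) (auto simp: hermitian_cnj_vec cnj_vec_scale)
  also have "cnj_vec (v k) - \<dots> = cnj_vec (gs_residual v k)"
    by (simp add: gs_residual_def cnj_vec_diff cnj_vec_sum)
  finally show ?case by (simp add: frame_eq norm_cnj_vec cnj_vec_scale)
qed

section \<open>Successive minima\<close>

text \<open>Here \<open>a\<close> stands for \<open>u\<close> divided by its nonzero coordinate
  \<open>l\<close>. It is real for real \<open>K\<close>, since \<open>id_e\<close> is then its own
  complex conjugate.\<close>

locale approximation_setup = num_field K for K +
  fixes a :: "'n::finite \<Rightarrow> complex" and l :: 'n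
  assumes a_real: "K \<subseteq> \<real> \<Longrightarrow> a i \<in> \<real>"
begin

definition Lambda :: "(complex ^ 'n) set" where
  "Lambda = {z. \<forall>i. vec_nth z i \<in> OK}"

definition id_e :: "complex \<Rightarrow> complex" where
  "id_e = restrict (\<lambda>x. x) K"

lemma id_e: "id_e \<in> E" and id_e_apply: "x \<in> K \<Longrightarrow> id_e x = x"
  by (auto simp: id_e_def id_emb)

lemma cj_id_e_apply: "x \<in> K \<Longrightarrow> cj id_e x = cnj x"
  by (simp add: cj_apply id_e_apply)

text \<open>It decides whether one or two embeddings carry the weight \<open>W\<close>, and thereby
  explains \<open>ambient_exponent\<close>.\<close>

lemma cj_id_e_iff: "cj id_e = id_e \<longleftrightarrow> K \<subseteq> \<real>"
proof
  assume "cj id_e = id_e"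
  hence "cnj x = x" if "x \<in> K" for x using that cj_id_e_apply id_e_apply by metis
  thus "K \<subseteq> \<real>" by (auto simp: Reals_cnj_iff)
next
  assume R: "K \<subseteq> \<real>"
  show "cj id_e = id_e"
  proof (rule extensionalityI[of _ K])
    fix x assume x: "x \<in> K"
    hence "cnj x = x" using R by (auto simp: Reals_cnj_iff)
    thus "cj id_e x = id_e x" using x by (simp add: cj_id_e_apply id_e_apply)
  qed (auto simp: cj_def id_e_def)
qed

text \<open>Subtracting this multiple of the coordinate \<open>l\<close> from the coordinate
  \<open>i\<close> annihilates the direction of \<open>u\<close> at \<open>id_e\<close>, and that of
  its complex conjugate at \<open>cj id_e\<close>. At the other embeddings nothing is
  subtracted.\<close>

definition shear :: "(complex \<Rightarrow> complex) \<Rightarrow> 'n \<Rightarrow> complex" where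
  "shear \<sigma> i = (if i = l then 0 else if \<sigma> = id_e then a i else if \<sigma> = cj id_e then cnj (a i) else 0)"

definition weight :: "real \<Rightarrow> (complex \<Rightarrow> complex) \<Rightarrow> 'n \<Rightarrow> real" where
  "weight W \<sigma> i = (if i \<noteq> l \<and> (\<sigma> = id_e \<or> \<sigma> = cj id_e) then W else 1)"

lemma cj_eq_iff: "\<sigma> \<in> E \<Longrightarrow> \<tau> \<in> E \<Longrightarrow> cj \<sigma> = \<tau> \<longleftrightarrow> \<sigma> = cj \<tau>"
  using cj_cj by metis

lemma shear_cj:
  assumes "\<sigma> \<in> E"
  shows "shear (cj \<sigma>) i = cnj (shear \<sigma> i)"
proof (cases "K \<subseteq> \<real>")
  case True
  hence "cj id_e = id_e" "cnj (a i) = a i" using cj_id_e_iff a_real[of i] by (auto simp: Reals_cnj_iff)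
  thus ?thesis using cj_eq_iff[OF assms id_e] by (simp add: shear_def)
next
  case False
  hence "cj id_e \<noteq> id_e" using cj_id_e_iff by simp
  thus ?thesis
    using cj_eq_iff[OF assms id_e] cj_eq_iff[OF assms cj_emb[OF id_e]] cj_cj[OF id_e] by (auto simp: shear_def)
qed

lemma weight_cj: "\<sigma> \<in> E \<Longrightarrow> weight W (cj \<sigma>) i = weight W \<sigma> i"
  using cj_eq_iff[of \<sigma> id_e] cj_eq_iff[of \<sigma> "cj id_e"] cj_cj[OF id_e] cj_emb id_e
  by (auto simp: weight_def)

lemma weight_ge_1: "W \<ge> 1 \<Longrightarrow> weight W \<sigma> i \<ge> 1"
  by (simp add: weight_def)

text \<open>Each distinguished embedding contributes \<open>W\<close> once for every coordinate
  other than \<open>l\<close>. The product is the factor by which the maps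
  \<open>phi W \<sigma>\<close> change the volume in total.\<close>

lemma prod_weight: "(\<Prod>\<sigma>\<in>E. \<Prod>i\<in>UNIV. weight W \<sigma> i) = W ^ (ambient_exponent K * (CARD('n) - 1))"
proof -
  let ?S = "{id_e, cj id_e}"
  have S: "?S \<subseteq> E" using id_e cj_emb by auto
  have cS: "card ?S = ambient_exponent K"
    using cj_id_e_iff by (auto simp: ambient_exponent_def card_insert_if)
  have "(\<Prod>i\<in>UNIV. weight W \<sigma> i) = (if \<sigma> \<in> ?S then W ^ (CARD('n) - 1) else 1)" for \<sigma>
  proof (cases "\<sigma> \<in> ?S")
    case True
    have "(\<Prod>i\<in>UNIV. weight W \<sigma> i) = (\<Prod>i\<in>UNIV - {l}. W)"
      using True by (intro prod.mono_neutral_cong_right) (auto simp: weight_def)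
    thus ?thesis using True by (simp add: card_Diff_singleton)
  qed (simp add: weight_def)
  hence "(\<Prod>\<sigma>\<in>E. \<Prod>i\<in>UNIV. weight W \<sigma> i) = (\<Prod>\<sigma>\<in>?S. W ^ (CARD('n) - 1))"
    using S finite_E by (intro prod.mono_neutral_cong_right) auto
  also have "\<dots> = W ^ (ambient_exponent K * (CARD('n) - 1))"
    by (simp only: prod_constant cS power_mult[symmetric] mult.commute)
  finally show ?thesis .
qed

text \<open>The conjugate of \<open>z\<close> under \<open>\<sigma>\<close>, sheared along
  \<open>u\<close> and then magnified in the transversal coordinates. The coordinate
  \<open>l\<close>, which measures the component along \<open>u\<close>, keeps its size.\<close>

definition phi :: "real \<Rightarrow> (complex \<Rightarrow> complex) \<Rightarrow> complex ^ 'n \<Rightarrow> complex ^ 'n" where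
  "phi W \<sigma> z = (\<chi> i. of_real (weight W \<sigma> i) * (\<sigma> (vec_nth z i) - shear \<sigma> i * \<sigma> (vec_nth z l)))"

lemma phi_sum:
  assumes "\<sigma> \<in> E" and "\<And>k. k \<in> I \<Longrightarrow> c k \<in> K" and "\<And>k i. k \<in> I \<Longrightarrow> vec_nth (x k) i \<in> K"
  shows "phi W \<sigma> (\<Sum>k\<in>I. c k *s x k) = (\<Sum>k\<in>I. \<sigma> (c k) *s phi W \<sigma> (x k))"
  using assms
  by (simp add: phi_def cart_eq_iff emb_sum emb_mult mult_K
      sum_distrib_left sum_subtractf[symmetric] algebra_simps)

lemma phi_diff:
  assumes "\<sigma> \<in> E" and "\<And>i. vec_nth x i \<in> K" and "\<And>i. vec_nth y i \<in> K"
  shows "phi W \<sigma> (x - y) = phi W \<sigma> x - phi W \<sigma> y"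
  using assms by (simp add: phi_def cart_eq_iff emb_diff algebra_simps)

lemma phi_cj:
  assumes "\<sigma> \<in> E" and "\<And>i. vec_nth x i \<in> K"
  shows "phi W (cj \<sigma>) x = cnj_vec (phi W \<sigma> x)"
  using assms by (simp add: phi_def cnj_vec_def cart_eq_iff cj_apply shear_cj weight_cj)

text \<open>It bounds the shear and its inverse alike, as both only add a multiple of the coordinate
  \<open>l\<close>.\<close>

definition shear_bound :: real where
  "shear_bound = 1 + (\<Sum>i\<in>UNIV. norm (a i))"

lemma shear_bound_ge_1: "shear_bound \<ge> 1"
  by (auto simp: shear_bound_def intro: sum_nonneg)

lemma norm_shear_le: "1 + norm (shear \<sigma> i) \<le> shear_bound"
proof -
  have "norm (a i) \<le> (\<Sum>i\<in>UNIV. norm (a i))" by (rule member_le_sum) auto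
  moreover have "norm (shear \<sigma> i) \<le> norm (a i)" by (simp add: shear_def)
  ultimately show ?thesis by (simp add: shear_bound_def)
qed

lemma norm_phi_component_le:
  assumes "W \<ge> 1" and "\<And>i. norm (\<sigma> (vec_nth z i)) \<le> B"
  shows "norm (vec_nth (phi W \<sigma> z) i) \<le> weight W \<sigma> i * (shear_bound * B)"
proof -
  have B: "B \<ge> 0" using assms(2)[of l] norm_ge_zero order.trans by blast
  have w: "weight W \<sigma> i \<ge> 1" using weight_ge_1[OF assms(1)] .
  have "norm (\<sigma> (vec_nth z i) - shear \<sigma> i * \<sigma> (vec_nth z l)) \<le> B + norm (shear \<sigma> i) * B"
    using assms(2)[of i] assms(2)[of l]
    by (intro order.trans[OF norm_triangle_ineq4] add_mono) (auto simp: norm_mult intro: mult_left_mono)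
  also have "\<dots> = (1 + norm (shear \<sigma> i)) * B" by (simp add: algebra_simps)
  also have "\<dots> \<le> shear_bound * B" using norm_shear_le B by (intro mult_right_mono)
  finally have "weight W \<sigma> i * norm (\<sigma> (vec_nth z i) - shear \<sigma> i * \<sigma> (vec_nth z l)) \<le> weight W \<sigma> i * (shear_bound * B)"
    using w by (intro mult_left_mono) auto
  thus ?thesis using w by (simp add: phi_def norm_mult)
qed

lemma norm_component_le:
  assumes "W \<ge> 1"
  shows "norm (\<sigma> (vec_nth z i)) \<le> shear_bound * norm (phi W \<sigma> z)"
proof -
  let ?P = "norm (phi W \<sigma> z)"
  have comp: "norm (vec_nth (phi W \<sigma> z) i) \<le> ?P" for i by (rule Finite_Cartesian_Product.norm_nth_le)
  have w: "weight W \<sigma> i \<ge> 1" for i using weight_ge_1[OF assms] .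
  have zl: "norm (\<sigma> (vec_nth z l)) \<le> ?P"
    using comp[of l] by (simp add: phi_def shear_def weight_def)
  have "norm (\<sigma> (vec_nth z i) - shear \<sigma> i * \<sigma> (vec_nth z l)) * 1
      \<le> norm (\<sigma> (vec_nth z i) - shear \<sigma> i * \<sigma> (vec_nth z l)) * weight W \<sigma> i"
    using w[of i] by (intro mult_left_mono) auto
  also have "\<dots> = norm (vec_nth (phi W \<sigma> z) i)"
    using w[of i] by (simp add: phi_def norm_mult)
  also have "\<dots> \<le> ?P" by (rule comp)
  finally have "norm (\<sigma> (vec_nth z i)) \<le> ?P + norm (shear \<sigma> i * \<sigma> (vec_nth z l))"
    using norm_triangle_ineq2[of "\<sigma> (vec_nth z i)" "shear \<sigma> i * \<sigma> (vec_nth z l)"] by simp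
  also have "\<dots> \<le> ?P + norm (shear \<sigma> i) * ?P"
    using zl by (simp add: norm_mult mult_left_mono)
  also have "\<dots> = (1 + norm (shear \<sigma> i)) * ?P" by (simp add: algebra_simps)
  also have "\<dots> \<le> shear_bound * ?P" using norm_shear_le by (intro mult_right_mono) auto
  finally show ?thesis .
qed

definition F :: "real \<Rightarrow> complex ^ 'n \<Rightarrow> real" where
  "F W z = Max ((\<lambda>\<sigma>. norm (phi W \<sigma> z)) ` E)"

lemma norm_phi_le_F: "\<sigma> \<in> E \<Longrightarrow> norm (phi W \<sigma> z) \<le> F W z"
  unfolding F_def using finite_E by (intro Max_ge) auto

lemma F_le_iff: "F W z \<le> T \<longleftrightarrow> (\<forall>\<sigma>\<in>E. norm (phi W \<sigma> z) \<le> T)"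
  unfolding F_def using finite_E id_e by (subst Max_le_iff) auto

lemma F_less_iff: "F W z < T \<longleftrightarrow> (\<forall>\<sigma>\<in>E. norm (phi W \<sigma> z) < T)"
  unfolding F_def using finite_E id_e by (subst Max_less_iff) auto

lemma Lambda_K: "z \<in> Lambda \<Longrightarrow> vec_nth z i \<in> K"
  by (auto simp: Lambda_def intro: OK_K)

lemma Lambda_diff: "x \<in> Lambda \<Longrightarrow> y \<in> Lambda \<Longrightarrow> x - y \<in> Lambda"
  by (simp add: Lambda_def OK_diff)

lemma F_pos:
  assumes "W \<ge> 1" and "z \<in> Lambda" and "z \<noteq> 0"
  shows "F W z > 0"
proof -
  obtain i where i: "vec_nth z i \<noteq> 0" using assms(3) by (auto simp: cart_eq_iff)
  have "norm (vec_nth z i) \<le> shear_bound * norm (phi W id_e z)"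
    using norm_component_le[OF assms(1), of id_e z i] Lambda_K[OF assms(2)] by (simp add: id_e_apply)
  moreover have "0 < norm (vec_nth z i)" using i by simp
  ultimately have "0 < shear_bound * norm (phi W id_e z)" by linarith
  hence "0 < norm (phi W id_e z)" using shear_bound_ge_1 by (simp add: zero_less_mult_iff)
  thus ?thesis using norm_phi_le_F[OF id_e, of W z] by linarith
qed

lemma finite_F_ball:
  assumes "W \<ge> 1"
  shows "finite {z \<in> Lambda. F W z \<le> T}"
proof -
  let ?S = "{x \<in> OK. \<forall>\<sigma>\<in>E. norm (\<sigma> x) \<le> shear_bound * T}"
  have "{z \<in> Lambda. F W z \<le> T} \<subseteq> (\<lambda>f. \<chi> i. f i) ` (PiE UNIV (\<lambda>_. ?S))"
  proof
    fix z assume z: "z \<in> {z \<in> Lambda. F W z \<le> T}"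
    have "vec_nth z i \<in> ?S" for i
    proof -
      have "norm (\<sigma> (vec_nth z i)) \<le> shear_bound * T" if "\<sigma> \<in> E" for \<sigma>
      proof -
        have "norm (phi W \<sigma> z) \<le> T" using z that by (simp add: F_le_iff)
        hence "shear_bound * norm (phi W \<sigma> z) \<le> shear_bound * T"
          using shear_bound_ge_1 by (intro mult_left_mono) auto
        thus ?thesis using norm_component_le[OF assms, of \<sigma> z i] by linarith
      qed
      thus ?thesis using z by (simp add: Lambda_def)
    qed
    hence "vec_nth z \<in> PiE UNIV (\<lambda>_. ?S)" by auto
    thus "z \<in> (\<lambda>f. \<chi> i. f i) ` (PiE UNIV (\<lambda>_. ?S))"
      by (intro image_eqI[of _ _ "vec_nth z"]) (auto simp: vec_lambda_eta)
  qed
  moreover have "finite (PiE (UNIV :: 'n set) (\<lambda>_. ?S))"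
    by (intro finite_PiE finite_integers_bounded) auto
  ultimately show ?thesis by (rule finite_surj[rotated])
qed

text \<open>A greedy choice: \<open>F W (xs ! i)\<close> is the successive minimum with index
  \<open>i\<close>, counted from 0. Spans are complex, which for vectors over \<open>K\<close> gives
  the same notion of independence as spans over \<open>K\<close>.\<close>

definition minimal_system :: "real \<Rightarrow> (complex ^ 'n) list \<Rightarrow> bool" where
  "minimal_system W xs \<longleftrightarrow> set xs \<subseteq> Lambda \<and> distinct xs \<and> vec.independent (set xs) \<and>
     (\<forall>i<length xs. xs ! i \<notin> vec.span (set (take i xs)) \<and>
        (\<forall>z\<in>Lambda. z \<notin> vec.span (set (take i xs)) \<longrightarrow> F W (xs ! i) \<le> F W z))"

lemma axis_Lambda: "axis i 1 \<in> Lambda"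
  by (simp add: Lambda_def axis_def OK_0 OK_1)

lemma span_all_axes: "(\<And>i. axis i 1 \<in> vec.span B) \<Longrightarrow> vec.span B = (UNIV :: (complex ^ 'n) set)"
proof -
  assume ax: "\<And>i. axis i 1 \<in> vec.span B"
  have "z \<in> vec.span B" for z
  proof -
    have "z = (\<Sum>i\<in>UNIV. vec_nth z i *s axis i 1)"
      by (simp add: cart_eq_iff axis_def if_distrib cong: if_cong)
    also have "\<dots> \<in> vec.span B" by (intro vec.span_sum vec.span_scale ax)
    finally show ?thesis .
  qed
  thus ?thesis by blast
qed

text \<open>While the chosen points do not span, some axis vector lies outside their span. Its value
  of \<open>F W\<close> confines the search for the next point to a finite ball.\<close>

lemma minimal_system_exists:
  assumes W: "W \<ge> 1" and "k \<le> CARD('n)"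
  shows "\<exists>xs. length xs = k \<and> minimal_system W xs"
  using assms(2)
proof (induction k)
  case 0
  have "minimal_system W []" by (simp add: minimal_system_def vec.independent_empty)
  thus ?case by (intro exI[of _ "[]"]) simp
next
  case (Suc k)
  then obtain xs where xs: "length xs = k" "minimal_system W xs" by auto
  let ?V = "vec.span (set xs)"
  have "?V \<noteq> UNIV"
  proof
    assume "?V = UNIV"
    hence "vec.dim (UNIV :: (complex ^ 'n) set) \<le> card (set xs)"
      by (metis List.finite_set vec.dim_le_card vec.span_superset subset_UNIV)
    hence "CARD('n) \<le> card (set xs)" by (simp only: vec_dim_card)
    thus False using Suc.prems xs(1) card_length[of xs] by simp
  qed
  then obtain i0 where i0: "axis i0 1 \<notin> ?V" using span_all_axes by blast
  let ?A = "{z \<in> Lambda. F W z \<le> F W (axis i0 1)} - ?V"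
  have "finite ?A" "?A \<noteq> {}" using finite_F_ball[OF W] i0 axis_Lambda by auto
  then obtain x where x: "x \<in> ?A" "\<And>z. z \<in> ?A \<Longrightarrow> F W x \<le> F W z"
    using ex_min_if_finite[of "F W ` ?A"] by (metis (no_types, lifting) arg_min_least arg_min_if_finite(1))
  have least: "F W x \<le> F W z" if "z \<in> Lambda" "z \<notin> ?V" for z
    using x that by (cases "F W z \<le> F W (axis i0 1)") auto
  have new: "x \<in> Lambda" "x \<notin> ?V" using x(1) by auto
  have "x \<notin> set xs" using new vec.span_base by blast
  have "minimal_system W (xs @ [x])"
    unfolding minimal_system_def
  proof (intro conjI allI impI ballI)
    show "set (xs @ [x]) \<subseteq> Lambda" "distinct (xs @ [x])"
      using xs(2) new \<open>x \<notin> set xs\<close> by (auto simp: minimal_system_def)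
    show "vec.independent (set (xs @ [x]))"
      using xs(2) new \<open>x \<notin> set xs\<close> by (simp add: minimal_system_def vec.independent_insert)
    fix i assume i: "i < length (xs @ [x])"
    show "(xs @ [x]) ! i \<notin> vec.span (set (take i (xs @ [x])))"
      using xs new i by (cases "i = k") (auto simp: minimal_system_def nth_append)
    fix z assume "z \<in> Lambda" "z \<notin> vec.span (set (take i (xs @ [x])))"
    thus "F W ((xs @ [x]) ! i) \<le> F W z"
      using xs least i by (cases "i = k") (auto simp: minimal_system_def nth_append)
  qed
  thus ?case using xs(1) by (intro exI[of _ "xs @ [x]"]) simp
qed

end

section \<open>Lattice point counts in terms of the successive minima\<close>

context approximation_setup
begin

lemma minimal_systemD:
  assumes "minimal_system W xs"
  shows "set xs \<subseteq> Lambda" and "distinct xs" and "vec.independent (set xs)"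
    and "i < length xs \<Longrightarrow> xs ! i \<notin> vec.span (set (take i xs))"
    and "i < length xs \<Longrightarrow> z \<in> Lambda \<Longrightarrow> z \<notin> vec.span (set (take i xs)) \<Longrightarrow> F W (xs ! i) \<le> F W z"
  using assms by (auto simp: minimal_system_def)

lemma minimal_system_mono:
  assumes xs: "minimal_system W xs" and "i \<le> k" and "k < length xs"
  shows "F W (xs ! i) \<le> F W (xs ! k)"
proof (rule minimal_systemD(5)[OF xs])
  show "i < length xs" using assms by simp
  show "xs ! k \<in> Lambda" using minimal_systemD(1)[OF xs] assms(3) by auto
  have "vec.span (set (take i xs)) \<subseteq> vec.span (set (take k xs))"
    by (intro vec.span_mono set_take_subset_set_take assms(2))
  thus "xs ! k \<notin> vec.span (set (take i xs))" using minimal_systemD(4)[OF xs assms(3)] by blast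
qed

lemma minimal_system_pos:
  assumes "W \<ge> 1" and xs: "minimal_system W xs" and "i < length xs"
  shows "F W (xs ! i) > 0"
proof (rule F_pos[OF assms(1)])
  show "xs ! i \<in> Lambda" using minimal_systemD(1)[OF xs] assms(3) by auto
  show "xs ! i \<noteq> 0" using minimal_systemD(4)[OF xs assms(3)] vec.span_zero by metis
qed

text \<open>\<open>k + 1\<close> is the least number of initial points whose span contains
  \<open>D\<close>. So \<open>D\<close> competed with \<open>xs ! k\<close> for the position
  \<open>k\<close>.\<close>

lemma minimal_system_level:
  assumes xs: "minimal_system W xs" "length xs = CARD('n)" and D: "D \<in> Lambda" "D \<noteq> 0"
  obtains k where "k < CARD('n)" and "D \<in> vec.span (set (take (Suc k) xs))" and "F W (xs ! k) \<le> F W D"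
proof -
  have "UNIV \<subseteq> vec.span (set xs)"
  proof (rule vec.card_ge_dim_independent)
    show "vec.independent (set xs)" by (rule minimal_systemD(3)[OF xs(1)])
    have "card (set xs) = CARD('n)" using minimal_systemD(2)[OF xs(1)] xs(2) by (simp add: distinct_card)
    thus "vec.dim (UNIV :: (complex ^ 'n) set) \<le> card (set xs)" by (simp only: vec_dim_card)
  qed auto
  hence full: "D \<in> vec.span (set (take CARD('n) xs))" using xs(2) by auto
  let ?P = "\<lambda>j. D \<in> vec.span (set (take j xs))"
  define j where "j = (LEAST j. ?P j)"
  have j: "?P j" unfolding j_def by (rule LeastI[of ?P, OF full])
  have jm: "j \<le> CARD('n)" unfolding j_def by (rule Least_le[of ?P, OF full])
  have "j \<noteq> 0"
  proof
    assume "j = 0"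
    thus False using j D(2) by simp
  qed
  then obtain k where k: "j = Suc k" using not0_implies_Suc by blast
  have "\<not> ?P k" using not_less_Least[of k ?P] k by (simp add: j_def)
  hence "F W (xs ! k) \<le> F W D"
    using minimal_systemD(5)[OF xs(1), of k D] D(1) jm k xs(2) by simp
  thus ?thesis using that[of k] j jm k by simp
qed

text \<open>\<open>phi W \<sigma>\<close> respects combinations with coefficients in
  \<open>K\<close>, and those of \<open>D\<close> lie there by \<open>coefficients_in_K\<close>.
  Hence at every embedding \<open>phi W \<sigma> D\<close> stays in the span of the images of the
  first \<open>k + 1\<close> points, which a frame adapted to the flag of the minima can
  detect.\<close>

lemma phi_frame_expansion:
  assumes xs: "minimal_system W xs" and k: "k < length xs" and D: "D \<in> Lambda"
    and span: "D \<in> vec.span (set (take (Suc k) xs))" and \<sigma>: "\<sigma> \<in> E"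
  shows "phi W \<sigma> D = (\<Sum>i<Suc k. hermitian (phi W \<sigma> D) (gs_frame (\<lambda>i. phi W \<sigma> (xs ! i)) i)
    *s gs_frame (\<lambda>i. phi W \<sigma> (xs ! i)) i)"
proof -
  let ?ys = "take (Suc k) xs"
  have ys: "distinct ?ys" "vec.independent (set ?ys)" "length ?ys = Suc k"
    using minimal_systemD(2,3)[OF xs] k vec.independent_mono[OF _ set_take_subset] by auto
  obtain c where "D = (\<Sum>i<length ?ys. c i *s ?ys ! i)"
    by (rule span_list_coefficients[OF ys(1) span])
  hence c: "D = (\<Sum>i<Suc k. c i *s xs ! i)" using ys(3) by simp
  have xK: "vec_nth (xs ! i) l' \<in> K" if "i < Suc k" for i l'
  proof -
    have "xs ! i \<in> Lambda" using minimal_systemD(1)[OF xs] that k by auto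
    thus ?thesis by (rule Lambda_K)
  qed
  have ind: "lin_indep_family {..<Suc k} (\<lambda>i. ?ys ! i)"
    using lin_indep_family_list[OF ys(1,2)] ys(3) by simp
  have "c i \<in> K" if "i < Suc k" for i
  proof (rule coefficients_in_K[OF _ ind])
    show "vec_nth (?ys ! i') l' \<in> K" if "i' \<in> {..<Suc k}" for i' l' using that xK by simp
    show "vec_nth (\<Sum>i<Suc k. c i *s ?ys ! i) l' \<in> K" for l'
      using Lambda_K[OF D] c by simp
  qed (use that in auto)
  hence "phi W \<sigma> D = (\<Sum>i<Suc k. \<sigma> (c i) *s phi W \<sigma> (xs ! i))"
    unfolding c using xK by (intro phi_sum[OF \<sigma>]) auto
  thus ?thesis by (rule frame_expansion)
qed

text \<open>The coordinate of \<open>z\<close> at \<open>\<sigma>\<close> and \<open>i\<close> is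
  taken along the frame vector \<open>i\<close> and cut into cells of side
  \<open>L_i / (4 m)\<close>, where \<open>L_i = F W (xs ! i)\<close> and
  \<open>m = CARD('n)\<close>. If two points share a cell, their difference \<open>D\<close> has
  some level \<open>k\<close> and only \<open>k + 1\<close> frame coordinates, each at most
  \<open>L_k / (2 m)\<close>. So \<open>F W D\<close> is below \<open>L_k\<close>, contrary to the
  minimality of \<open>xs ! k\<close>.\<close>

lemma card_F_ball_le:
  fixes W T :: real
  assumes W: "W \<ge> 1" and xs: "minimal_system W xs" "length xs = CARD('n)"
    and T: "\<And>i. i < CARD('n) \<Longrightarrow> F W (xs ! i) \<le> T"
  shows "real (card {z \<in> Lambda. F W z \<le> T}) * (\<Prod>i<CARD('n). F W (xs ! i)) ^ deg
    \<le> (18 * real CARD('n) * T) ^ (CARD('n) * deg)"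
proof -
  let ?A = "{z \<in> Lambda. F W z \<le> T}" and ?I = "E \<times> {..<CARD('n)}"
  let ?m = "real CARD('n)"
  define G where "G \<sigma> = gs_frame (\<lambda>i. phi W \<sigma> (xs ! i))" for \<sigma>
  define f where "f z = (\<lambda>(\<sigma>, i). re_im (hermitian (phi W \<sigma> z) (G \<sigma> i)))" for z
  define s where "s = (\<lambda>(\<sigma> :: complex \<Rightarrow> complex, i). F W (xs ! i) / (4 * ?m))"
  have Lpos: "F W (xs ! i) > 0" if "i < CARD('n)" for i
    using minimal_system_pos[OF W xs(1)] that xs(2) by simp
  have m1: "?m \<ge> 1" by (simp add: Suc_leI)
  have T0: "T > 0" using T[of 0] Lpos[of 0] by simp
  have xsL: "xs ! i \<in> Lambda" if "i < CARD('n)" for i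
    using minimal_systemD(1)[OF xs(1)] that xs(2) by auto
  have Gcj: "G (cj \<sigma>) i = cnj_vec (G \<sigma> i)" if "\<sigma> \<in> E" "i < CARD('n)" for \<sigma> i
  proof -
    \<comment> \<open>Only input up to the index \<open>i\<close> enters the recursion, so agreement
      below \<open>CARD('n)\<close> suffices. Beyond the end of the list \<open>xs ! i\<close> is
      unspecified, and \<open>phi_cj\<close> would not apply to it.\<close>
    have eq: "gs_frame v i = gs_frame v' i"
      if "\<And>k. k < CARD('n) \<Longrightarrow> v k = v' k" "i < CARD('n)" for v v' :: "nat \<Rightarrow> complex ^ 'n" and i
      using that(2)
    proof (induction i rule: less_induct)
      case (less i)
      have "(\<Sum>k<i. hermitian (v i) (gs_frame v k) *s gs_frame v k)
          = (\<Sum>k<i. hermitian (v' i) (gs_frame v' k) *s gs_frame v' k)"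
        using less that(1)[OF less.prems] by (intro sum.cong) auto
      hence "gs_residual v i = gs_residual v' i"
        by (simp add: gs_residual_def that(1)[OF less.prems])
      thus ?case by (simp add: frame_eq)
    qed
    have "G (cj \<sigma>) i = gs_frame (\<lambda>i. cnj_vec (phi W \<sigma> (xs ! i))) i"
      unfolding G_def by (rule eq[OF _ that(2)]) (simp add: phi_cj[OF that(1)] Lambda_K xsL)
    thus ?thesis by (simp add: G_def frame_cnj)
  qed
  have fcj: "f z (cj \<sigma>, i) = re_im (cnj (hermitian (phi W \<sigma> z) (G \<sigma> i)))" if "z \<in> Lambda" "\<sigma> \<in> E" "i < CARD('n)" for z \<sigma> i
    using that by (simp add: f_def Gcj phi_cj Lambda_K hermitian_cnj_vec)
  have bound: "\<bar>f z p\<bar> \<le> 2 * T" if z: "z \<in> ?A" and p: "p \<in> ?I" for z p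
  proof -
    obtain \<sigma> i where p': "p = (\<sigma>, i)" "\<sigma> \<in> E" using p by auto
    have "norm (hermitian (phi W \<sigma> z) (G \<sigma> i)) \<le> norm (phi W \<sigma> z) * norm (G \<sigma> i)"
      by (rule norm_hermitian_le)
    also have "\<dots> \<le> norm (phi W \<sigma> z) * 1"
      unfolding G_def by (intro mult_left_mono norm_frame_le) auto
    also have "\<dots> \<le> T" using z p' by (simp add: F_le_iff)
    finally show ?thesis
      using abs_re_im_le[of "hermitian (phi W \<sigma> z) (G \<sigma> i)"] by (simp add: f_def p')
  qed
  have spos: "s p > 0" if "p \<in> ?I" for p
    using that Lpos m1 by (auto simp: s_def)
  have sep: "z = w" if zw: "z \<in> ?A" "w \<in> ?A" and close: "\<And>p. p \<in> ?I \<Longrightarrow> \<bar>f z p - f w p\<bar> < s p" for z w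
  proof (rule ccontr)
    assume "z \<noteq> w"
    define D where "D = z - w"
    have DL: "D \<in> Lambda" and D0: "D \<noteq> 0" using zw \<open>z \<noteq> w\<close> by (auto simp: D_def Lambda_diff)
    have small: "norm (hermitian (phi W \<sigma> D) (G \<sigma> i)) \<le> F W (xs ! i) / (2 * ?m)"
      if \<sigma>: "\<sigma> \<in> E" and i: "i < CARD('n)" for \<sigma> i
    proof -
      have "phi W \<sigma> D = phi W \<sigma> z - phi W \<sigma> w"
        unfolding D_def using zw by (intro phi_diff[OF \<sigma>] Lambda_K) auto
      hence h: "hermitian (phi W \<sigma> D) (G \<sigma> i) = hermitian (phi W \<sigma> z) (G \<sigma> i) - hermitian (phi W \<sigma> w) (G \<sigma> i)"
        by (simp add: hermitian_diff_left)
      have "norm (hermitian (phi W \<sigma> D) (G \<sigma> i))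
          \<le> \<bar>f z (\<sigma>, i) - f w (\<sigma>, i)\<bar> + \<bar>f z (cj \<sigma>, i) - f w (cj \<sigma>, i)\<bar>"
        using norm_le_re_im[of "hermitian (phi W \<sigma> D) (G \<sigma> i)"] zw \<sigma> i
        unfolding h by (simp add: fcj re_im_diff) (simp add: f_def)
      also have "\<dots> \<le> s (\<sigma>, i) + s (cj \<sigma>, i)"
        using close[of "(\<sigma>, i)"] close[of "(cj \<sigma>, i)"] \<sigma> i cj_emb by (intro add_mono) auto
      finally show ?thesis by (simp add: s_def)
    qed
    obtain k where k: "k < CARD('n)" "D \<in> vec.span (set (take (Suc k) xs))" "F W (xs ! k) \<le> F W D"
      by (rule minimal_system_level[OF xs DL D0])
    have "norm (phi W \<sigma> D) < F W (xs ! k)" if \<sigma>: "\<sigma> \<in> E" for \<sigma>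
    proof -
      have "phi W \<sigma> D = (\<Sum>i<Suc k. hermitian (phi W \<sigma> D) (G \<sigma> i) *s G \<sigma> i)"
        unfolding G_def using k(1) xs(2) by (intro phi_frame_expansion[OF xs(1) _ DL k(2) \<sigma>]) simp
      hence "norm (phi W \<sigma> D) \<le> (\<Sum>i<Suc k. norm (hermitian (phi W \<sigma> D) (G \<sigma> i) *s G \<sigma> i))"
        by (metis norm_sum)
      also have "\<dots> \<le> (\<Sum>i<Suc k. F W (xs ! k) / (2 * ?m))"
      proof (rule sum_mono)
        fix i assume i: "i \<in> {..<Suc k}"
        have "norm (hermitian (phi W \<sigma> D) (G \<sigma> i) *s G \<sigma> i) \<le> norm (hermitian (phi W \<sigma> D) (G \<sigma> i)) * 1"
          unfolding norm_scale_complex G_def by (intro mult_left_mono norm_frame_le) auto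
        also have "\<dots> \<le> F W (xs ! i) / (2 * ?m)" using small[OF \<sigma>, of i] i k(1) by simp
        also have "\<dots> \<le> F W (xs ! k) / (2 * ?m)"
          using minimal_system_mono[OF xs(1), of i k] i k(1) xs(2) m1 by (intro divide_right_mono) auto
        finally show "norm (hermitian (phi W \<sigma> D) (G \<sigma> i) *s G \<sigma> i) \<le> F W (xs ! k) / (2 * ?m)" .
      qed
      also have "\<dots> = real (Suc k) * (F W (xs ! k) / (2 * ?m))" by simp
      also have "\<dots> \<le> ?m * (F W (xs ! k) / (2 * ?m))"
        using k(1) Lpos[OF k(1)] m1 by (intro mult_right_mono) auto
      also have "\<dots> = F W (xs ! k) / 2" using m1 by simp
      also have "\<dots> < F W (xs ! k)" using Lpos[OF k(1)] by simp
      finally show ?thesis .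
    qed
    hence "F W D < F W (xs ! k)" by (simp add: F_less_iff)
    thus False using k(3) by simp
  qed
  have "real (card ?A) \<le> (\<Prod>p\<in>?I. 2 * (2 * T) / s p + 2)"
    by (rule card_le_boxes(2)[where f = f and R = "\<lambda>_. 2 * T" and s = s])
      (use finite_E T0 in \<open>auto simp only: finite_cartesian_product finite_lessThan intro!: bound spos sep\<close>)
  also have "\<dots> \<le> (\<Prod>p\<in>?I. 18 * ?m * T / F W (xs ! snd p))"
  proof (intro prod_mono conjI)
    fix p assume p: "p \<in> ?I"
    then obtain \<sigma> i where pi: "p = (\<sigma>, i)" "i < CARD('n)" by auto
    let ?L = "F W (xs ! i)"
    have "2 * (2 * T) / s p = 16 * ?m * T / ?L" using m1 by (simp add: pi s_def)
    \<comment> \<open>The radius is not below any minimum, which absorbs the summand 2 of the cell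
      count: \<open>16 + 2 = 18\<close>.\<close>
    moreover have "1 \<le> T / ?L" using T[OF pi(2)] Lpos[OF pi(2)] by simp
    hence "1 * 1 \<le> ?m * (T / ?L)" using m1 by (intro mult_mono) auto
    moreover have "18 * ?m * T / ?L = 16 * ?m * T / ?L + 2 * (?m * (T / ?L))"
      by (simp add: divide_inverse algebra_simps)
    ultimately have "2 * (2 * T) / s p + 2 \<le> 18 * ?m * T / ?L" by linarith
    thus "2 * (2 * T) / s p + 2 \<le> 18 * ?m * T / F W (xs ! snd p)" by (simp add: pi)
    show "0 \<le> 2 * (2 * T) / s p + 2" using spos[OF p] T0 by simp
  qed
  also have "\<dots> = (\<Prod>\<sigma>\<in>E. \<Prod>i<CARD('n). 18 * ?m * T / F W (xs ! i))"
    by (simp only: prod.cartesian_product case_prod_unfold)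
  also have "\<dots> = (18 * ?m * T) ^ (CARD('n) * deg) / (\<Prod>i<CARD('n). F W (xs ! i)) ^ deg"
    by (simp add: prod_dividef card_E power_divide power_mult)
  finally have "real (card ?A) \<le> (18 * ?m * T) ^ (CARD('n) * deg) / (\<Prod>i<CARD('n). F W (xs ! i)) ^ deg" .
  moreover have "(\<Prod>i<CARD('n). F W (xs ! i)) ^ deg > 0"
    using Lpos by (intro zero_less_power prod_pos) auto
  ultimately show ?thesis by (simp add: pos_le_divide_eq)
qed

text \<open>The \<open>M ^ ?N\<close> points with power basis coefficients below \<open>M\<close>
  are mapped into a box with sides proportional to \<open>weight W \<sigma> i * M\<close>.
  Differences within a fullest cell of side \<open>T\<close> belong to the ball: a factor 2 is lost
  from \<open>re_im\<close> to the modulus, and \<open>CARD('n)\<close> from the coordinates to the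
  norm. The power of \<open>M\<close> cancels.\<close>

lemma card_F_ball_ge:
  fixes W T :: real
  assumes W: "W \<ge> 1" and T: "T > 0"
  shows "T ^ (CARD('n) * deg) \<le> real (card {z \<in> Lambda. F W z \<le> 2 * real CARD('n) * T})
    * (4 * shear_bound * theta_bound + 2) ^ (CARD('n) * deg) * W ^ (ambient_exponent K * (CARD('n) - 1))"
proof -
  let ?N = "CARD('n) * deg" and ?I = "E \<times> (UNIV :: 'n set)"
  \<comment> \<open>Rounding up gives \<open>1 \<le> M / T\<close>, which absorbs the summand 2 of
    the cell count.\<close>
  define M where "M = nat \<lceil>T\<rceil>"
  have M: "T \<le> real M" unfolding M_def by (rule real_nat_ceiling_ge)
  have M0: "M > 0" using M T by (cases M) auto
  let ?Z = "PiE (UNIV \<times> {..<deg}) (\<lambda>_. {..<M}) :: ('n \<times> nat \<Rightarrow> nat) set"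
  define vec where "vec h = (\<chi> i. \<Sum>k<deg. of_rat (of_nat (h (i, k))) * theta ^ k)" for h :: "'n \<times> nat \<Rightarrow> nat"
  have vecL: "vec h \<in> Lambda" for h
    unfolding vec_def Lambda_def of_rat_of_nat_eq by (auto intro!: OK_sum OK_mult OK_of_nat OK_power theta(1))
  have inj: "inj_on vec ?Z"
  proof (rule inj_onI)
    fix h h' assume hh: "h \<in> ?Z" "h' \<in> ?Z" "vec h = vec h'"
    have "h (i, k) = h' (i, k)" if k: "k < deg" for i k
    proof -
      have "vec_nth (vec h) i - vec_nth (vec h') i = 0" using hh(3) by simp
      hence "(\<Sum>k<deg. of_rat (of_nat (h (i, k)) - of_nat (h' (i, k))) * theta ^ k) = 0"
        by (simp add: vec_def sum_subtractf[symmetric] of_rat_diff left_diff_distrib)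
      hence "(of_nat (h (i, k)) - of_nat (h' (i, k)) :: rat) = 0"
        by (rule power_basis_independent[OF _ k])
      thus ?thesis by simp
    qed
    thus "h = h'" using hh by (intro PiE_ext[OF hh(1,2)]) auto
  qed
  let ?A = "vec ` ?Z"
  have cA: "card ?A = M ^ ?N"
    by (simp add: card_image[OF inj] card_PiE card_cartesian_product)
  have finA: "finite ?A" by (intro finite_imageI finite_PiE) auto
  have neA: "?A \<noteq> {}" using cA M0 finA by (metis card.empty power_not_zero less_numeral_extra(3))
  define f where "f z = (\<lambda>(\<sigma>, i). re_im (vec_nth (phi W \<sigma> z) i))" for z
  define R where "R = (\<lambda>(\<sigma>, i). 2 * (weight W \<sigma> i * (shear_bound * (real M * theta_bound))))"
  have bound: "\<bar>f z p\<bar> \<le> R p" if z: "z \<in> ?A" and p: "p \<in> ?I" for z p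
  proof -
    obtain h where h: "h \<in> ?Z" "z = vec h" using z by blast
    obtain \<sigma> i where pi: "p = (\<sigma>, i)" "\<sigma> \<in> E" using p by auto
    have "norm (\<sigma> (vec_nth z i')) \<le> real M * theta_bound" for i'
    proof -
      have "norm (\<sigma> (\<Sum>k<deg. of_rat (of_nat (h (i', k))) * theta ^ k)) \<le> of_rat (of_nat M) * theta_bound"
      proof (rule norm_emb_combination_le[OF pi(2)])
        fix k assume "k < deg"
        hence "h (i', k) < M" using h(1) by (auto simp: PiE_iff)
        thus "\<bar>of_nat (h (i', k))\<bar> \<le> (of_nat M :: rat)" by simp
      qed simp
      thus ?thesis by (simp add: h(2) vec_def)
    qed
    hence "norm (vec_nth (phi W \<sigma> z) i) \<le> weight W \<sigma> i * (shear_bound * (real M * theta_bound))"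
      by (rule norm_phi_component_le[OF W])
    thus ?thesis using abs_re_im_le[of "vec_nth (phi W \<sigma> z) i"] by (simp add: f_def R_def pi)
  qed
  have R0: "R p \<ge> 0" if "p \<in> ?I" for p
    using weight_ge_1[OF W, of "fst p" "snd p"] shear_bound_ge_1 theta_bound_ge_1
    by (auto simp: R_def case_prod_unfold intro!: mult_nonneg_nonneg)
  obtain B where B: "B \<subseteq> ?A" "B \<noteq> {}" "real (card ?A) \<le> real (card B) * (\<Prod>p\<in>?I. 2 * R p / T + 2)"
    "\<And>x y p. x \<in> B \<Longrightarrow> y \<in> B \<Longrightarrow> p \<in> ?I \<Longrightarrow> \<bar>f x p - f y p\<bar> < T"
    by (rule pigeonhole_boxes[of ?I ?A f R "\<lambda>_. T"])
      (use finite_E T finA neA in \<open>auto simp only: finite_cartesian_product finite intro!: bound R0\<close>)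
  obtain z0 where z0: "z0 \<in> B" using B(2) by blast
  let ?S = "{z \<in> Lambda. F W z \<le> 2 * real CARD('n) * T}"
  have BL: "B \<subseteq> Lambda" using B(1) vecL by blast
  have "(\<lambda>z. z - z0) ` B \<subseteq> ?S"
  proof clarify
    fix z assume z: "z \<in> B"
    have zL: "z \<in> Lambda" "z0 \<in> Lambda" using z z0 BL by auto
    have "norm (phi W \<sigma> (z - z0)) \<le> 2 * real CARD('n) * T" if \<sigma>: "\<sigma> \<in> E" for \<sigma>
    proof -
      have d: "phi W \<tau> (z - z0) = phi W \<tau> z - phi W \<tau> z0" if "\<tau> \<in> E" for \<tau>
        using that zL by (intro phi_diff Lambda_K)
      have comp: "norm (vec_nth (phi W \<sigma> (z - z0)) i) \<le> 2 * T" for i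
      proof -
        let ?c = "vec_nth (phi W \<sigma> (z - z0)) i"
        have "\<bar>re_im ?c\<bar> < T"
          using B(4)[OF z z0, of "(\<sigma>, i)"] \<sigma> by (simp add: f_def d re_im_diff)
        moreover have "cnj ?c = vec_nth (phi W (cj \<sigma>) (z - z0)) i"
          using zL by (subst phi_cj[OF \<sigma>]) (auto simp: cnj_vec_def intro: Lambda_K Lambda_diff diff_K)
        hence "\<bar>re_im (cnj ?c)\<bar> < T"
          using B(4)[OF z z0, of "(cj \<sigma>, i)"] cj_emb[OF \<sigma>] by (simp add: f_def d re_im_diff)
        ultimately show ?thesis using norm_le_re_im[of ?c] by linarith
      qed
      have "norm (phi W \<sigma> (z - z0)) \<le> (\<Sum>i\<in>UNIV. norm (vec_nth (phi W \<sigma> (z - z0)) i))"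
        unfolding norm_vec_def by (rule L2_set_le_sum) auto
      also have "\<dots> \<le> (\<Sum>i\<in>(UNIV :: 'n set). 2 * T)" by (intro sum_mono comp)
      finally show ?thesis by (simp add: mult_ac)
    qed
    thus "z - z0 \<in> Lambda \<and> F W (z - z0) \<le> 2 * real CARD('n) * T"
      using zL by (simp add: F_le_iff Lambda_diff)
  qed
  moreover have "inj_on (\<lambda>z. z - z0) B" by (auto simp: inj_on_def)
  ultimately have cB: "card B \<le> card ?S"
    using finite_F_ball[OF W] by (intro card_inj_on_le)
  let ?c = "4 * shear_bound * theta_bound + 2"
  have cI: "card ?I = ?N" by (simp add: card_cartesian_product card_E mult.commute)
  have "(\<Prod>p\<in>?I. 2 * R p / T + 2) \<le> (\<Prod>p\<in>?I. weight W (fst p) (snd p) * (?c * (real M / T)))"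
  proof (intro prod_mono conjI)
    fix p assume p: "p \<in> ?I"
    show "0 \<le> 2 * R p / T + 2" using R0[OF p] T by simp
    let ?w = "weight W (fst p) (snd p)"
    have w: "?w \<ge> 1" by (rule weight_ge_1[OF W])
    have "1 * 1 \<le> ?w * (real M / T)" using w M T by (intro mult_mono) auto
    moreover have "2 * R p / T = ?w * (4 * shear_bound * theta_bound * (real M / T))"
      by (simp add: R_def case_prod_unfold)
    moreover have "?w * (?c * (real M / T))
        = ?w * (4 * shear_bound * theta_bound * (real M / T)) + 2 * (?w * (real M / T))"
      by (simp only: distrib_left distrib_right mult_ac)
    ultimately show "2 * R p / T + 2 \<le> ?w * (?c * (real M / T))" by linarith
  qed
  also have "\<dots> = (\<Prod>\<sigma>\<in>E. \<Prod>i\<in>UNIV. weight W \<sigma> i) * (?c * (real M / T)) ^ ?N"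
    by (simp only: prod.distrib prod_constant cI prod.cartesian_product case_prod_unfold power_mult_distrib)
  also have "(\<Prod>\<sigma>\<in>E. \<Prod>i\<in>UNIV. weight W \<sigma> i) = W ^ (ambient_exponent K * (CARD('n) - 1))" (is "_ = ?V")
    by (rule prod_weight)
  finally have prod: "(\<Prod>p\<in>?I. 2 * R p / T + 2) \<le> ?V * (?c * (real M / T)) ^ ?N" .
  have "real M ^ ?N \<le> real (card B) * (\<Prod>p\<in>?I. 2 * R p / T + 2)"
    using B(3) by (simp add: cA)
  also have "\<dots> \<le> real (card ?S) * (?V * (?c * (real M / T)) ^ ?N)"
  proof (rule mult_mono)
    show "real (card B) \<le> real (card ?S)" using cB by simp
    show "0 \<le> (\<Prod>p\<in>?I. 2 * R p / T + 2)" using R0 T by (intro prod_nonneg) auto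
  qed (use prod in auto)
  also have "\<dots> = (real (card ?S) * ?V * ?c ^ ?N / T ^ ?N) * real M ^ ?N"
    by (simp add: power_mult_distrib power_divide)
  finally have "1 * real M ^ ?N \<le> (real (card ?S) * ?V * ?c ^ ?N / T ^ ?N) * real M ^ ?N"
    by (simp only: mult_1)
  hence "1 \<le> real (card ?S) * ?V * ?c ^ ?N / T ^ ?N"
    by (rule mult_right_le_imp_le) (use M0 in simp)
  hence "T ^ ?N \<le> real (card ?S) * ?V * ?c ^ ?N"
    using T by (simp add: pos_le_divide_eq)
  thus ?thesis by (simp only: mult_ac)
qed

text \<open>Compare the two counts of lattice points in the ball whose radius is the last minimum.\<close>

lemma prod_minima_le:
  "\<exists>C>0. \<forall>W\<ge>1. \<forall>xs. minimal_system W xs \<longrightarrow> length xs = CARD('n) \<longrightarrow>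
     (\<Prod>i<CARD('n). F W (xs ! i)) ^ deg \<le> C * W ^ (ambient_exponent K * (CARD('n) - 1))"
proof -
  let ?N = "CARD('n) * deg" and ?m = "real CARD('n)"
  let ?c = "4 * shear_bound * theta_bound + 2"
  define C where "C = (18 * ?m * (2 * ?m)) ^ ?N * ?c ^ ?N"
  have c0: "?c > 0" using shear_bound_ge_1 theta_bound_ge_1 by (intro add_nonneg_pos) auto
  have "(\<Prod>i<CARD('n). F W (xs ! i)) ^ deg \<le> C * W ^ (ambient_exponent K * (CARD('n) - 1))"
    if W: "W \<ge> 1" and xs: "minimal_system W xs" "length xs = CARD('n)" for W xs
  proof -
    let ?V = "W ^ (ambient_exponent K * (CARD('n) - 1))"
    define T where "T = F W (xs ! (CARD('n) - 1))"
    have T0: "T > 0" unfolding T_def using xs(2) by (intro minimal_system_pos[OF W xs(1)]) simp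
    have LT: "F W (xs ! i) \<le> T" if "i < CARD('n)" for i
      unfolding T_def using that xs(2) by (intro minimal_system_mono[OF xs(1)]) auto
    have m1: "?m \<ge> 1" by (simp add: Suc_leI)
    have "1 * T \<le> (2 * ?m) * T" using m1 T0 by (intro mult_right_mono) linarith+
    hence TT: "T \<le> 2 * ?m * T" by (simp only: mult_1)
    let ?S = "{z \<in> Lambda. F W z \<le> 2 * ?m * T}"
    let ?P = "(\<Prod>i<CARD('n). F W (xs ! i)) ^ deg"
    have P0: "?P \<ge> 0" using minimal_system_pos[OF W xs(1)] xs(2)
      by (intro zero_le_power prod_nonneg) (auto intro: less_imp_le)
    \<comment> \<open>The upper count is valid for every radius not below the last minimum; it is
      applied at the radius \<open>2 * ?m * T\<close> that the lower count produces.\<close>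
    have up: "real (card ?S) * ?P \<le> (18 * ?m * (2 * ?m * T)) ^ ?N"
      using LT TT by (intro card_F_ball_le[OF W xs]) (auto intro: order.trans)
    have low: "T ^ ?N \<le> real (card ?S) * ?c ^ ?N * ?V"
      using card_F_ball_ge[OF W T0] by simp
    have "T ^ ?N * ?P \<le> real (card ?S) * ?c ^ ?N * ?V * ?P"
      using low P0 by (intro mult_right_mono)
    also have "\<dots> = (real (card ?S) * ?P) * (?c ^ ?N * ?V)" by (simp only: mult_ac)
    also have "\<dots> \<le> (18 * ?m * (2 * ?m * T)) ^ ?N * (?c ^ ?N * ?V)"
      using up c0 W by (intro mult_right_mono) auto
    also have "\<dots> = T ^ ?N * (C * ?V)"
      by (simp only: C_def power_mult_distrib mult_ac)
    finally show ?thesis using T0 by simp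
  qed
  moreover have "C > 0" unfolding C_def using c0 by (intro mult_pos_pos zero_less_power) auto
  ultimately show ?thesis by blast
qed

end

section \<open>The subspaces spanned by the first minima\<close>

text \<open>Hadamard's inequality up to a constant: by Cauchy-Schwarz, each of the \<open>d!\<close>
  terms of the Leibniz formula for the Gram determinant is at most the squared product of the
  norms.\<close>

lemma abs_wedge_norm_le: "\<bar>wedge_norm Xs\<bar> \<le> sqrt (fact (length Xs)) * (\<Prod>i<length Xs. norm (Xs ! i))"
proof -
  define d where "d = length Xs"
  let ?P = "\<Prod>i<d. norm (Xs ! i)"
  have G: "gram_mat Xs \<in> carrier_mat d d" by (simp add: gram_mat_def d_def)
  have summand: "norm (signof p * (\<Prod>i = 0..<d. gram_mat Xs $$ (i, p i))) \<le> ?P\<^sup>2" if p: "p permutes {0..<d}" for p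
  proof -
    have pd: "p i < d" if "i < d" for i using permutes_in_image[OF p, of i] that by simp
    have "norm (signof p * (\<Prod>i = 0..<d. gram_mat Xs $$ (i, p i))) = (\<Prod>i = 0..<d. norm (gram_mat Xs $$ (i, p i)))"
      by (simp add: norm_mult sign_def prod_norm)
    also have "\<dots> \<le> (\<Prod>i = 0..<d. norm (Xs ! i) * norm (Xs ! (p i)))"
      using pd by (intro prod_mono) (auto simp: gram_mat_def d_def norm_hermitian_le)
    also have "\<dots> = (\<Prod>i = 0..<d. norm (Xs ! i)) * (\<Prod>i = 0..<d. norm (Xs ! (p i)))"
      by (rule prod.distrib)
    also have "(\<Prod>i = 0..<d. norm (Xs ! (p i))) = (\<Prod>i = 0..<d. norm (Xs ! i))"
      using prod.permute[OF p, of "\<lambda>i. norm (Xs ! i)"] by (simp add: comp_def)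
    finally show ?thesis by (simp add: power2_eq_square lessThan_atLeast0)
  qed
  have "\<bar>Re (Det (gram_mat Xs))\<bar> \<le> norm (Det (gram_mat Xs))"
    by (rule abs_Re_le_cmod)
  also have "\<dots> \<le> (\<Sum>p | p permutes {0..<d}. ?P\<^sup>2)"
    unfolding det_def'[OF G] by (intro sum_norm_le summand) simp
  also have "\<dots> = fact d * ?P\<^sup>2"
    by (simp add: card_permutations)
  finally have "sqrt \<bar>Re (Det (gram_mat Xs))\<bar> \<le> sqrt (fact d * ?P\<^sup>2)"
    by (rule real_sqrt_le_mono)
  also have "\<dots> = sqrt (fact d) * ?P"
    by (simp add: real_sqrt_mult prod_nonneg)
  finally have "sqrt \<bar>Re (Det (gram_mat Xs))\<bar> \<le> sqrt (fact d) * ?P" .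
  moreover have "\<bar>sqrt x\<bar> = sqrt \<bar>x\<bar>" for x
    by (cases "x \<ge> 0") (simp_all add: real_sqrt_minus abs_if)
  ultimately show ?thesis by (simp add: wedge_norm_def gram_mat_def d_def)
qed

text \<open>The transition matrix is lower triangular with unit diagonal.\<close>

lemma wedge_norm_shear:
  assumes len: "length Ys = length Xs" and d: "Xs \<noteq> []"
    and Y: "Ys ! 0 = Xs ! 0" "\<And>i. 0 < i \<Longrightarrow> i < length Xs \<Longrightarrow> Ys ! i = Xs ! i - t i *s Xs ! 0"
  shows "wedge_norm Ys = wedge_norm Xs"
proof -
  define d where "d = length Xs"
  have d0: "0 < d" using assms(2) by (simp add: d_def)
  define A where "A = Matrix.mat d d (\<lambda>(i, k). if i = k then 1 else if k = 0 then - t i else 0)"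
  have A: "A \<in> carrier_mat d d" by (simp add: A_def)
  have "wedge_norm Ys = norm (Det A) * wedge_norm Xs"
  proof (rule wedge_norm_linear_image[OF _ _ A])
    fix i assume i: "i < d"
    show "Ys ! i = (\<Sum>k<d. A $$ (i, k) *s Xs ! k)"
    proof (cases "i = 0")
      case True
      have "(\<Sum>k<d. A $$ (i, k) *s Xs ! k) = (\<Sum>k<d. if k = 0 then Xs ! 0 else 0)"
        using True i by (intro sum.cong) (auto simp: A_def)
      thus ?thesis using True d0 Y(1) by simp
    next
      case False
      have "(\<Sum>k<d. A $$ (i, k) *s Xs ! k)
          = (\<Sum>k<d. (if k = i then Xs ! i else 0) + (if k = 0 then - t i *s Xs ! 0 else 0))"
        using False i by (intro sum.cong) (auto simp: A_def)
      also have "\<dots> = Xs ! i - t i *s Xs ! 0" using i d0 by (simp add: sum.distrib)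
      finally show ?thesis using Y(2)[of i] False i by (simp add: d_def)
    qed
  qed (use len in \<open>auto simp: d_def\<close>)
  moreover have "Det A = prod_list (diag_mat A)"
    by (rule det_lower_triangular[OF _ A]) (auto simp: A_def)
  hence "Det A = 1"
    by (simp add: prod_list_diag_prod A_def)
  ultimately show ?thesis by simp
qed

lemma wedge_norm_orthogonal_pair:
  assumes "hermitian X Y = 0"
  shows "wedge_norm [X, Y] = norm X * norm Y"
proof -
  let ?G = "gram_mat [X, Y]"
  have G: "?G \<in> carrier_mat 2 2" by (rule carrier_matI) (simp_all add: gram_mat_def)
  have "hermitian Y X = 0" using assms hermitian_cnj[of Y X] by simp
  hence ut: "upper_triangular ?G"
    by (auto simp: gram_mat_def nth_Cons split: nat.splits)
  have "Det ?G = prod_list (diag_mat ?G)"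
    by (rule det_upper_triangular[OF ut G])
  also have "\<dots> = of_real ((norm X * norm Y)\<^sup>2)"
    by (simp add: prod_list_diag_prod gram_mat_def hermitian_self power_mult_distrib)
  finally have "Re (Det ?G) = (norm X * norm Y)\<^sup>2" by simp
  thus ?thesis by (simp add: wedge_norm_def gram_mat_def)
qed

text \<open>Subtracting from \<open>Y\<close> its projection on \<open>X\<close> leaves an
  orthogonal pair, whose volume is the product of the norms; for \<open>X = 0\<close> the quotient
  is 0 by convention. This bounds the infimum in \<open>first_angle\<close> from below.\<close>

lemma wedge_norm_pair_nonneg: "wedge_norm [X, Y] \<ge> 0"
proof -
  let ?Z = "Y - (hermitian Y X / hermitian X X) *s X"
  have "wedge_norm [X, ?Z] = wedge_norm [X, Y]"
    by (rule wedge_norm_shear[where t = "\<lambda>_. hermitian Y X / hermitian X X"]) (auto simp: less_Suc_eq)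
  moreover have "hermitian ?Z X = 0"
    by (cases "X = 0") (auto simp: hermitian_diff_left hermitian_scale_left hermitian_self)
  hence "hermitian X ?Z = 0" by (subst hermitian_cnj) simp
  hence "wedge_norm [X, ?Z] = norm X * norm ?Z" by (rule wedge_norm_orthogonal_pair)
  ultimately have "wedge_norm [X, Y] = norm X * norm ?Z" by metis
  thus ?thesis by (metis mult_nonneg_nonneg norm_ge_zero)
qed

lemma angle_nonneg: "angle X Y \<ge> 0"
  by (simp add: angle_def wedge_norm_pair_nonneg)

lemma first_angle_nonneg: "S - {0} \<noteq> {} \<Longrightarrow> first_angle u S \<ge> 0"
  unfolding first_angle_def by (intro cINF_greatest angle_nonneg)

lemma first_angle_le: "Y \<in> S \<Longrightarrow> Y \<noteq> 0 \<Longrightarrow> first_angle u S \<le> angle u Y"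
  unfolding first_angle_def
  by (intro cINF_lower bdd_belowI2[of _ 0] angle_nonneg) auto

text \<open>The multiple of \<open>u\<close> does not change the area spanned with \<open>u\<close>;
  \<open>sqrt 2\<close> is the constant of \<open>abs_wedge_norm_le\<close> for two vectors.\<close>

lemma angle_le:
  assumes "u \<noteq> 0"
  shows "angle u (c *s u + y) \<le> sqrt 2 * norm y / norm (c *s u + y)"
proof -
  have "wedge_norm [u, c *s u + y] = wedge_norm [u, y]"
    by (rule wedge_norm_shear[where t = "\<lambda>_. - c"]) (auto simp: less_Suc_eq vec.scale_minus_left)
  also have "\<dots> \<le> sqrt 2 * (norm u * norm y)"
    using abs_wedge_norm_le[of "[u, y]"] by (simp add: lessThan_Suc numeral_2_eq_2 mult_ac)
  finally have "wedge_norm [u, c *s u + y] / (norm u * norm (c *s u + y))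
      \<le> sqrt 2 * (norm u * norm y) / (norm u * norm (c *s u + y))"
    by (intro divide_right_mono) auto
  thus ?thesis using assms by (simp add: angle_def)
qed

lemma wedge_norm_cnj: "wedge_norm (map cnj_vec Xs) = wedge_norm Xs"
proof -
  have "gram_mat (map cnj_vec Xs) = map_mat cnj (gram_mat Xs)"
    by (rule eq_matI) (auto simp: gram_mat_def hermitian_cnj_vec)
  hence "Det (gram_mat (map cnj_vec Xs)) = cnj (Det (gram_mat Xs))"
    by simp
  thus ?thesis by (simp add: wedge_norm_def gram_mat_def)
qed

lemma norm_le_card_mult:
  fixes x :: "complex ^ 'n"
  assumes "\<And>i. norm (vec_nth x i) \<le> B"
  shows "norm x \<le> real CARD('n) * B"
proof -
  have "norm x \<le> (\<Sum>i\<in>UNIV. norm (vec_nth x i))"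
    unfolding norm_vec_def by (rule L2_set_le_sum) auto
  also have "\<dots> \<le> (\<Sum>i\<in>(UNIV :: 'n set). B)" by (intro sum_mono assms)
  finally show ?thesis by simp
qed

context approximation_setup
begin

text \<open>Complex independence implies real independence, so the same list serves for real and for
  complex \<open>K\<close>.\<close>

lemma rational_basis_minimal_system:
  assumes xs: "minimal_system W xs" and Zs: "distinct Zs" "set Zs \<subseteq> set xs"
  shows "rational_basis K (ambient_span K (set Zs)) Zs"
proof -
  have ind: "vec.independent (set Zs)"
    using minimal_systemD(3)[OF xs] Zs(2) vec.independent_mono by blast
  have "independent (set Zs)"
  proof (rule independent_if_scalars_zero)
    fix f x assume f: "(\<Sum>x\<in>set Zs. f x *\<^sub>R x) = 0" and x: "x \<in> set Zs"
    have "r *\<^sub>R y = complex_of_real r *s y" for r and y :: "complex ^ 'n"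
      by (simp add: cart_eq_iff) (simp add: scaleR_conv_of_real)
    hence "(\<Sum>x\<in>set Zs. complex_of_real (f x) *s x) = 0" using f by simp
    hence "complex_of_real (f x) = 0"
      using vec.independentD[OF ind, of "set Zs" "\<lambda>x. complex_of_real (f x)" x] x by auto
    thus "f x = 0" by simp
  qed auto
  moreover have "vec_nth X i \<in> K" if "X \<in> set Zs" for X i
    using minimal_systemD(1)[OF xs] Zs(2) that Lambda_K by blast
  ultimately show ?thesis
    using Zs(1) ind by (auto simp: rational_basis_def ambient_independent_def)
qed

text \<open>Among the basis vectors, \<open>x0\<close> has the relatively largest component along \<open>u\<close>. Subtracting multiples
  of it makes all other vectors transversal to \<open>u\<close>, hence short, and \<open>x0\<close> itself makes a small angle
  with \<open>u\<close>; if all these components vanish, the junk value \<open>0 / 0 = 0\<close> makes the argument uniform.\<close>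

lemma subspace_estimate:
  assumes ul: "vec_nth u l \<noteq> 0" and a: "\<And>i. a i = vec_nth u i / vec_nth u l"
    and d: "0 < d" "d \<le> CARD('n)"
  shows "\<exists>C>0. \<forall>W\<ge>1. \<forall>xs. minimal_system W xs \<longrightarrow> length xs = CARD('n) \<longrightarrow>
    (\<exists>S. rational_subspace K d S \<and> first_angle u S \<ge> 0 \<and>
       height K S \<le> C * (\<Prod>i<d. F W (xs ! i)) ^ deg / W ^ ((d - 1) * ambient_exponent K) \<and>
       height K S * first_angle u S ^ ambient_exponent K
         \<le> C * (\<Prod>i<d. F W (xs ! i)) ^ deg / W ^ (d * ambient_exponent K))"
proof -
  obtain C0 where C0: "C0 > 0" and height: "\<And>S (Xs :: (complex ^ 'n) list).
      rational_basis K S Xs \<Longrightarrow> \<forall>X\<in>set Xs. \<forall>i. vec_nth X i \<in> OK \<Longrightarrow>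
      height K S \<le> C0 * (\<Prod>\<sigma>\<in>E. \<bar>wedge_norm (map (conjugate_vec \<sigma>) Xs)\<bar>)"
    using height_le[where 'n = 'n] by (elim exE conjE) blast
  let ?m = "real CARD('n)" and ?q = "ambient_exponent K"
  \<comment> \<open>\<open>sqrt (fact d)\<close> comes from \<open>abs_wedge_norm_le\<close>. Each
    vector costs at most \<open>?m\<close> from coordinates to norm, 2 for the two terms of a
    difference, and \<open>shear_bound\<close> for undoing the shear.\<close>
  define D where "D = sqrt (fact d) * (2 * ?m * shear_bound) ^ d"
  have m1: "?m \<ge> 1" by (simp add: Suc_leI)
  have D0: "D > 0" using m1 shear_bound_ge_1 by (simp add: D_def)
  have u0: "u \<noteq> 0" using ul by auto
  let ?Sp = "{id_e, cj id_e}"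
  have Sp: "?Sp \<subseteq> E" using id_e cj_emb by auto
  have cSp: "card ?Sp = ?q"
    using cj_id_e_iff by (auto simp: ambient_exponent_def card_insert_if)
  have qdeg: "?q \<le> deg" using card_mono[OF finite_E Sp] by (simp only: cSp card_E)
  define C where "C = C0 * D ^ deg * sqrt 2 ^ ?q"
  have "\<exists>S. rational_subspace K d S \<and> first_angle u S \<ge> 0 \<and>
       height K S \<le> C * (\<Prod>i<d. F W (xs ! i)) ^ deg / W ^ ((d - 1) * ?q) \<and>
       height K S * first_angle u S ^ ?q \<le> C * (\<Prod>i<d. F W (xs ! i)) ^ deg / W ^ (d * ?q)"
    if W: "W \<ge> 1" and xs: "minimal_system W xs" "length xs = CARD('n)" for W xs
  proof -
    define alpha where "alpha x = vec_nth x l / vec_nth u l" for x :: "complex ^ 'n"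
    define y where "y x = x - alpha x *s u" for x :: "complex ^ 'n"
    let ?ys = "take d xs"
    have lys: "length ?ys = d" using d xs(2) by simp
    have ysxs: "set ?ys \<subseteq> set xs" by (rule set_take_subset)
    have dys: "distinct ?ys" using minimal_systemD(2)[OF xs(1)] by simp
    define r where "r x = norm (alpha x) / F W x" for x
    have fin: "finite (r ` set ?ys)" "r ` set ?ys \<noteq> {}" using lys d by auto
    obtain x0 where x0: "x0 \<in> set ?ys" "r x0 = Max (r ` set ?ys)"
      using Max_in[OF fin] by (metis imageE)
    have rmax: "r x \<le> r x0" if "x \<in> set ?ys" for x
      unfolding x0(2) using fin that by (intro Max_ge) auto
    define Zs where "Zs = x0 # remove1 x0 ?ys"
    have Zs: "distinct Zs" "set Zs = set ?ys" using x0(1) dys by (auto simp: Zs_def)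
    have lZ: "length Zs = d" using lys x0(1) d by (simp add: Zs_def length_remove1)
    have ZL: "Zs ! k \<in> Lambda" if "k < d" for k
      using that lZ Zs(2) ysxs minimal_systemD(1)[OF xs(1)] nth_mem[of k Zs] by blast
    have Z0: "Zs ! 0 = x0" by (simp add: Zs_def)
    define L where "L k = F W (Zs ! k)" for k
    have Lpos: "L k > 0" if "k < d" for k
      unfolding L_def
    proof (rule F_pos[OF W ZL[OF that]])
      have "Zs ! k \<in> set xs" using that lZ Zs(2) ysxs nth_mem[of k Zs] by blast
      thus "Zs ! k \<noteq> 0" using minimal_systemD(3)[OF xs(1)] vec.dependent_zero by metis
    qed
    let ?P = "\<Prod>i<d. F W (xs ! i)"
    have PL: "(\<Prod>k<d. L k) = ?P"
    proof -
      have "(\<Prod>k<d. L k) = (\<Prod>x\<in>set Zs. F W x)"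
        unfolding L_def using prod.reindex_bij_betw[OF bij_betw_nth[OF Zs(1) refl refl], of "F W"] lZ by simp
      also have "\<dots> = (\<Prod>k<d. F W (?ys ! k))"
        unfolding Zs(2) using prod.reindex_bij_betw[OF bij_betw_nth[OF dys refl refl], of "F W"] lys by simp
      finally show ?thesis by simp
    qed
    have P0: "?P > 0" using Lpos by (subst PL[symmetric]) (auto intro: prod_pos)
    have FL: "norm (phi W \<sigma> (Zs ! k)) \<le> L k" if "\<sigma> \<in> E" for \<sigma> k
      unfolding L_def by (rule norm_phi_le_F[OF that])
    have comp: "norm (\<sigma> (vec_nth (Zs ! k) i)) \<le> shear_bound * L k" if "\<sigma> \<in> E" for \<sigma> k i
      using norm_component_le[OF W, of \<sigma> "Zs ! k" i] FL[OF that, of k] shear_bound_ge_1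
      by (meson mult_left_mono order.trans zero_le_one)
    have norm_y: "norm (y (Zs ! k)) \<le> ?m * (L k / W)" if k: "k < d" for k
    proof (rule norm_le_card_mult)
      fix i
      show "norm (vec_nth (y (Zs ! k)) i) \<le> L k / W"
      proof (cases "i = l")
        case True
        thus ?thesis using ul Lpos[OF k] W by (simp add: y_def alpha_def)
      next
        case False
        have "vec_nth (phi W id_e (Zs ! k)) i = of_real W * vec_nth (y (Zs ! k)) i"
          using False Lambda_K[OF ZL[OF k]] ul
          by (simp add: phi_def weight_def shear_def id_e_apply y_def alpha_def a)
        hence "W * norm (vec_nth (y (Zs ! k)) i) = norm (vec_nth (phi W id_e (Zs ! k)) i)"
          using W by (simp add: norm_mult)
        also have "\<dots> \<le> L k"
          using Finite_Cartesian_Product.norm_nth_le[of "phi W id_e (Zs ! k)" i] FL[OF id_e, of k] by linarith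
        finally show ?thesis using W by (simp add: field_simps)
      qed
    qed
    define t where "t k = alpha (Zs ! k) / alpha x0" for k
    define Xs where "Xs = map (\<lambda>k. if k = 0 then x0 else Zs ! k - t k *s x0) [0..<d]"
    have X: "length Xs = d" "Xs ! 0 = x0" "\<And>k. 0 < k \<Longrightarrow> k < d \<Longrightarrow> Xs ! k = Zs ! k - t k *s x0"
      using d by (auto simp: Xs_def)
    have ratio: "norm (alpha (Zs ! k)) / L k \<le> norm (alpha x0) / L 0" if "k < d" for k
    proof -
      have "Zs ! k \<in> set ?ys" using that lZ Zs(2) nth_mem[of k Zs] by blast
      thus ?thesis using rmax[of "Zs ! k"] by (simp add: r_def L_def Z0)
    qed
    have t_alpha: "t k * alpha x0 = alpha (Zs ! k)" if k: "k < d" for k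
    proof (cases "alpha x0 = 0")
      case True
      hence "norm (alpha (Zs ! k)) / L k \<le> 0" using ratio[OF k] by simp
      hence "norm (alpha (Zs ! k)) \<le> 0" using Lpos[OF k] by (simp add: divide_le_0_iff)
      thus ?thesis using True by simp
    qed (simp add: t_def)
    \<comment> \<open>The maximality of the ratio at \<open>x0\<close> is used here: the subtracted
      multiple of \<open>x0\<close> has size at most that of the vector it is subtracted from, as
      measured by \<open>L\<close>.\<close>
    have t_le: "norm (t k) \<le> L k / L 0" if k: "k < d" for k
    proof (cases "alpha x0 = 0")
      case True
      thus ?thesis using Lpos[OF k] Lpos[OF d(1)] by (simp add: t_def)
    next
      case False
      thus ?thesis using ratio[OF k] Lpos[OF k] Lpos[OF d(1)] by (simp add: t_def norm_divide field_simps)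
    qed
    have norm_X: "norm (Xs ! k) \<le> 2 * ?m * (L k / W)" if k: "0 < k" "k < d" for k
    proof -
      \<comment> \<open>The components along \<open>u\<close> cancel by \<open>t_alpha\<close>; only
        transversal parts remain, and each of them carries the factor \<open>1 / W\<close>.\<close>
      have "Xs ! k = y (Zs ! k) - t k *s y x0"
        using k t_alpha[OF k(2)]
        by (simp add: X(3) y_def vec.scale_right_diff_distrib)
      hence "norm (Xs ! k) \<le> norm (y (Zs ! k)) + norm (t k) * norm (y x0)"
        using norm_triangle_ineq4[of "y (Zs ! k)" "t k *s y x0"] by (simp add: norm_scale_complex)
      also have "\<dots> \<le> ?m * (L k / W) + (L k / L 0) * (?m * (L 0 / W))"
        using norm_y[OF k(2)] norm_y[OF d(1)] t_le[OF k(2)] Lpos[OF k(2)] Lpos[OF d(1)]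
        by (intro add_mono mult_mono) (auto simp: Z0)
      also have "\<dots> = 2 * ?m * (L k / W)" using Lpos[OF d(1)] by simp
      finally show ?thesis .
    qed
    define w where "w = \<bar>wedge_norm Zs\<bar>"
    define cw where "cw \<sigma> = \<bar>wedge_norm (map (conjugate_vec \<sigma>) Zs)\<bar>" for \<sigma>
    \<comment> \<open>\<open>norm x0\<close> is kept instead of a bound by \<open>L 0\<close>, so
      that in \<open>w2\<close> it cancels against the denominator of the angle.\<close>
    have w_le: "w \<le> sqrt (fact d) * norm x0 * (\<Prod>k\<in>{1..<d}. 2 * ?m * (L k / W))"
    proof -
      have "Zs \<noteq> []" by (simp add: Zs_def)
      hence "wedge_norm Xs = wedge_norm Zs"
        by (intro wedge_norm_shear[where t = t]) (auto simp: X lZ Z0)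
      hence "w \<le> sqrt (fact d) * (\<Prod>k<d. norm (Xs ! k))"
        using abs_wedge_norm_le[of Xs] by (simp add: w_def X(1))
      also have "{..<d} = insert 0 {1..<d}" using d by auto
      also have "(\<Prod>k\<in>insert 0 {1..<d}. norm (Xs ! k)) = norm x0 * (\<Prod>k\<in>{1..<d}. norm (Xs ! k))"
        by (simp add: X(2))
      also have "sqrt (fact d) * \<dots> \<le> sqrt (fact d) * (norm x0 * (\<Prod>k\<in>{1..<d}. 2 * ?m * (L k / W)))"
        using norm_X by (intro mult_left_mono prod_mono) auto
      finally show ?thesis by (simp only: mult.assoc)
    qed
    have tail: "L 0 * (\<Prod>k\<in>{1..<d}. 2 * ?m * (L k / W)) = (2 * ?m) ^ (d - 1) * ?P / W ^ (d - 1)"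
    proof -
      have "{..<d} = insert 0 {1..<d}" using d by auto
      hence "(\<Prod>k<d. L k) = L 0 * (\<Prod>k\<in>{1..<d}. L k)" by simp
      hence "?P = L 0 * (\<Prod>k\<in>{1..<d}. L k)" by (simp only: PL)
      thus ?thesis by (simp add: prod.distrib prod_dividef)
    qed
    have pow: "(2 * ?m) ^ (d - 1) * ?m \<le> (2 * ?m) ^ d"
      using d m1 by (cases d) (auto simp: mult.commute)
    have "(2 * ?m) ^ d * shear_bound \<le> (2 * ?m) ^ d * shear_bound ^ d"
      using d shear_bound_ge_1 m1 self_le_power[of shear_bound d] by (intro mult_left_mono) auto
    hence sb: "(2 * ?m) ^ d * shear_bound \<le> (2 * ?m * shear_bound) ^ d" by (simp add: power_mult_distrib)
    have "(2 * ?m) ^ d * 1 \<le> (2 * ?m) ^ d * shear_bound"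
      using shear_bound_ge_1 by (intro mult_left_mono) auto
    also note sb
    finally have sb': "(2 * ?m) ^ d \<le> (2 * ?m * shear_bound) ^ d" by (simp only: mult_1_right)
    have L0: "L 0 > 0" by (rule Lpos[OF d(1)])
    have T0: "(\<Prod>k\<in>{1..<d}. 2 * ?m * (L k / W)) \<ge> 0"
      using Lpos W by (intro prod_nonneg) (auto intro!: divide_nonneg_nonneg less_imp_le)
    have x0_le: "norm x0 \<le> ?m * (shear_bound * L 0)"
      using comp[OF id_e, of 0] Lambda_K[OF ZL[OF d(1)]] by (intro norm_le_card_mult) (simp add: Z0 id_e_apply)
    have w1: "w \<le> D * ?P / W ^ (d - 1)"
    proof -
      have "w \<le> sqrt (fact d) * (?m * (shear_bound * L 0)) * (\<Prod>k\<in>{1..<d}. 2 * ?m * (L k / W))"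
        using w_le x0_le T0 by (intro order.trans[OF w_le] mult_right_mono mult_left_mono) auto
      also have "\<dots> = sqrt (fact d) * (?m * shear_bound) * (L 0 * (\<Prod>k\<in>{1..<d}. 2 * ?m * (L k / W)))"
        by (simp only: mult_ac)
      also have "\<dots> = sqrt (fact d) * (((2 * ?m) ^ (d - 1) * ?m) * shear_bound) * (?P / W ^ (d - 1))"
        unfolding tail by (simp add: mult_ac)
      also have "\<dots> \<le> D * (?P / W ^ (d - 1))"
        unfolding D_def
      proof (intro mult_right_mono mult_left_mono)
        have "(2 * ?m) ^ (d - 1) * ?m * shear_bound \<le> (2 * ?m) ^ d * shear_bound"
          using pow shear_bound_ge_1 by (intro mult_right_mono) auto
        thus "(2 * ?m) ^ (d - 1) * ?m * shear_bound \<le> (2 * ?m * shear_bound) ^ d" using sb by linarith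
      qed (use P0 W in auto)
      finally show ?thesis by simp
    qed
    have x0_nz: "norm x0 > 0"
    proof -
      have "x0 \<noteq> 0" using x0(1) ysxs minimal_systemD(3)[OF xs(1)] vec.dependent_zero by blast
      thus ?thesis by simp
    qed
    have ang: "angle u x0 \<le> sqrt 2 * (?m * (L 0 / W)) / norm x0"
    proof -
      have "x0 = alpha x0 *s u + y x0" by (simp add: y_def)
      hence "angle u x0 \<le> sqrt 2 * norm (y x0) / norm x0" using angle_le[OF u0] by metis
      also have "\<dots> \<le> sqrt 2 * (?m * (L 0 / W)) / norm x0"
        using norm_y[OF d(1)] by (intro divide_right_mono mult_left_mono) (auto simp: Z0)
      finally show ?thesis .
    qed
    have w2: "w * angle u x0 \<le> sqrt 2 * (D * ?P / W ^ d)"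
    proof -
      have "w * angle u x0 \<le> (sqrt (fact d) * norm x0 * (\<Prod>k\<in>{1..<d}. 2 * ?m * (L k / W)))
          * (sqrt 2 * (?m * (L 0 / W)) / norm x0)"
        using w_le ang T0 angle_nonneg by (intro mult_mono) auto
      also have "\<dots> = sqrt 2 * (sqrt (fact d) * (?m * (1 / W)) * (L 0 * (\<Prod>k\<in>{1..<d}. 2 * ?m * (L k / W))))"
        using x0_nz by simp
      also have "\<dots> = sqrt 2 * (sqrt (fact d) * ((2 * ?m) ^ (d - 1) * ?m) * (?P / W ^ d))"
        unfolding tail using d by (cases d) (simp_all add: mult_ac)
      also have "\<dots> \<le> sqrt 2 * (D * (?P / W ^ d))"
        unfolding D_def using pow sb' P0 W by (intro mult_left_mono mult_right_mono) auto
      finally show ?thesis by simp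
    qed
    \<comment> \<open>No power of \<open>W\<close> is gained here; the bound serves the embeddings
      outside \<open>?Sp\<close>.\<close>
    have other: "cw \<sigma> \<le> D * ?P" if \<sigma>: "\<sigma> \<in> E" for \<sigma>
    proof -
      have "cw \<sigma> \<le> sqrt (fact d) * (\<Prod>k<d. norm (conjugate_vec \<sigma> (Zs ! k)))"
        using abs_wedge_norm_le[of "map (conjugate_vec \<sigma>) Zs"] by (simp add: lZ cw_def)
      also have "\<dots> \<le> sqrt (fact d) * (\<Prod>k<d. (2 * ?m * shear_bound) * L k)"
      proof (intro mult_left_mono prod_mono conjI)
        fix k assume "k \<in> {..<d}"
        have "norm (conjugate_vec \<sigma> (Zs ! k)) \<le> ?m * (shear_bound * L k)"
          using comp[OF \<sigma>] by (intro norm_le_card_mult) (simp add: conjugate_vec_def)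
        also have "\<dots> \<le> 2 * (?m * (shear_bound * L k))"
          using Lpos[of k] \<open>k \<in> {..<d}\<close> shear_bound_ge_1 by simp
        finally show "norm (conjugate_vec \<sigma> (Zs ! k)) \<le> (2 * ?m * shear_bound) * L k" by (simp add: mult_ac)
      qed auto
      finally show ?thesis by (simp add: prod.distrib D_def PL[symmetric] mult_ac power_mult_distrib)
    qed
    \<comment> \<open>Conjugating all vectors conjugates the Gram determinant, so both distinguished
      embeddings see the same volume.\<close>
    have special: "cw \<sigma> = w" if \<sigma>: "\<sigma> \<in> ?Sp" for \<sigma>
    proof -
      have ZK: "vec_nth z i \<in> K" if "z \<in> set Zs" for z i
        using that Zs(2) ysxs minimal_systemD(1)[OF xs(1)] Lambda_K by blast
      have "map (conjugate_vec id_e) Zs = map (\<lambda>z. z) Zs"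
        using ZK by (intro map_cong) (auto simp: conjugate_vec_def id_e_apply cart_eq_iff)
      moreover have "map (conjugate_vec (cj id_e)) Zs = map cnj_vec Zs"
        using ZK by (intro map_cong) (auto simp: conjugate_vec_def cnj_vec_def cj_id_e_apply cart_eq_iff)
      ultimately have "wedge_norm (map (conjugate_vec id_e) Zs) = wedge_norm Zs"
        "wedge_norm (map (conjugate_vec (cj id_e)) Zs) = wedge_norm Zs"
        by (simp_all only: wedge_norm_cnj list.map_ident)
      thus ?thesis using \<sigma> unfolding w_def cw_def by (elim insertE) simp_all
    qed
    define S where "S = ambient_span K (set Zs)"
    have basis: "rational_basis K S Zs"
      unfolding S_def using Zs ysxs by (intro rational_basis_minimal_system[OF xs(1)]) auto
    have "rational_subspace K d S" unfolding rational_subspace_def using basis lZ by blast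
    moreover have x0S: "x0 \<in> S" "x0 \<noteq> 0" using rational_basisD(4)[OF basis] x0_nz by (auto simp: Zs_def)
    hence fa: "first_angle u S \<ge> 0" "first_angle u S \<le> angle u x0"
      by (auto intro: first_angle_nonneg first_angle_le)
    moreover have hS: "height K S \<le> C0 * (w ^ ?q * (D * ?P) ^ (deg - ?q))"
    proof -
      have "\<forall>X\<in>set Zs. \<forall>i. vec_nth X i \<in> OK"
        using Zs(2) ysxs minimal_systemD(1)[OF xs(1)] by (auto simp: Lambda_def)
      hence "height K S \<le> C0 * (\<Prod>\<sigma>\<in>E. cw \<sigma>)"
        unfolding cw_def by (rule height[OF basis])
      also have "(\<Prod>\<sigma>\<in>E. cw \<sigma>)
          = (\<Prod>\<sigma>\<in>E - ?Sp. cw \<sigma>) * (\<Prod>\<sigma>\<in>?Sp. cw \<sigma>)"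
        by (rule prod.subset_diff[OF Sp finite_E])
      also have "(\<Prod>\<sigma>\<in>?Sp. cw \<sigma>) = (\<Prod>\<sigma>\<in>?Sp. w)"
        by (rule prod.cong[OF refl special])
      also have "\<dots> = w ^ ?q" by (simp only: prod_constant cSp)
      also have "C0 * ((\<Prod>\<sigma>\<in>E - ?Sp. cw \<sigma>) * w ^ ?q)
          \<le> C0 * ((\<Prod>\<sigma>\<in>E - ?Sp. D * ?P) * w ^ ?q)"
        using other C0 by (intro mult_left_mono mult_right_mono prod_mono) (auto simp: w_def cw_def)
      also have "(\<Prod>\<sigma>\<in>E - ?Sp. D * ?P) = (D * ?P) ^ (deg - ?q)"
        by (simp only: prod_constant card_Diff_subset[OF finite_subset[OF Sp finite_E] Sp] cSp card_E)
      finally show ?thesis by (simp only: mult.commute)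
    qed
    have split: "X ^ ?q * X ^ (deg - ?q) = X ^ deg" for X :: real
      using qdeg by (simp flip: power_add)
    have DP: "D * ?P > 0" using D0 P0 by simp
    have w0: "w \<ge> 0" by (simp add: w_def)
    have s2: "sqrt 2 ^ ?q \<ge> (1 :: real)" by (intro one_le_power) simp
    have h1: "height K S \<le> C * ?P ^ deg / W ^ ((d - 1) * ?q)"
    proof -
      have "C0 * (w ^ ?q * (D * ?P) ^ (deg - ?q)) \<le> C0 * ((D * ?P / W ^ (d - 1)) ^ ?q * (D * ?P) ^ (deg - ?q))"
        using w1 w0 C0 DP by (intro mult_left_mono mult_right_mono power_mono) auto
      also have "\<dots> = C0 * ((D * ?P) ^ deg / W ^ ((d - 1) * ?q))"
        unfolding split[symmetric] by (simp add: power_divide power_mult)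
      \<comment> \<open>The factor, which stems from the angle, is inserted so that one constant
        \<open>C\<close> serves both bounds.\<close>
      also have "\<dots> \<le> C0 * ((D * ?P) ^ deg / W ^ ((d - 1) * ?q)) * sqrt 2 ^ ?q"
      proof -
        have "0 \<le> C0 * ((D * ?P) ^ deg / W ^ ((d - 1) * ?q))" using C0 DP W by simp
        thus ?thesis using mult_left_mono[OF s2] by fastforce
      qed
      finally show ?thesis using hS by (simp add: C_def power_mult_distrib mult_ac)
    qed
    have h2: "height K S * first_angle u S ^ ?q \<le> C * ?P ^ deg / W ^ (d * ?q)"
    proof -
      have "height K S * first_angle u S ^ ?q \<le> C0 * (w ^ ?q * (D * ?P) ^ (deg - ?q)) * angle u x0 ^ ?q"
        using hS fa w0 DP C0 by (intro mult_mono power_mono) auto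
      also have "\<dots> = C0 * ((w * angle u x0) ^ ?q * (D * ?P) ^ (deg - ?q))"
        by (simp add: power_mult_distrib mult_ac)
      also have "\<dots> \<le> C0 * ((sqrt 2 * (D * ?P / W ^ d)) ^ ?q * (D * ?P) ^ (deg - ?q))"
        using w2 mult_nonneg_nonneg[OF w0 angle_nonneg[of u x0]] C0 DP
        by (intro mult_left_mono mult_right_mono power_mono) auto
      also have "\<dots> = C * ?P ^ deg / W ^ (d * ?q)"
      proof -
        have "(sqrt 2 * (D * ?P / W ^ d)) ^ ?q * (D * ?P) ^ (deg - ?q)
            = sqrt 2 ^ ?q * ((D * ?P) ^ ?q * (D * ?P) ^ (deg - ?q)) / W ^ (d * ?q)"
          by (simp add: power_divide power_mult power_mult_distrib)
        thus ?thesis unfolding split by (simp add: C_def power_mult_distrib mult_ac)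
      qed
      finally show ?thesis .
    qed
    show ?thesis using calculation(1) fa(1) h1 h2 by blast
  qed
  moreover have "C > 0" using C0 D0 by (simp add: C_def)
  ultimately show ?thesis by blast
qed

end

text \<open>The geometric mean of the \<open>d\<close> smallest values is at most that of all. The
  value \<open>L d\<close> separates the two groups: the first product is at most
  \<open>L d ^ d\<close> and the rest at least \<open>L d ^ (m - d)\<close>.\<close>

lemma prod_initial_le:
  fixes L :: "nat \<Rightarrow> real"
  assumes "d \<le> m" and pos: "\<And>i. i < m \<Longrightarrow> L i > 0"
    and mono: "\<And>i k. i \<le> k \<Longrightarrow> k < m \<Longrightarrow> L i \<le> L k"
  shows "(\<Prod>i<d. L i) ^ m \<le> (\<Prod>i<m. L i) ^ d"
proof (cases "d = m")
  case False
  hence dm: "d < m" using assms(1) by simp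
  let ?P = "\<Prod>i<d. L i" and ?R = "\<Prod>i\<in>{d..<m}. L i"
  have P0: "?P > 0" using pos dm by (intro prod_pos) auto
  have "?P \<le> (\<Prod>i<d. L d)" using pos mono dm by (intro prod_mono) (auto simp: less_imp_le)
  hence P: "?P \<le> L d ^ d" by simp
  have "(\<Prod>i\<in>{d..<m}. L d) \<le> ?R" using pos mono dm by (intro prod_mono) (auto simp: less_imp_le)
  hence R: "L d ^ (m - d) \<le> ?R" by simp
  have "?P ^ (m - d) \<le> (L d ^ d) ^ (m - d)" using P P0 by (intro power_mono) auto
  also have "\<dots> = (L d ^ (m - d)) ^ d" by (simp only: power_mult[symmetric] mult.commute)
  also have "\<dots> \<le> ?R ^ d" using R pos[OF dm] by (intro power_mono) auto
  finally have "?P ^ d * ?P ^ (m - d) \<le> ?P ^ d * ?R ^ d" using P0 by (intro mult_left_mono) auto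
  moreover have "?P ^ d * ?P ^ (m - d) = ?P ^ m" using dm by (simp flip: power_add)
  moreover have "?P * ?R = (\<Prod>i<m. L i)"
    using prod.atLeastLessThan_concat[of 0 d m L] dm by (simp add: lessThan_atLeast0)
  ultimately show ?thesis by (metis power_mult_distrib)
qed simp

section \<open>From the parameter \<open>W\<close> to the exponents of approximation\<close>

theorem theorem1:
  fixes n j :: nat and K :: "complex set" and u :: "complex ^ 'n"
  assumes "n \<ge> 1" and "CARD('n) = n + 1"
    and "number_field K"
    and "u \<in> ambient K" and "u \<noteq> 0"
    and "j \<le> n - 1"
  shows "exponent K j u \<ge> uniform_exponent K j u \<and>
         uniform_exponent K j u \<ge> ereal ((real j + 1) / (real n - real j))"
proof
  show "uniform_exponent K j u \<le> exponent K j u"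
    unfolding uniform_exponent_def exponent_def
    by (intro Sup_subset_mono image_mono Collect_mono impI eventually_frequently) simp_all
next
  obtain l where l: "vec_nth u l \<noteq> 0"
    using assms(5) by (auto simp: cart_eq_iff)
  define a where "a i = vec_nth u i / vec_nth u l" for i
  interpret approximation_setup K a l
  proof
    show "number_field K" by (rule assms(3))
    fix i assume "K \<subseteq> \<real>"
    thus "a i \<in> \<real>" using assms(4) by (simp add: a_def ambient_def)
  qed
  let ?q = "ambient_exponent K" and ?d = "j + 1"
  have j: "j < n" using assms(1,6) by simp
  note m = assms(2)
  obtain C1 where C1: "C1 > 0" and minima: "\<forall>W\<ge>1. \<forall>xs. minimal_system W xs \<longrightarrow> length xs = n + 1 \<longrightarrow>
     (\<Prod>i<n + 1. F W (xs ! i)) ^ deg \<le> C1 * W ^ (?q * n)"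
    using prod_minima_le unfolding m add_diff_cancel_right' by (elim exE conjE)
  have "0 < ?d" "?d \<le> CARD('n)" using j m by auto
  note est = subspace_estimate[OF l a_def this, unfolded m add_diff_cancel_right']
  obtain C2 where C2: "C2 > 0" and subspace: "\<forall>W\<ge>1. \<forall>xs. minimal_system W xs \<longrightarrow> length xs = n + 1 \<longrightarrow>
    (\<exists>S. rational_subspace K ?d S \<and> first_angle u S \<ge> 0 \<and>
       height K S \<le> C2 * (\<Prod>i<?d. F W (xs ! i)) ^ deg / W ^ (j * ?q) \<and>
       height K S * first_angle u S ^ ?q \<le> C2 * (\<Prod>i<?d. F W (xs ! i)) ^ deg / W ^ (?d * ?q))"
    using est by (elim exE conjE)
  define e1 where "e1 = real ?q * (real n - real j) / (real n + 1)"
  define e2 where "e2 = real ?q * (real j + 1) / (real n + 1)"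
  define tau where "tau = (real j + 1) / (real n - real j)"
  define C where "C = C2 * C1 powr (real ?d / real (n + 1))"
  have q: "?q > 0" by (simp add: ambient_exponent_def)
  have e1: "e1 > 0" using j q by (simp add: e1_def)
  have e2: "e2 = tau * e1" using j by (simp add: e1_def e2_def tau_def)
  have C: "C > 0" using C1 C2 by (simp add: C_def)
  have key: "\<exists>S. rational_subspace K ?d S \<and> height K S \<le> C * W powr e1 \<and>
      height K S * first_angle u S ^ ?q \<le> C * W powr (- e2)" if W: "W \<ge> 1" for W :: real
  proof -
    obtain xs where xs: "length xs = n + 1" "minimal_system W xs"
      using minimal_system_exists[OF W, of "n + 1"] m by auto
    let ?P = "\<Prod>i<?d. F W (xs ! i)" and ?R = "\<Prod>i<n + 1. F W (xs ! i)"
    have pos: "F W (xs ! i) > 0" if "i < n + 1" for i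
      using minimal_system_pos[OF W xs(2)] xs(1) that by simp
    have P0: "?P > 0" using pos j by (intro prod_pos) auto
    have R0: "?R > 0" using pos by (intro prod_pos) auto
    have "?P ^ (n + 1) \<le> ?R ^ ?d"
      using j xs(1) by (intro prod_initial_le pos minimal_system_mono[OF xs(2)]) auto
    hence "(?P ^ (n + 1)) ^ deg \<le> (?R ^ ?d) ^ deg" using P0 by (intro power_mono) auto
    hence "(?P ^ deg) ^ (n + 1) \<le> (?R ^ deg) ^ ?d"
      by (simp only: power_mult[symmetric] mult.commute)
    also have "\<dots> \<le> (C1 * W ^ (?q * n)) ^ ?d"
      using minima W xs R0 by (intro power_mono) auto
    finally have "((?P ^ deg) ^ (n + 1)) powr (1 / real (n + 1)) \<le> ((C1 * W ^ (?q * n)) ^ ?d) powr (1 / real (n + 1))"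
      using P0 by (intro powr_mono2) auto
    moreover have root: "(X ^ k) powr b = X powr (real k * b)" if "X > 0" for X b :: real and k
      using that by (simp add: powr_realpow[symmetric] powr_powr)
    have "((?P ^ deg) ^ (n + 1)) powr (1 / real (n + 1)) = ?P ^ deg"
      using P0 by (subst root) (simp_all del: prod.lessThan_Suc)
    moreover have "((C1 * W ^ (?q * n)) ^ ?d) powr (1 / real (n + 1))
        = C1 powr (real ?d / real (n + 1)) * W powr (real (?q * n) * (real ?d / real (n + 1)))"
      using C1 W root[of "C1 * W ^ (?q * n)" ?d "1 / real (n + 1)"] root[of W "?q * n" "real ?d / real (n + 1)"]
      by (simp add: powr_mult)
    ultimately have P: "?P ^ deg \<le> C1 powr (real ?d / real (n + 1)) * W powr (real (?q * n) * (real ?d / real (n + 1)))"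
      by simp
    obtain S where S: "rational_subspace K ?d S" "first_angle u S \<ge> 0"
      "height K S \<le> C2 * ?P ^ deg / W ^ (j * ?q)"
      "height K S * first_angle u S ^ ?q \<le> C2 * ?P ^ deg / W ^ (?d * ?q)"
      using subspace W xs by blast
    have bound: "C2 * ?P ^ deg / W ^ k \<le> C * W powr (real (?q * n) * (real ?d / real (n + 1)) - real k)" for k
    proof -
      have "C2 * ?P ^ deg / W ^ k \<le> C2 * (C1 powr (real ?d / real (n + 1)) * W powr (real (?q * n) * (real ?d / real (n + 1)))) / W ^ k"
        using P C2 W by (intro divide_right_mono mult_left_mono) auto
      also have "\<dots> = C * (W powr (real (?q * n) * (real ?d / real (n + 1))) / W powr real k)"
        using W by (simp add: C_def powr_realpow)
      finally show ?thesis by (simp only: powr_diff)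
    qed
    have "real (?q * n) * (real ?d / real (n + 1)) - real (j * ?q) = e1"
      unfolding e1_def by (simp add: field_simps)
    moreover have "real (?q * n) * (real ?d / real (n + 1)) - real (?d * ?q) = - e2"
      unfolding e2_def by (simp add: field_simps)
    ultimately show ?thesis
      using S bound[of "j * ?q"] bound[of "?d * ?q"] by (intro exI[of _ S]) (auto intro: order.trans)
  qed
  have ev: "\<forall>\<^sub>F Q in at_top. approximable K u j w Q" if w: "w < tau" for w
  proof -
    \<comment> \<open>The constant enters twice, through \<open>W powr e1 = Q / C\<close> and in
      front of the bound. For \<open>w < tau\<close> the spare power of \<open>Q\<close> absorbs
      both.\<close>
    have "\<forall>\<^sub>F Q in at_top. C powr (1 + tau) \<le> Q powr (tau - w)"
    proof (rule eventually_mono[OF eventually_ge_at_top[of "(C powr (1 + tau)) powr (1 / (tau - w))"]])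
      fix Q assume Q: "(C powr (1 + tau)) powr (1 / (tau - w)) \<le> Q"
      have "C powr (1 + tau) = ((C powr (1 + tau)) powr (1 / (tau - w))) powr (tau - w)"
        using w C by (simp add: powr_powr)
      also have "\<dots> \<le> Q powr (tau - w)" using Q w by (intro powr_mono2) auto
      finally show "C powr (1 + tau) \<le> Q powr (tau - w)" .
    qed
    moreover have "\<forall>\<^sub>F Q in at_top. Q \<ge> C" by (rule eventually_ge_at_top)
    ultimately show ?thesis
    proof eventually_elim
      case (elim Q)
      have Q: "Q > 0" using elim(2) C by simp
      \<comment> \<open>Chosen so that the height bound \<open>C * W powr e1\<close> equals
        \<open>Q\<close>; then \<open>Q \<ge> C\<close> gives \<open>W \<ge> 1\<close>.\<close>
      define W where "W = (Q / C) powr (1 / e1)"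
      have W: "W \<ge> 1" unfolding W_def using elim(2) C e1 by (intro ge_one_powr_ge_zero) auto
      have We: "W powr e1 = Q / C" unfolding W_def using e1 Q C by (simp add: powr_powr)
      obtain S where S: "rational_subspace K ?d S" "height K S \<le> C * W powr e1"
        "height K S * first_angle u S ^ ?q \<le> C * W powr (- e2)"
        using key[OF W] by blast
      have "C * W powr (- e2) = C * (Q / C) powr (- tau)"
        by (simp add: e2 We[symmetric] powr_powr mult.commute)
      also have "\<dots> = C powr (1 + tau) * Q powr (- tau)"
        using C Q by (simp add: powr_divide powr_minus powr_add divide_simps)
      also have "\<dots> \<le> Q powr (tau - w) * Q powr (- tau)"
        using elim(1) by (intro mult_right_mono) auto
      also have "\<dots> = Q powr (- w)" by (simp add: powr_add[symmetric])
      finally have "height K S * first_angle u S ^ ?q \<le> Q powr (- w)" using S(3) by linarith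
      moreover have "height K S \<le> Q" using S(2) C by (simp add: We)
      ultimately show ?case unfolding approximable_def using S(1) by blast
    qed
  qed
  \<comment> \<open>The constants cost an arbitrarily small power of \<open>Q\<close>, so
    \<open>tau\<close> is obtained as the supremum of the exponents \<open>w < tau\<close>.\<close>
  show "ereal ((real j + 1) / (real n - real j)) \<le> uniform_exponent K j u"
    unfolding uniform_exponent_def tau_def[symmetric] le_Sup_iff
  proof (intro allI impI)
    fix z assume "z < ereal tau"
    then obtain w where w: "z < ereal w" "ereal w < ereal tau" using ereal_dense2 by blast
    hence "ereal w \<in> ereal ` {w. \<forall>\<^sub>F Q in at_top. approximable K u j w Q}" using ev[of w] by auto
    thus "\<exists>a\<in>ereal ` {w. \<forall>\<^sub>F Q in at_top. approximable K u j w Q}. z < a" using w(1) by blast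
  qed
qed

end
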